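(* Assume there is a constant $u^*>0$ such that $$\min_{\sigma\in[s,u^*]}g(\sigma)>f(s)\ \text{ for } 0<s<u^*,\qquad \max_{\sigma\in[u^*,s]}g(\sigma)<f(s)\ \text{ for } u^*<s\le B,$$ and that $f'(0),g'(0)$ exist with $g'(0)>f'(0)>0$, and $f(s)>f(0)$ for all $s>0$. Assume there is a unique constant $M>0$ such that $g(M)=\max_{s\in[0,\infty)}g(s)$, that $g$ is nondecreasing on $(0,M)$ and nonincreasing on $(M,B)$, and that $u^*>M$. Assume $$f(s)<f(M)\ \text{ for } 0\le s<M,\qquad f(s)>f(M)\ \text{ for } M<s\le B.$$ Assume the set $\{s\in(M,B]: g(s)=f(M)\}$ is nonempty, put $\mathbf A:=\min\{s\in(M,B]: g(s)=f(M)\}$, and assume $$f(s)<f(\mathbf A)\ \text{ for } u^*\le s<\mathbf A,\qquad f(s)>f(\mathbf A)\ \text{ for } \mathbf A<s\le B,\qquad f(\mathbf A)\ge g(M).$$ Suppose that $f,g$ are differentiable functions and that $f$ is strictly increasing on $[M,\mathbf A]$; let $\hat f=f|_{[M,\mathbf A]}$ and $G:[M,\mathbf A]\to[M,\mathbf A]$, $G(s)=\hat f^{-1}(g(s))$. Assume at least one of the following holds: (H1) $s\mapsto (f(s)-f(0))(g(s)-g(0))$ is nondecreasing on $[M,\mathbf A]$; (H2) $f+g$ is nondecreasing on $[M,\mathbf A]$; (H3) $s\mapsto (f(s)-f(0))(g(s)-g(0))+f(s)+g(s)$ is nondecreasing on $[M,\mathbf A]$; (H4) $s\mapsto \frac{(G\circ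 G)(s)}{s}$ is nonincreasing on $[M,u^*]$; (H5) $s\mapsto \frac{(G\circ G)(s)}{s}$ is nonincreasing on $[u^*,\mathbf A]$. Then the positive steady state $u^*$ of problem (P) is globally exponentially stable provided that $$\inf_{s\in[M,\mathbf A]}f'(s)>\sup_{s\in[M,\mathbf A]}|g'(s)|.$$
   Context: Let $\tau>0$, let $\Omega\subset\mathbb R^N$ be a bounded domain with smooth boundary, let $\partial/\partial n$ be the outward normal derivative on $\partial\Omega$, and let $h$ be a positive (integrable) function on $[0,\tau]$ with $\int_0^\tau h(a)\,da=1$. The functions $f,g:\mathbb R\to\mathbb R$ satisfy: (T1) $f,g$ are Lipschitz continuous and $f(0)=g(0)$; (T2) $g(s)>g(0)$ for all $s>0$ and there is a number $B>0$ with $\max_{v\in[0,s]}g(v)<f(s)$ for all $s>B$. Let $X_+=C(\bar\Omega\times[-\tau,0],[0,\infty))$ with the supremum norm. Problem (P) is $$u_t(x,t)-\Delta u(x,t)=-f(u(x,t))+\int_0^\tau h(a)g(u(x,t-a))\,da\ (x\in\Omega,\ t>0),$$ $$\frac{\partial u}{\partial n}=0\ \text{ on }\partial\Omega,\ t>0,\qquad u(x,t)=\phi(x,t)\ \text{ for }(x,t)\in\bar\Omega\times[-\tau,0].$$ For $\phi\in X_+$ the solution of (P) is the unique global mild solution, i.e. the continuous $u:\bar\Omega\times[-\tau,\infty)\to[0,\infty)$ with $u=\phi$ on $\bar\Omega\times[-\tau,0]$ and $u(\cdot,t)=T(t)\phi(\cdot,0)+\int_0^tT(t-s)F(u_s)\,ds$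 for $t\ge0$, where $T(t)$ is the semigroup on $C(\bar\Omega,\mathbb R)$ generated by the Laplacian with homogeneous Neumann condition, $u_s(x,\theta)=u(x,s+\theta)$ for $\theta\in[-\tau,0]$, and $F(\psi)(x)=-f(\psi(x,0))+\int_0^\tau h(a)g(\psi(x,-a))\,da$. "Globally exponentially stable" means: for every $\phi\in X_+\setminus\{0\}$ there exist constants $C>0$ and $\gamma>0$ such that the solution satisfies $|u(x,t)-u^*|\le Ce^{-\gamma t}$ for all $x\in\bar\Omega$, $t\ge0$. *)

theory Defs
  imports "HOL-Analysis.Analysis"
begin

section \<open>Smooth functions and domains with smooth boundary\<close>

primrec Ck_on :: "nat \<Rightarrow> 'a::euclidean_space set \<Rightarrow> ('a \<Rightarrow> real) \<Rightarrow> bool" where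
  "Ck_on 0 U v \<longleftrightarrow> continuous_on U v"
| "Ck_on (Suc k) U v \<longleftrightarrow>
     (\<forall>x\<in>U. v differentiable (at x)) \<and>
     (\<forall>b\<in>Basis. Ck_on k U (\<lambda>x. frechet_derivative v (at x) b))"

definition smooth_on :: "'a::euclidean_space set \<Rightarrow> ('a \<Rightarrow> real) \<Rightarrow> bool" where
  "smooth_on U v \<longleftrightarrow> (\<forall>k. Ck_on k U v)"

definition gradient :: "('a::euclidean_space \<Rightarrow> real) \<Rightarrow> 'a \<Rightarrow> 'a" where
  "gradient v x = (\<Sum>b\<in>Basis. frechet_derivative v (at x) b *\<^sub>R b)"

definition laplacian :: "('a::euclidean_space \<Rightarrow> real) \<Rightarrow> 'a \<Rightarrow> real" where
  "laplacian v x =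
     (\<Sum>b\<in>Basis. frechet_derivative (\<lambda>y. frechet_derivative v (at y) b) (at x) b)"

text \<open>The domain lies on the side \<open>\<rho> < 0\<close> of its boundary, so \<open>gradient \<rho>\<close> points outward.\<close>

definition local_defining_function ::
    "'a::euclidean_space set \<Rightarrow> 'a set \<Rightarrow> ('a \<Rightarrow> real) \<Rightarrow> bool" where
  "local_defining_function \<Omega> U \<rho> \<longleftrightarrow>
     open U \<and> smooth_on U \<rho> \<and> (\<forall>x\<in>U. gradient \<rho> x \<noteq> 0) \<and>
     \<Omega> \<inter> U = {x\<in>U. \<rho> x < 0} \<and> frontier \<Omega> \<inter> U = {x\<in>U. \<rho> x = 0}"

definition smooth_boundary :: "'a::euclidean_space set \<Rightarrow> bool" where
  "smooth_boundary \<Omega> \<longleftrightarrow>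
     (\<forall>p\<in>frontier \<Omega>. \<exists>U \<rho>. p \<in> U \<and> local_defining_function \<Omega> U \<rho>)"

definition outward_unit_normal :: "'a::euclidean_space set \<Rightarrow> 'a \<Rightarrow> 'a \<Rightarrow> bool" where
  "outward_unit_normal \<Omega> p n \<longleftrightarrow>
     (\<exists>U \<rho>. p \<in> U \<and> local_defining_function \<Omega> U \<rho> \<and>
            n = gradient \<rho> p /\<^sub>R norm (gradient \<rho> p))"

definition bounded_smooth_domain :: "'a::euclidean_space set \<Rightarrow> bool" where
  "bounded_smooth_domain \<Omega> \<longleftrightarrow>
     open \<Omega> \<and> connected \<Omega> \<and> \<Omega> \<noteq> {} \<and> bounded \<Omega> \<and> smooth_boundary \<Omega>"


section \<open>The Neumann heat semigroup on the continuous functions on the closure\<close>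

text \<open>
  For compact \<open>K\<close>, an element of \<open>C(K)\<close> is represented by any function on the ambient space
  that is continuous on \<open>K\<close>; only its values on \<open>K\<close> matter. In particular, linearity and
  boundedness force \<open>T t v\<close> on \<open>K\<close> to depend only on the restriction of \<open>v\<close> to \<open>K\<close>.
\<close>

definition sup_norm_on :: "'a set \<Rightarrow> ('a \<Rightarrow> real) \<Rightarrow> real" where
  "sup_norm_on K v = (SUP x\<in>K. \<bar>v x\<bar>)"

definition C0_semigroup_on ::
    "'a::euclidean_space set \<Rightarrow> (real \<Rightarrow> ('a \<Rightarrow> real) \<Rightarrow> 'a \<Rightarrow> real) \<Rightarrow> bool" where
  "C0_semigroup_on K T \<longleftrightarrow>
     (\<forall>t\<ge>0. \<forall>v. continuous_on K v \<longrightarrow> continuous_on K (T t v)) \<and>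
     (\<forall>t\<ge>0. \<forall>v w. \<forall>a b. continuous_on K v \<longrightarrow> continuous_on K w \<longrightarrow>
        (\<forall>x\<in>K. T t (\<lambda>y. a * v y + b * w y) x = a * T t v x + b * T t w x)) \<and>
     (\<forall>t\<ge>0. \<exists>C. \<forall>v. continuous_on K v \<longrightarrow> sup_norm_on K (T t v) \<le> C * sup_norm_on K v) \<and>
     (\<forall>v. continuous_on K v \<longrightarrow> (\<forall>x\<in>K. T 0 v x = v x)) \<and>
     (\<forall>s\<ge>0. \<forall>t\<ge>0. \<forall>v. continuous_on K v \<longrightarrow> (\<forall>x\<in>K. T (s + t) v x = T s (T t v) x)) \<and>
     (\<forall>v. continuous_on K v \<longrightarrow> uniform_limit K (\<lambda>t. T t v) v (at_right 0))"

text \<open>Operators are given by their graphs: \<open>generator_on K T v w\<close> means that \<open>v\<close> is in the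
  domain of the generator and is mapped to \<open>w\<close>.\<close>

definition generator_on ::
    "'a::euclidean_space set \<Rightarrow> (real \<Rightarrow> ('a \<Rightarrow> real) \<Rightarrow> 'a \<Rightarrow> real) \<Rightarrow>
     ('a \<Rightarrow> real) \<Rightarrow> ('a \<Rightarrow> real) \<Rightarrow> bool" where
  "generator_on K T v w \<longleftrightarrow>
     continuous_on K v \<and> continuous_on K w \<and>
     uniform_limit K (\<lambda>t x. (T t v x - v x) / t) w (at_right 0)"

text \<open>The Laplacian on functions in \<open>C\<^sup>2(closure \<Omega>)\<close> (restrictions of \<open>C\<^sup>2\<close> functions on the
  whole space) with vanishing normal derivative.\<close>

definition classical_neumann_laplacian ::
    "'a::euclidean_space set \<Rightarrow> ('a \<Rightarrow> real) \<Rightarrow> ('a \<Rightarrow> real) \<Rightarrow> bool" where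
  "classical_neumann_laplacian \<Omega> v w \<longleftrightarrow>
     (\<exists>V. Ck_on 2 UNIV V \<and>
          (\<forall>x\<in>closure \<Omega>. V x = v x \<and> laplacian V x = w x) \<and>
          (\<forall>p\<in>frontier \<Omega>. \<forall>n. outward_unit_normal \<Omega> p n \<longrightarrow>
             frechet_derivative V (at p) n = 0))"

text \<open>A generator is a closed operator, whereas the classical Neumann Laplacian is only closable
  in \<open>C(closure \<Omega>)\<close>. The Neumann Laplacian on \<open>C(closure \<Omega>)\<close> is its closure with respect
  to the supremum norm.\<close>

definition neumann_laplacian ::
    "'a::euclidean_space set \<Rightarrow> ('a \<Rightarrow> real) \<Rightarrow> ('a \<Rightarrow> real) \<Rightarrow> bool" where
  "neumann_laplacian \<Omega> v w \<longleftrightarrow>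
     (\<exists>V W. (\<forall>k::nat. classical_neumann_laplacian \<Omega> (V k) (W k)) \<and>
            uniform_limit (closure \<Omega>) V v sequentially \<and>
            uniform_limit (closure \<Omega>) W w sequentially)"

definition neumann_heat_semigroup ::
    "'a::euclidean_space set \<Rightarrow> (real \<Rightarrow> ('a \<Rightarrow> real) \<Rightarrow> 'a \<Rightarrow> real) \<Rightarrow> bool" where
  "neumann_heat_semigroup \<Omega> T \<longleftrightarrow>
     C0_semigroup_on (closure \<Omega>) T \<and>
     (\<forall>v w. generator_on (closure \<Omega>) T v w \<longleftrightarrow> neumann_laplacian \<Omega> v w)"


section \<open>The delayed reaction-diffusion problem\<close>

text \<open>The set \<open>X\<^sub>+\<close>; functions of \<open>(x, t)\<close> are curried.\<close>

definition initial_data :: "'a::euclidean_space set \<Rightarrow> real \<Rightarrow> ('a \<Rightarrow> real \<Rightarrow> real) set" where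
  "initial_data \<Omega> \<tau> =
     {\<phi>. continuous_on (closure \<Omega> \<times> {-\<tau>..0}) (\<lambda>(x, \<theta>). \<phi> x \<theta>) \<and>
         (\<forall>x\<in>closure \<Omega>. \<forall>\<theta>\<in>{-\<tau>..0}. 0 \<le> \<phi> x \<theta>)}"

definition reaction ::
    "(real \<Rightarrow> real) \<Rightarrow> (real \<Rightarrow> real) \<Rightarrow> (real \<Rightarrow> real) \<Rightarrow> real \<Rightarrow>
     ('a \<Rightarrow> real \<Rightarrow> real) \<Rightarrow> 'a \<Rightarrow> real" where
  "reaction f g h \<tau> \<psi> x = - f (\<psi> x 0) + integral {0..\<tau>} (\<lambda>a. h a * g (\<psi> x (- a)))"

definition segment :: "('a \<Rightarrow> real \<Rightarrow> real) \<Rightarrow> real \<Rightarrow> 'a \<Rightarrow> real \<Rightarrow> real" where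
  "segment u s x \<theta> = u x (s + \<theta>)"

text \<open>The integrand of the variation-of-constants formula is a continuous curve in
  \<open>C(closure \<Omega>)\<close>, so its integral is evaluated pointwise in \<open>x\<close>.\<close>

definition mild_solution ::
    "'a::euclidean_space set \<Rightarrow> (real \<Rightarrow> ('a \<Rightarrow> real) \<Rightarrow> 'a \<Rightarrow> real) \<Rightarrow>
     (real \<Rightarrow> real) \<Rightarrow> (real \<Rightarrow> real) \<Rightarrow> (real \<Rightarrow> real) \<Rightarrow> real \<Rightarrow>
     ('a \<Rightarrow> real \<Rightarrow> real) \<Rightarrow> ('a \<Rightarrow> real \<Rightarrow> real) \<Rightarrow> bool" where
  "mild_solution \<Omega> T f g h \<tau> \<phi> u \<longleftrightarrow>
     continuous_on (closure \<Omega> \<times> {-\<tau>..}) (\<lambda>(x, t). u x t) \<and>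
     (\<forall>x\<in>closure \<Omega>. \<forall>t\<ge>-\<tau>. 0 \<le> u x t) \<and>
     (\<forall>x\<in>closure \<Omega>. \<forall>\<theta>\<in>{-\<tau>..0}. u x \<theta> = \<phi> x \<theta>) \<and>
     (\<forall>x\<in>closure \<Omega>. \<forall>t\<ge>0.
        u x t = T t (\<lambda>y. \<phi> y 0) x +
                integral {0..t} (\<lambda>s. T (t - s) (reaction f g h \<tau> (segment u s)) x))"

definition steady_state ::
    "'a::euclidean_space set \<Rightarrow> (real \<Rightarrow> ('a \<Rightarrow> real) \<Rightarrow> 'a \<Rightarrow> real) \<Rightarrow>
     (real \<Rightarrow> real) \<Rightarrow> (real \<Rightarrow> real) \<Rightarrow> (real \<Rightarrow> real) \<Rightarrow> real \<Rightarrow> real \<Rightarrow> bool" where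
  "steady_state \<Omega> T f g h \<tau> c \<longleftrightarrow> mild_solution \<Omega> T f g h \<tau> (\<lambda>x \<theta>. c) (\<lambda>x t. c)"

definition globally_exponentially_stable ::
    "'a::euclidean_space set \<Rightarrow> (real \<Rightarrow> ('a \<Rightarrow> real) \<Rightarrow> 'a \<Rightarrow> real) \<Rightarrow>
     (real \<Rightarrow> real) \<Rightarrow> (real \<Rightarrow> real) \<Rightarrow> (real \<Rightarrow> real) \<Rightarrow> real \<Rightarrow> real \<Rightarrow> bool" where
  "globally_exponentially_stable \<Omega> T f g h \<tau> c \<longleftrightarrow>
     (\<forall>\<phi>\<in>initial_data \<Omega> \<tau>. (\<exists>x\<in>closure \<Omega>. \<exists>\<theta>\<in>{-\<tau>..0}. \<phi> x \<theta> \<noteq> 0) \<longrightarrow>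
        (\<exists>C>0. \<exists>\<gamma>>0. \<forall>u. mild_solution \<Omega> T f g h \<tau> \<phi> u \<longrightarrow>
           (\<forall>x\<in>closure \<Omega>. \<forall>t\<ge>0. \<bar>u x t - c\<bar> \<le> C * exp (- \<gamma> * t))))"

end

theory Submission
  imports Defs
begin

text \<open>The heart of the matter is a scalar argument about the asymptotic upper limit \<open>U\<close> and lower limit
\<open>Lo\<close> of a solution, taken over all of \<open>closure \<Omega>\<close>. At a point where \<open>u\<close> is maximal in space,
diffusion can only lower \<open>u\<close>; hence \<open>f U\<close> is at most the largest value of \<open>g\<close> on \<open>[Lo, U]\<close>, since
otherwise the maximum would keep decreasing past \<open>U\<close>, and likewise \<open>f Lo\<close> is at least the smallest
value of \<open>g\<close> on \<open>[Lo, U]\<close>. If \<open>Lo\<close> is positive, the sign conditions on \<open>f\<close> and \<open>g\<close> confine \<open>Lo\<close> and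
\<open>U\<close> to \<open>[M, A]\<close>: for \<open>U > B\<close> the value \<open>f U\<close> would exceed all values of \<open>g\<close> on \<open>[0, U]\<close>, for
\<open>A < U \<le> B\<close> it would exceed \<open>f A \<ge> g M\<close>, the largest value of \<open>g\<close>, and then \<open>Lo < M\<close> is excluded
because \<open>f Lo\<close> would be below all values of \<open>g\<close> on \<open>[Lo, A]\<close>. On \<open>[M, A]\<close> the gap between the
derivatives makes \<open>f\<close> expand distances strictly more than \<open>g\<close> does, so \<open>f U - f Lo \<le> max g - min g\<close>
forces \<open>Lo = U\<close>, and the common value solves \<open>f = g\<close>, hence is the equilibrium. Once the solution is near
the equilibrium, the same gap between damping and delayed feedback yields an exponential rate, by
comparison with an exponential of small rate (\<open>exponential_convergence\<close>, \<open>solution_exponential_decay\<close>).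

Two facts about the Neumann heat semigroup are needed: it preserves upper bounds, and it eventually carries
positivity to every point, so that \<open>Lo > 0\<close>. They have to be extracted from its description as a strongly
continuous semigroup whose generator is the closure of the classical Neumann Laplacian. A classical function
satisfies the maximum principle up to the boundary, because at a boundary maximum the Neumann condition
makes the whole gradient vanish; this passes to the closure as dissipativity of the generator, and from there
to the semigroup (\<open>T_le\<close>). For positivity, the resolvent of a nonnegative function is a
supersolution of an elliptic equation; a Hopf lemma with a polynomial barrier, applied to classical
approximations of the resolvent, shows that it vanishes nowhere on the connected set \<open>\<Omega>\<close> or its
boundary (\<open>strong_maximum_principle\<close>, \<open>neumann_heat_positive\<close>). This gives positivity at each point at some
time; that the delay kernel \<open>h\<close> is positive everywhere makes positivity of a solution persist at each
point (\<open>positive_forever\<close>), so that it holds everywhere after a finite time.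

Mild solutions enter through the expansion
\<open>u (t + h) = T h (u t + h R t) + o(h)\<close>, uniformly in space, where \<open>R\<close> is the reaction term: since \<open>T h\<close>
preserves bounds, comparison with a barrier reduces to a pointwise inequality for \<open>u t + h R t\<close>.\<close>

section \<open>Strongly continuous semigroups on continuous functions on a compact set\<close>

locale strongly_continuous_semigroup =
  fixes K :: "'a::euclidean_space set"
    and T :: "real \<Rightarrow> ('a \<Rightarrow> real) \<Rightarrow> 'a \<Rightarrow> real"
  assumes compact_K: "compact K" and K_nonempty: "K \<noteq> {}" and C0: "C0_semigroup_on K T"
begin

lemmas semigroup_axioms = C0[unfolded C0_semigroup_on_def]

lemma continuous_on_T:
  assumes "t \<ge> 0" "continuous_on K v" shows "continuous_on K (T t v)"
  using conjunct1[OF semigroup_axioms, rule_format, OF assms] .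

lemma T_linear:
  assumes "t \<ge> 0" "continuous_on K v" "continuous_on K w" "x \<in> K"
  shows "T t (\<lambda>y. a * v y + b * w y) x = a * T t v x + b * T t w x"
  using semigroup_axioms[THEN conjunct2, THEN conjunct1, rule_format, OF assms] .

lemma T_sup_norm_bound:
  assumes "t \<ge> 0"
  obtains C where "\<And>v. continuous_on K v \<Longrightarrow> sup_norm_on K (T t v) \<le> C * sup_norm_on K v"
  using semigroup_axioms[THEN conjunct2, THEN conjunct2, THEN conjunct1, rule_format, OF assms] by auto

lemma T_0: "continuous_on K v \<Longrightarrow> x \<in> K \<Longrightarrow> T 0 v x = v x"
  using semigroup_axioms[THEN conjunct2, THEN conjunct2, THEN conjunct2, THEN conjunct1, rule_format] .

lemma T_add_time:
  assumes "s \<ge> 0" "t \<ge> 0" "continuous_on K v" "x \<in> K"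
  shows "T (s + t) v x = T s (T t v) x"
  using semigroup_axioms[THEN conjunct2, THEN conjunct2, THEN conjunct2, THEN conjunct2, THEN conjunct1, rule_format, OF assms] .

lemma T_strongly_continuous: "continuous_on K v \<Longrightarrow> uniform_limit K (\<lambda>t. T t v) v (at_right 0)"
  using semigroup_axioms[THEN conjunct2, THEN conjunct2, THEN conjunct2, THEN conjunct2, THEN conjunct2, rule_format] .

lemma T_near_0:
  assumes "continuous_on K v" "e > 0"
  obtains d where "d > 0" "\<And>t x. 0 \<le> t \<Longrightarrow> t < d \<Longrightarrow> x \<in> K \<Longrightarrow> \<bar>T t v x - v x\<bar> < e"
proof -
  have "uniform_limit K (\<lambda>t. T t v) v (at_right 0)"
    by (rule T_strongly_continuous[OF assms(1)])
  then have "\<forall>\<^sub>F t in at_right 0. \<forall>x\<in>K. dist (T t v x) (v x) < e"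
    using assms(2) by (rule uniform_limitD)
  then obtain d where d: "d > 0" "\<And>t. 0 < t \<Longrightarrow> t < d \<Longrightarrow> \<forall>x\<in>K. dist (T t v x) (v x) < e"
    unfolding eventually_at_right_field by auto
  show thesis
  proof (rule that[OF d(1)])
    fix t x assume "0 \<le> t" "t < d" "x \<in> K"
    then show "\<bar>T t v x - v x\<bar> < e"
      using d(2)[of t] T_0[OF assms(1)] assms(2) by (cases "t = 0") (auto simp: dist_real_def)
  qed
qed

lemma T_add:
  assumes "t \<ge> 0" "continuous_on K v" "continuous_on K w" "x \<in> K"
  shows "T t (\<lambda>y. v y + w y) x = T t v x + T t w x"
  using T_linear[OF assms, of 1 1] by simp

lemma T_diff:
  assumes "t \<ge> 0" "continuous_on K v" "continuous_on K w" "x \<in> K"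
  shows "T t (\<lambda>y. v y - w y) x = T t v x - T t w x"
  using T_linear[OF assms, of 1 "-1"] by simp

lemma T_scale:
  assumes "t \<ge> 0" "continuous_on K v" "x \<in> K"
  shows "T t (\<lambda>y. c * v y) x = c * T t v x"
  using T_linear[OF assms(1,2,2,3), of c 0] by simp

lemma T_minus:
  assumes "t \<ge> 0" "continuous_on K v" "x \<in> K"
  shows "T t (\<lambda>y. - v y) x = - T t v x"
  using T_scale[OF assms, of "-1"] by simp

definition operator_bound :: "real \<Rightarrow> real \<Rightarrow> bool" where
  "operator_bound t C \<longleftrightarrow> (\<forall>v c. continuous_on K v \<longrightarrow> (\<forall>x\<in>K. \<bar>v x\<bar> \<le> c) \<longrightarrow> (\<forall>x\<in>K. \<bar>T t v x\<bar> \<le> C * c))"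

lemma operator_boundD:
  assumes "operator_bound t C" "continuous_on K v" "\<And>x. x \<in> K \<Longrightarrow> \<bar>v x\<bar> \<le> c" "x \<in> K"
  shows "\<bar>T t v x\<bar> \<le> C * c"
  using assms unfolding operator_bound_def by blast

lemma bounded_on_K:
  assumes "continuous_on K v"
  obtains c where "c > 0" "\<And>x. x \<in> K \<Longrightarrow> \<bar>v x :: real\<bar> \<le> c"
proof -
  have "bounded (v ` K)" using compact_continuous_image[OF assms compact_K] compact_imp_bounded by blast
  then obtain c where "c > 0" "\<And>x. x \<in> K \<Longrightarrow> \<bar>v x\<bar> \<le> c"
    unfolding bounded_pos by auto
  then show thesis by (rule that)
qed

lemma operator_bound_exists:
  assumes "t \<ge> 0" obtains C where "C \<ge> 0" "operator_bound t C"
proof -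
  obtain C where C: "\<And>v. continuous_on K v \<Longrightarrow> sup_norm_on K (T t v) \<le> C * sup_norm_on K v"
    using T_sup_norm_bound[OF assms] by metis
  have "operator_bound t (max C 0)"
    unfolding operator_bound_def
  proof (intro allI impI ballI)
    fix v :: "'a \<Rightarrow> real" and c x assume v: "continuous_on K v" and c: "\<forall>x\<in>K. \<bar>v x\<bar> \<le> c" and x: "x \<in> K"
    have n0: "0 \<le> sup_norm_on K v" and nc: "sup_norm_on K v \<le> c"
    proof -
      have "bdd_above ((\<lambda>x. \<bar>v x\<bar>) ` K)" using c by (auto intro: bdd_aboveI)
      then have "\<bar>v x\<bar> \<le> sup_norm_on K v" unfolding sup_norm_on_def using x by (rule cSUP_upper2) simp
      then show "0 \<le> sup_norm_on K v" by linarith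
      show "sup_norm_on K v \<le> c" unfolding sup_norm_on_def using c K_nonempty by (intro cSUP_least) auto
    qed
    obtain b where "\<And>x. x \<in> K \<Longrightarrow> \<bar>T t v x\<bar> \<le> b" using bounded_on_K[OF continuous_on_T[OF assms v]] by metis
    then have "bdd_above ((\<lambda>x. \<bar>T t v x\<bar>) ` K)" by (rule bdd_aboveI2)
    then have "\<bar>T t v x\<bar> \<le> sup_norm_on K (T t v)" unfolding sup_norm_on_def using x by (rule cSUP_upper2) simp
    also have "\<dots> \<le> C * sup_norm_on K v" by (rule C[OF v])
    also have "\<dots> \<le> max C 0 * sup_norm_on K v" using n0 by (intro mult_right_mono) auto
    also have "\<dots> \<le> max C 0 * c" using nc by (intro mult_left_mono) auto
    finally show "\<bar>T t v x\<bar> \<le> max C 0 * c" .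
  qed
  then show thesis using that[of "max C 0"] by simp
qed

text \<open>A function on the whole space represents an element of \<open>C(K)\<close>. Its values outside \<open>K\<close> do not influence
\<open>T t\<close> on \<open>K\<close>, since the difference of two representatives has norm zero.\<close>

lemma T_cong:
  assumes "t \<ge> 0" "continuous_on K v" "continuous_on K w" "\<And>y. y \<in> K \<Longrightarrow> v y = w y" "x \<in> K"
  shows "T t v x = T t w x"
proof -
  obtain C where C: "operator_bound t C" using operator_bound_exists[OF assms(1)] by blast
  have "\<bar>T t (\<lambda>y. v y - w y) x\<bar> \<le> C * 0"
    by (rule operator_boundD[OF C]) (use assms in \<open>auto intro: continuous_intros\<close>)
  then show ?thesis using T_diff[OF assms(1-3,5)] by simp
qed

lemma operator_bound_compose:
  assumes "s \<ge> 0" "t \<ge> 0" "operator_bound s C" "operator_bound t D"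
  shows "operator_bound (s + t) (C * D)"
  unfolding operator_bound_def
proof (intro allI impI ballI)
  fix v :: "'a \<Rightarrow> real" and c x assume v: "continuous_on K v" and c: "\<forall>x\<in>K. \<bar>v x\<bar> \<le> c" and x: "x \<in> K"
  have "\<bar>T s (T t v) x\<bar> \<le> C * (D * c)"
    by (rule operator_boundD[OF assms(3) continuous_on_T[OF assms(2) v] _ x])
      (use operator_boundD[OF assms(4) v] c in blast)
  then show "\<bar>T (s + t) v x\<bar> \<le> C * D * c"
    using T_add_time[OF assms(1,2) v x] by (simp add: mult.assoc)
qed

definition operator_norm :: "real \<Rightarrow> real" where
  "operator_norm t = Sup {\<bar>T t v x\<bar> | v x. continuous_on K v \<and> (\<forall>y\<in>K. \<bar>v y\<bar> \<le> 1) \<and> x \<in> K}"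

lemma operator_norm_upper:
  assumes "t \<ge> 0" "continuous_on K v" "\<And>y. y \<in> K \<Longrightarrow> \<bar>v y\<bar> \<le> 1" "x \<in> K"
  shows "\<bar>T t v x\<bar> \<le> operator_norm t"
proof -
  obtain C where C: "operator_bound t C" using operator_bound_exists[OF assms(1)] by blast
  have "bdd_above {\<bar>T t v x\<bar> | v x. continuous_on K v \<and> (\<forall>y\<in>K. \<bar>v y\<bar> \<le> 1) \<and> x \<in> K}"
    by (rule bdd_aboveI[of _ "C * 1"]) (use operator_boundD[OF C, where c = 1] in blast)
  then show ?thesis
    unfolding operator_norm_def using assms by (intro cSup_upper) blast+
qed

lemma operator_bound_operator_norm:
  assumes "t \<ge> 0" shows "operator_bound t (operator_norm t)"
  unfolding operator_bound_def
proof (intro allI impI ballI)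
  fix v :: "'a \<Rightarrow> real" and c x assume v: "continuous_on K v" and c: "\<forall>x\<in>K. \<bar>v x\<bar> \<le> c" and x: "x \<in> K"
  have "c \<ge> 0" using c x by force
  show "\<bar>T t v x\<bar> \<le> operator_norm t * c"
  proof (cases "c = 0")
    case True
    obtain C where C: "operator_bound t C" using operator_bound_exists[OF assms(1)] by blast
    show ?thesis using operator_boundD[OF C v _ x, of 0] c True by simp
  next
    case False
    with \<open>c \<ge> 0\<close> have "c > 0" by simp
    have "\<bar>T t (\<lambda>y. (1 / c) * v y) x\<bar> \<le> operator_norm t"
    proof (rule operator_norm_upper[OF assms _ _ x])
      show "continuous_on K (\<lambda>y. (1 / c) * v y)" by (intro continuous_intros v)
      show "\<bar>(1 / c) * v y\<bar> \<le> 1" if "y \<in> K" for y using c that \<open>c > 0\<close> by (simp add: abs_mult divide_simps)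
    qed
    then have "c * \<bar>T t (\<lambda>y. (1 / c) * v y) x\<bar> \<le> c * operator_norm t" using \<open>c > 0\<close> by (intro mult_left_mono) auto
    then show ?thesis unfolding T_scale[OF assms v x, of "1 / c"] using \<open>c > 0\<close> by (simp add: abs_mult mult.commute)
  qed
qed

lemma operator_norm_nearly_attained:
  assumes "t \<ge> 0" "q < operator_norm t"
  obtains v x where "continuous_on K v" "\<And>y. y \<in> K \<Longrightarrow> \<bar>v y\<bar> \<le> 1" "x \<in> K" "q < \<bar>T t v x\<bar>"
proof -
  obtain x0 where "x0 \<in> K" using K_nonempty by blast
  then have "\<bar>T t (\<lambda>_. 0) x0\<bar> \<in> {\<bar>T t v x\<bar> | v x. continuous_on K v \<and> (\<forall>y\<in>K. \<bar>v y\<bar> \<le> 1) \<and> x \<in> K}"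
    by (intro CollectI exI[of _ "\<lambda>_. 0"] exI[of _ x0]) auto
  then have "{\<bar>T t v x\<bar> | v x. continuous_on K v \<and> (\<forall>y\<in>K. \<bar>v y\<bar> \<le> 1) \<and> x \<in> K} \<noteq> {}" by blast
  from less_cSupD[OF this assms(2)[unfolded operator_norm_def]] show thesis using that by blast
qed

text \<open>This is the uniform boundedness principle along times tending to zero, by a gliding hump:
  if the norms were unbounded near \<open>0\<close>, one could add up functions \<open>\<plusminus> v n\<close> with weights
  \<open>3^(-n)\<close>, the sign of each being chosen so that \<open>T (t n)\<close> of the partial sum is large at some
  point, while the tail of the series is too short to destroy this. The sum would be a continuous
  function whose images under \<open>T (t n)\<close> blow up, although they converge to it.\<close>

lemma operator_norm_bounded_near_0:
  obtains d C where "d > 0" "C \<ge> 1" "\<And>t. 0 \<le> t \<Longrightarrow> t \<le> d \<Longrightarrow> operator_bound t C"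
proof -
  have "\<exists>d>0. \<exists>C. \<forall>t. 0 \<le> t \<and> t \<le> d \<longrightarrow> operator_norm t \<le> C"
  proof (rule ccontr)
    assume "\<not> ?thesis"
    then have unb: "\<exists>t. 0 \<le> t \<and> t \<le> d \<and> C < operator_norm t" if "d > 0" for d C
      using that by (meson linorder_not_le)
    have "\<exists>t v p. 0 \<le> t \<and> t \<le> 1 / real (Suc n) \<and> 4 ^ n < operator_norm t \<and> continuous_on K v \<and>
       (\<forall>y\<in>K. \<bar>v y\<bar> \<le> 1) \<and> p \<in> K \<and> 2 / 3 * operator_norm t < \<bar>T t v p\<bar>" for n
    proof -
      obtain t where t: "0 \<le> t" "t \<le> 1 / real (Suc n)" "4 ^ n < operator_norm t"
        using unb[of "1 / real (Suc n)" "4 ^ n"] by auto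
      have "0 < (4::real) ^ n" by simp
      then have "2 / 3 * operator_norm t < operator_norm t" using t(3) by linarith
      then show ?thesis using operator_norm_nearly_attained[OF t(1)] t by metis
    qed
    then obtain t v p where t: "\<And>n. 0 \<le> t n" "\<And>n. t n \<le> 1 / real (Suc n)" "\<And>n. 4 ^ n < operator_norm (t n)"
      and v: "\<And>n. continuous_on K (v n)" "\<And>n y. y \<in> K \<Longrightarrow> \<bar>v n y\<bar> \<le> 1"
      and p: "\<And>n. p n \<in> K" "\<And>n. 2 / 3 * operator_norm (t n) < \<bar>T (t n) (v n) (p n)\<bar>"
      by metis
    define a :: "nat \<Rightarrow> real" where "a n = (1 / 3) ^ n" for n
    have a_pos: "a n > 0" and a_Suc: "a (Suc n) = a n / 3" for n by (auto simp: a_def)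
    define plus minus where "plus n w = (\<lambda>y. w y + a n * v n y)" and "minus n w = (\<lambda>y. w y - a n * v n y)" for n w
    define X where "X = rec_nat (\<lambda>_. 0)
      (\<lambda>n w. if \<bar>T (t n) (plus n w) (p n)\<bar> \<ge> a n * \<bar>T (t n) (v n) (p n)\<bar> then plus n w else minus n w)"
    have X0: "X 0 = (\<lambda>_. 0)" by (simp add: X_def)
    have XS: "X (Suc n) = (if \<bar>T (t n) (plus n (X n)) (p n)\<bar> \<ge> a n * \<bar>T (t n) (v n) (p n)\<bar>
        then plus n (X n) else minus n (X n))" for n by (simp add: X_def)
    have contX: "continuous_on K (X n)" for n
    proof (induction n)
      case (Suc n)
      have "continuous_on K (plus n (X n))" "continuous_on K (minus n (X n))"
        unfolding plus_def minus_def by (intro continuous_intros Suc v)+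
      then show ?case unfolding XS by simp
    qed (simp add: X0)
    have big: "\<bar>T (t n) (X (Suc n)) (p n)\<bar> \<ge> a n * \<bar>T (t n) (v n) (p n)\<bar>" for n
    proof -
      have "T (t n) (\<lambda>y. 1 * X n y + a n * v n y) (p n) = 1 * T (t n) (X n) (p n) + a n * T (t n) (v n) (p n)"
        "T (t n) (\<lambda>y. 1 * X n y + (- a n) * v n y) (p n) = 1 * T (t n) (X n) (p n) + (- a n) * T (t n) (v n) (p n)"
        by (intro T_linear t contX v p)+
      then have "T (t n) (plus n (X n)) (p n) = T (t n) (X n) (p n) + a n * T (t n) (v n) (p n)"
        "T (t n) (minus n (X n)) (p n) = T (t n) (X n) (p n) - a n * T (t n) (v n) (p n)"
        by (simp_all add: plus_def minus_def)
      moreover have "\<bar>a n * T (t n) (v n) (p n)\<bar> = a n * \<bar>T (t n) (v n) (p n)\<bar>" using a_pos[of n] by (simp add: abs_mult)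
      ultimately show ?thesis unfolding XS by (simp; argo)
    qed
    have step: "\<bar>X (Suc n) y - X n y\<bar> \<le> a n" if "y \<in> K" for n y
      using v(2)[OF that, of n] a_pos[of n] by (auto simp: XS plus_def minus_def abs_mult mult_le_cancel_left1)
    have tel: "\<bar>X (n + k) y - X n y\<bar> \<le> 3 / 2 * (a n - a (n + k))" if "y \<in> K" for n k y
    proof (induction k)
      case (Suc k)
      have "\<bar>X (Suc (n + k)) y - X (n + k) y\<bar> \<le> a (n + k)" by (rule step[OF that])
      with Suc show ?case unfolding add_Suc_right a_Suc by argo
    qed simp
    have tel': "\<bar>X m y - X n y\<bar> \<le> 3 / 2 * a n" if "y \<in> K" "m \<ge> n" for m n y
    proof -
      obtain k where "m = n + k" using \<open>m \<ge> n\<close> le_Suc_ex by blast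
      then show ?thesis using tel[OF that(1), of n k] a_pos[of "n + k"] by auto
    qed
    have a_lim: "a \<longlonglongrightarrow> 0" unfolding a_def by (rule LIMSEQ_power_zero) simp
    have conv: "convergent (\<lambda>n. X n y)" if y: "y \<in> K" for y
    proof (rule Cauchy_convergent, rule metric_CauchyI)
      fix e :: real assume "e > 0"
      then have "\<forall>\<^sub>F n in sequentially. a n < e / 3" using order_tendstoD(2)[OF a_lim, of "e / 3"] by simp
      then obtain N where N: "a N < e / 3" by (auto simp: eventually_sequentially)
      have "dist (X m y) (X n y) < e" if "m \<ge> N" "n \<ge> N" for m n
        unfolding dist_real_def using tel'[OF y that(1)] tel'[OF y that(2)] N by argo
      then show "\<exists>M. \<forall>m\<ge>M. \<forall>n\<ge>M. dist (X m y) (X n y) < e" by blast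
    qed
    define Y where "Y y = lim (\<lambda>n. X n y)" for y
    have Ylim: "(\<lambda>n. X n y) \<longlonglongrightarrow> Y y" if "y \<in> K" for y
      using conv[OF that] by (simp add: Y_def convergent_LIMSEQ_iff)
    have Y: "\<bar>Y y - X n y\<bar> \<le> 3 / 2 * a n" if "y \<in> K" for n y
    proof (rule LIMSEQ_le_const2)
      show "(\<lambda>m. \<bar>X m y - X n y\<bar>) \<longlonglongrightarrow> \<bar>Y y - X n y\<bar>" by (intro tendsto_intros Ylim that)
      show "\<exists>N. \<forall>m\<ge>N. \<bar>X m y - X n y\<bar> \<le> 3 / 2 * a n" using tel'[OF that] by blast
    qed
    have "uniform_limit K X Y sequentially"
    proof (rule uniform_limitI)
      fix e :: real assume "e > 0"
      then have "\<forall>\<^sub>F n in sequentially. a n < e / 3" using order_tendstoD(2)[OF a_lim, of "e / 3"] by simp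
      then show "\<forall>\<^sub>F n in sequentially. \<forall>x\<in>K. dist (X n x) (Y x) < e"
      proof eventually_elim
        case (elim n)
        show ?case
        proof
          fix y assume "y \<in> K" then show "dist (X n y) (Y y) < e"
            unfolding dist_real_def using Y[of y n] elim \<open>e > 0\<close> by argo
        qed
      qed
    qed
    then have contY: "continuous_on K Y"
      by (rule uniform_limit_theorem[rotated]) (use contX in auto)
    have large: "(4 / 3) ^ n \<le> 6 * \<bar>T (t n) Y (p n)\<bar>" for n
    proof -
      have "\<bar>T (t n) (\<lambda>y. Y y - X (Suc n) y) (p n)\<bar> \<le> operator_norm (t n) * (3 / 2 * a (Suc n))"
        by (rule operator_boundD[OF operator_bound_operator_norm[OF t(1)] _ Y p(1)])
          (intro continuous_intros contY contX)
      also have "\<dots> = operator_norm (t n) * a n / 2" by (simp add: a_Suc)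
      finally have 1: "\<bar>T (t n) Y (p n) - T (t n) (X (Suc n)) (p n)\<bar> \<le> operator_norm (t n) * a n / 2"
        using T_diff[OF t(1) contY contX p(1)] by simp
      have 2: "a n * \<bar>T (t n) (v n) (p n)\<bar> \<ge> a n * (2 / 3 * operator_norm (t n))"
        using p(2)[of n] a_pos[of n] by (intro mult_left_mono) auto
      have 3: "a n * operator_norm (t n) \<ge> a n * 4 ^ n"
        using t(3)[of n] a_pos[of n] by (intro mult_left_mono) auto
      have 4: "a n * 4 ^ n = (4 / 3) ^ n" by (simp add: a_def power_divide)
      define P where "P = operator_norm (t n) * a n"
      have "\<bar>T (t n) Y (p n) - T (t n) (X (Suc n)) (p n)\<bar> \<le> P / 2" "\<bar>T (t n) (X (Suc n)) (p n)\<bar> \<ge> 2 / 3 * P" "(4 / 3) ^ n \<le> P"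
        using 1 2 3 big[of n] unfolding 4 P_def by (simp_all add: mult_ac)
      then show ?thesis by argo
    qed
    obtain c where c: "\<And>x. x \<in> K \<Longrightarrow> \<bar>Y x\<bar> \<le> c" using bounded_on_K[OF contY] by metis
    obtain d where d: "d > 0" "\<And>t x. 0 \<le> t \<Longrightarrow> t < d \<Longrightarrow> x \<in> K \<Longrightarrow> \<bar>T t Y x - Y x\<bar> < 1"
      using T_near_0[OF contY zero_less_one] by metis
    have "\<forall>\<^sub>F n in sequentially. 1 / real (Suc n) < d"
      using order_tendstoD(2)[OF LIMSEQ_inverse_real_of_nat d(1)] by (simp add: inverse_eq_divide)
    moreover have "\<forall>\<^sub>F n in sequentially. (4 / 3 :: real) ^ n > 6 * (c + 1)"
      using filterlim_at_top_dense[of "\<lambda>n. (4 / 3 :: real) ^ n" sequentially] filterlim_realpow_sequentially_gt1[of "4/3::real"]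
      by (simp add: filterlim_at_infinity_imp_filterlim_at_top)
    ultimately have "\<forall>\<^sub>F n in sequentially. False"
    proof eventually_elim
      case (elim n)
      have "\<bar>T (t n) Y (p n) - Y (p n)\<bar> < 1" using d(2)[OF t(1) _ p(1)] t(2)[of n] elim(1) by force
      then show ?case using c[OF p(1)[of n]] large[of n] elim(2) by argo
    qed
    then show False by simp
  qed
  then obtain d C where dC: "d > 0" "\<And>t. 0 \<le> t \<Longrightarrow> t \<le> d \<Longrightarrow> operator_norm t \<le> C" by blast
  show thesis
  proof (rule that[OF dC(1), of "max C 1"])
    fix t assume t: "0 \<le> t" "t \<le> d"
    show "operator_bound t (max C 1)" unfolding operator_bound_def
    proof (intro allI impI ballI)
      fix v :: "'a \<Rightarrow> real" and c x assume v: "continuous_on K v" and c: "\<forall>x\<in>K. \<bar>v x\<bar> \<le> c" and x: "x \<in> K"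
      have "c \<ge> 0" using c x by force
      have "\<bar>T t v x\<bar> \<le> operator_norm t * c"
        by (rule operator_boundD[OF operator_bound_operator_norm v _ x]) (use t c in auto)
      also have "\<dots> \<le> max C 1 * c" using dC(2)[OF t] \<open>c \<ge> 0\<close> by (intro mult_right_mono) auto
      finally show "\<bar>T t v x\<bar> \<le> max C 1 * c" .
    qed
  qed simp
qed

lemma operator_norm_bounded_on_intervals:
  obtains C where "C \<ge> 1" "\<And>t. 0 \<le> t \<Longrightarrow> t \<le> a \<Longrightarrow> operator_bound t C"
proof -
  obtain d C where d: "d > 0" and C: "C \<ge> 1" "\<And>t. 0 \<le> t \<Longrightarrow> t \<le> d \<Longrightarrow> operator_bound t C"
    using operator_norm_bounded_near_0 by metis
  have *: "operator_bound t (C ^ Suc n)" if "0 \<le> t" "t \<le> real (Suc n) * d" for n t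
    using that
  proof (induction n arbitrary: t)
    case 0 then show ?case using C(2)[of t] by simp
  next
    case (Suc n)
    define s where "s = t - min t d"
    have s: "0 \<le> s" "s \<le> real (Suc n) * d" using Suc.prems d by (auto simp: s_def min_def algebra_simps)
    have "operator_bound (min t d + s) (C * C ^ Suc n)"
      by (rule operator_bound_compose[OF _ s(1) C(2) Suc.IH[OF s]]) (use Suc.prems d in auto)
    then show ?case by (simp add: s_def)
  qed
  obtain n where n: "a / d \<le> real n" using real_arch_simple by blast
  show thesis
  proof (rule that[of "C ^ Suc n"])
    show "C ^ Suc n \<ge> 1" using C(1) by (rule one_le_power)
    fix t assume t: "0 \<le> t" "t \<le> a"
    have "a \<le> real n * d" using n d by (simp add: divide_simps)
    also have "\<dots> \<le> real (Suc n) * d" using d by (simp add: algebra_simps)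
    finally show "operator_bound t (C ^ Suc n)" using *[of t n] t by simp
  qed
qed

lemma T_uniformly_close:
  assumes "continuous_on K v" "e > 0" "a \<ge> 0"
  obtains d where "d > 0"
    "\<And>s t x. 0 \<le> s \<Longrightarrow> s \<le> a \<Longrightarrow> 0 \<le> t \<Longrightarrow> t \<le> a \<Longrightarrow> \<bar>s - t\<bar> < d \<Longrightarrow> x \<in> K \<Longrightarrow> \<bar>T s v x - T t v x\<bar> < e"
proof -
  obtain C where C: "C \<ge> 1" "\<And>t. 0 \<le> t \<Longrightarrow> t \<le> a \<Longrightarrow> operator_bound t C"
    using operator_norm_bounded_on_intervals by metis
  have "e / (2 * C) > 0" using assms C by simp
  then obtain d where d: "d > 0" "\<And>t x. 0 \<le> t \<Longrightarrow> t < d \<Longrightarrow> x \<in> K \<Longrightarrow> \<bar>T t v x - v x\<bar> < e / (2 * C)"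
    using T_near_0[OF assms(1)] by metis
  have ord: "\<bar>T s v x - T t v x\<bar> < e" if h: "0 \<le> t" "t \<le> s" "s \<le> a" "s - t < d" "x \<in> K" for s t x
  proof -
    have st: "0 \<le> s - t" using h by simp
    have "T s v x = T t (T (s - t) v) x" using T_add_time[OF h(1) st assms(1) h(5)] by simp
    then have "T s v x - T t v x = T t (\<lambda>y. T (s - t) v y - v y) x"
      using T_diff[OF h(1) continuous_on_T[OF st assms(1)] assms(1) h(5)] by simp
    moreover have "\<bar>T t (\<lambda>y. T (s - t) v y - v y) x\<bar> \<le> C * (e / (2 * C))"
    proof (rule operator_boundD[OF C(2) _ _ h(5)])
      show "continuous_on K (\<lambda>y. T (s - t) v y - v y)" by (intro continuous_intros continuous_on_T st assms)
      show "\<bar>T (s - t) v y - v y\<bar> \<le> e / (2 * C)" if "y \<in> K" for y using d(2)[OF st h(4) that] by simp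
    qed (use h in auto)
    ultimately show ?thesis using C(1) assms(2) by simp
  qed
  show thesis
  proof (rule that[OF d(1)])
    fix s t x assume h: "0 \<le> s" "s \<le> a" "0 \<le> t" "t \<le> a" "\<bar>s - t\<bar> < d" "x \<in> K"
    show "\<bar>T s v x - T t v x\<bar> < e"
      using ord[of s t x] ord[of t s x] h by (cases "s \<le> t") (auto simp: abs_minus_commute)
  qed
qed

text \<open>Continuous curves in \<open>C(K)\<close> are treated as jointly continuous functions of point and time.\<close>

lemma jointly_continuous_slice:
  assumes "continuous_on (K \<times> S) (\<lambda>(x, s). u x s)" "s \<in> S"
  shows "continuous_on K (\<lambda>x. u x s)"
  by (rule continuous_on_compose2[OF assms(1), of _ "\<lambda>x. (x, s)", simplified]) (use assms(2) in \<open>auto intro!: continuous_intros\<close>)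

lemma jointly_continuous_uniform:
  assumes "continuous_on (K \<times> S) (\<lambda>(x, s). u x s :: real)" "s0 \<in> S" "e > 0"
  obtains d where "d > 0" "\<And>s x. s \<in> S \<Longrightarrow> \<bar>s - s0\<bar> < d \<Longrightarrow> x \<in> K \<Longrightarrow> \<bar>u x s - u x (s0::real)\<bar> < e"
proof -
  have sw: "continuous_on (S \<times> K) (\<lambda>(s, x). u x s)"
    unfolding case_prod_beta'
    by (rule continuous_on_compose2[OF assms(1), of _ "\<lambda>q. (snd q, fst q)", simplified]) (auto intro!: continuous_intros)
  have "e / 2 > 0" using assms by simp
  from continuous_on_prod_compactE[OF sw compact_K assms(2) this]
  obtain X0 where X0: "s0 \<in> X0" "open X0"
    and b: "\<forall>s\<in>X0 \<inter> S. \<forall>x\<in>K. dist (u x s) (u x s0) \<le> e / 2"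
    by (auto simp: case_prod_beta')
  obtain d where d: "d > 0" "ball s0 d \<subseteq> X0" using X0 open_contains_ball by blast
  show thesis
  proof (rule that[OF d(1)])
    fix s x assume h: "s \<in> S" "\<bar>s - s0\<bar> < d" "x \<in> K"
    have "s \<in> X0" using d h by (auto simp: dist_real_def abs_minus_commute)
    then have "dist (u x s) (u x s0) \<le> e / 2" using b h by blast
    then show "\<bar>u x s - u x s0\<bar> < e" using assms(3) by (simp add: dist_real_def)
  qed
qed

lemma continuous_on_T_curve:
  assumes u: "continuous_on (K \<times> S) (\<lambda>(x, s). u x (s::real))"
  shows "continuous_on ({0..} \<times> S \<times> K) (\<lambda>(t, s, x). T t (\<lambda>y. u y s) x)"
proof (unfold continuous_on_iff, intro ballI allI impI)
  fix q0 :: "real \<times> real \<times> 'a" and e :: real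
  assume "q0 \<in> {0..} \<times> S \<times> K" and e: "e > 0"
  then obtain t0 s0 x0 where q0: "q0 = (t0, s0, x0)" and h: "t0 \<in> {0..}" "s0 \<in> S" "x0 \<in> K" by auto
  then have t0: "0 \<le> t0" by simp
  obtain C where C: "C \<ge> 1" "\<And>t. 0 \<le> t \<Longrightarrow> t \<le> t0 + 1 \<Longrightarrow> operator_bound t C"
    using operator_norm_bounded_on_intervals by metis
  have cs: "continuous_on K (\<lambda>y. u y s)" if "s \<in> S" for s using jointly_continuous_slice[OF u that] .
  obtain d1 where d1: "d1 > 0" "\<And>s x. s \<in> S \<Longrightarrow> \<bar>s - s0\<bar> < d1 \<Longrightarrow> x \<in> K \<Longrightarrow> \<bar>u x s - u x s0\<bar> < e / (3 * C)"
    using jointly_continuous_uniform[OF u h(2), of "e / (3 * C)"] e C(1) by (auto; blast)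
  obtain d2 where d2: "d2 > 0"
    "\<And>s t x. 0 \<le> s \<Longrightarrow> s \<le> t0 + 1 \<Longrightarrow> 0 \<le> t \<Longrightarrow> t \<le> t0 + 1 \<Longrightarrow> \<bar>s - t\<bar> < d2 \<Longrightarrow> x \<in> K \<Longrightarrow>
       \<bar>T s (\<lambda>y. u y s0) x - T t (\<lambda>y. u y s0) x\<bar> < e / 3"
    using T_uniformly_close[OF cs[OF h(2)], of "e / 3" "t0 + 1"] e t0 by (auto; blast)
  obtain d3 where d3: "d3 > 0" "\<And>x. x \<in> K \<Longrightarrow> dist x x0 < d3 \<Longrightarrow> \<bar>T t0 (\<lambda>y. u y s0) x - T t0 (\<lambda>y. u y s0) x0\<bar> < e / 3"
    using continuous_on_T[OF t0 cs[OF h(2)]] h(3) e unfolding continuous_on_iff dist_real_def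
    by (metis zero_less_divide_iff zero_less_numeral)
  show "\<exists>d>0. \<forall>q\<in>{0..} \<times> S \<times> K. dist q q0 < d \<longrightarrow>
     dist (case q of (t, s, x) \<Rightarrow> T t (\<lambda>y. u y s) x) (case q0 of (t, s, x) \<Rightarrow> T t (\<lambda>y. u y s) x) < e"
    unfolding q0
  proof (rule exI[of _ "min (min d1 d2) (min d3 1)"], intro conjI ballI impI)
    show "min (min d1 d2) (min d3 1) > 0" using d1 d2 d3 by simp
    fix q assume q: "q \<in> {0..} \<times> S \<times> K" "dist q (t0, s0, x0) < min (min d1 d2) (min d3 1)"
    obtain t s x where qe: "q = (t, s, x)" by (cases q) auto
    have m: "t \<ge> 0" "s \<in> S" "x \<in> K" using q qe by auto
    have "dist t t0 \<le> dist q (t0, s0, x0)" "dist s s0 \<le> dist q (t0, s0, x0)" "dist x x0 \<le> dist q (t0, s0, x0)"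
      unfolding qe using dist_fst_le[of "(t, s, x)" "(t0, s0, x0)"] dist_snd_le[of "(t, s, x)" "(t0, s0, x0)"]
        dist_fst_le[of "(s, x)" "(s0, x0)"] dist_snd_le[of "(s, x)" "(s0, x0)"] by auto
    then have ds: "\<bar>t - t0\<bar> < d2" "\<bar>t - t0\<bar> < 1" "\<bar>s - s0\<bar> < d1" "dist x x0 < d3"
      using q(2) by (auto simp: dist_real_def)
    have t1: "t \<le> t0 + 1" using ds by linarith
    have "\<bar>T t (\<lambda>y. u y s - u y s0) x\<bar> \<le> C * (e / (3 * C))"
      by (rule operator_boundD[OF C(2)[OF m(1) t1] _ _ m(3)])
        (use d1(2)[OF m(2) ds(3)] cs m h in \<open>auto intro!: continuous_intros less_imp_le\<close>)
    then have "\<bar>T t (\<lambda>y. u y s) x - T t (\<lambda>y. u y s0) x\<bar> \<le> e / 3"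
      using T_diff[OF m(1) cs[OF m(2)] cs[OF h(2)] m(3)] C(1) by simp
    moreover have "\<bar>T t (\<lambda>y. u y s0) x - T t0 (\<lambda>y. u y s0) x\<bar> < e / 3"
      by (rule d2(2)) (use m t1 t0 ds in auto)
    moreover have "\<bar>T t0 (\<lambda>y. u y s0) x - T t0 (\<lambda>y. u y s0) x0\<bar> < e / 3" by (rule d3(2)) (use m ds in auto)
    ultimately show "dist (case q of (t, s, x) \<Rightarrow> T t (\<lambda>y. u y s) x) (case (t0, s0, x0) of (t, s, x) \<Rightarrow> T t (\<lambda>y. u y s) x) < e"
      unfolding qe dist_real_def prod.case by argo
  qed
qed

end

section \<open>Integrals of curves and the generator\<close>

lemma increment_bound:
  fixes F :: "real \<Rightarrow> real"
  assumes "\<And>s. s \<in> closed_segment r r' \<Longrightarrow> (F has_field_derivative F' s) (at s within closed_segment r r')"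
    and "\<And>s. s \<in> closed_segment r r' \<Longrightarrow> \<bar>F' s - c\<bar> \<le> e"
  shows "\<bar>F r' - F r - (r' - r) * c\<bar> \<le> e * \<bar>r' - r\<bar>"
proof -
  have "norm ((F r' - r' * c) - (F r - r * c)) \<le> e * norm (r' - r)"
  proof (rule field_differentiable_bound[of "closed_segment r r'" _ "\<lambda>s. F' s - c"])
    fix s assume s: "s \<in> closed_segment r r'"
    show "((\<lambda>s. F s - s * c) has_field_derivative F' s - c) (at s within closed_segment r r')"
      by (auto intro!: derivative_eq_intros assms(1)[OF s])
    show "norm (F' s - c) \<le> e" using assms(2)[OF s] by simp
  qed auto
  then show ?thesis by (simp add: algebra_simps)
qed

context strongly_continuous_semigroup
begin

lemma continuous_on_integral_curve:
  fixes a b :: real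
  assumes "continuous_on (K \<times> {a..b}) (\<lambda>(x, s). u x s :: real)"
  shows "continuous_on K (\<lambda>x. integral {a..b} (u x))"
  using integral_continuous_on_param[of K a b u] assms by (simp add: cbox_interval)

lemma continuous_on_time:
  assumes "continuous_on (K \<times> S) (\<lambda>(x, s). u x s)" "x \<in> K"
  shows "continuous_on S (u x)"
  by (rule continuous_on_compose2[OF assms(1), of _ "\<lambda>s. (x, s)", simplified]) (use assms(2) in \<open>auto intro!: continuous_intros\<close>)

lemma jointly_continuous_reparametrize:
  assumes "continuous_on (K \<times> S) (\<lambda>(x, s). u x s)" "continuous_on S' b" "\<And>r. r \<in> S' \<Longrightarrow> b r \<in> S"
  shows "continuous_on (K \<times> S') (\<lambda>(x, r). u x (b r))"
proof -
  have "continuous_on (K \<times> S') (\<lambda>q. (fst q, b (snd q)))"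
    by (intro continuous_on_Pair continuous_on_fst continuous_on_id
        continuous_on_compose2[OF assms(2) continuous_on_snd[OF continuous_on_id]]) auto
  moreover have "(\<lambda>q. (fst q, b (snd q))) ` (K \<times> S') \<subseteq> K \<times> S" using assms(3) by auto
  ultimately show ?thesis
    using continuous_on_compose2[OF assms(1), of "K \<times> S'" "\<lambda>q. (fst q, b (snd q))"]
    by (simp add: case_prod_beta')
qed

lemma continuous_on_T_curve':
  assumes "continuous_on (K \<times> S) (\<lambda>(x, s). u x (s::real))" "continuous_on S' a" "continuous_on S' b"
    "\<And>r. r \<in> S' \<Longrightarrow> a r \<ge> 0" "\<And>r. r \<in> S' \<Longrightarrow> b r \<in> S"
  shows "continuous_on (K \<times> S') (\<lambda>(x, r). T (a r) (\<lambda>y. u y (b r)) x)"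
proof -
  have "continuous_on (K \<times> S') (\<lambda>q. (a (snd q), b (snd q), fst q))"
    by (intro continuous_on_Pair continuous_on_fst continuous_on_id
        continuous_on_compose2[OF assms(2) continuous_on_snd[OF continuous_on_id]]
        continuous_on_compose2[OF assms(3) continuous_on_snd[OF continuous_on_id]]) auto
  moreover have "(\<lambda>q. (a (snd q), b (snd q), fst q)) ` (K \<times> S') \<subseteq> {0..} \<times> S \<times> K" using assms(4,5) by auto
  ultimately show ?thesis
    using continuous_on_compose2[OF continuous_on_T_curve[OF assms(1)], of "K \<times> S'" "\<lambda>q. (a (snd q), b (snd q), fst q)"]
    by (simp add: case_prod_beta')
qed

lemma continuous_on_orbit:
  assumes "continuous_on K v"
  shows "continuous_on (K \<times> {0..}) (\<lambda>(x, t). T t v x)"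
proof -
  have "continuous_on (K \<times> {0}) (\<lambda>(x, s). v x)"
    unfolding case_prod_beta' by (rule continuous_on_compose2[OF assms]) (auto intro!: continuous_intros)
  from continuous_on_T_curve'[OF this, of "{0..}" "\<lambda>t. t" "\<lambda>_. 0"] show ?thesis by (auto intro!: continuous_intros)
qed

text \<open>Both sides vanish for \<open>b = a\<close> and have, as functions of \<open>b\<close>, the derivative
  \<open>T t (u b) x\<close>: the left one since \<open>T t\<close> is linear and bounded and \<open>u\<close> is continuous
  in the supremum norm.\<close>

lemma T_integral:
  fixes a b :: real
  assumes u: "continuous_on (K \<times> {a..b}) (\<lambda>(x, s). u x s)" and "a \<le> b" and t: "t \<ge> 0" and x: "x \<in> K"
  shows "T t (\<lambda>y. integral {a..b} (u y)) x = integral {a..b} (\<lambda>s. T t (\<lambda>y. u y s) x)"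
proof -
  obtain C where C: "C \<ge> 0" "operator_bound t C" using operator_bound_exists[OF t] by blast
  have usub: "continuous_on (K \<times> {a..r}) (\<lambda>(x, s). u x s)" if "r \<in> {a..b}" for r
    using that by (intro continuous_on_subset[OF u]) auto
  have cI: "continuous_on K (\<lambda>y. integral {a..r} (u y))" if "r \<in> {a..b}" for r
    by (rule continuous_on_integral_curve[OF usub[OF that]])
  have cu: "continuous_on K (\<lambda>y. u y r)" if "r \<in> {a..b}" for r
    by (rule jointly_continuous_slice[OF u that])
  have dI: "((\<lambda>r. integral {a..r} (u y)) has_field_derivative u y r) (at r within {a..b})" if "y \<in> K" "r \<in> {a..b}" for y r
    by (rule integral_has_real_derivative[OF continuous_on_time[OF u that(1)] that(2)])
  have cT: "continuous_on {a..b} (\<lambda>s. T t (\<lambda>y. u y s) x)"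
    by (rule continuous_on_time[OF continuous_on_T_curve'[OF u, of "{a..b}" "\<lambda>_. t" "\<lambda>s. s"] x])
      (use t in \<open>auto intro!: continuous_intros\<close>)
  have d1: "((\<lambda>r. T t (\<lambda>y. integral {a..r} (u y)) x) has_field_derivative T t (\<lambda>y. u y r) x) (at r within {a..b})"
    if r: "r \<in> {a..b}" for r
    unfolding has_field_derivative_def has_derivative_within_alt
  proof (intro conjI allI impI)
    show "bounded_linear ((*) (T t (\<lambda>y. u y r) x))" by (rule bounded_linear_mult_right)
    fix e :: real assume e: "e > 0"
    then have "e / (C + 1) > 0" using C by simp
    from jointly_continuous_uniform[OF u r this] obtain d where d: "d > 0"
      "\<And>s y. s \<in> {a..b} \<Longrightarrow> \<bar>s - r\<bar> < d \<Longrightarrow> y \<in> K \<Longrightarrow> \<bar>u y s - u y r\<bar> < e / (C + 1)" by blast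
    have "norm (T t (\<lambda>y. integral {a..r'} (u y)) x - T t (\<lambda>y. integral {a..r} (u y)) x - T t (\<lambda>y. u y r) x * (r' - r)) \<le> e * norm (r' - r)"
      if r': "r' \<in> {a..b}" "norm (r' - r) < d" for r'
    proof -
      have sub: "closed_segment r r' \<subseteq> {a..b}" using r r'(1) by (simp add: closed_segment_subset)
      have "\<bar>integral {a..r'} (u y) - integral {a..r} (u y) - (r' - r) * u y r\<bar> \<le> e / (C + 1) * \<bar>r' - r\<bar>" if y: "y \<in> K" for y
      proof (rule increment_bound)
        fix s assume s: "s \<in> closed_segment r r'"
        show "((\<lambda>r. integral {a..r} (u y)) has_field_derivative u y s) (at s within closed_segment r r')"
          using has_field_derivative_subset[OF dI[OF y, of s] sub] s sub by blast
        have "\<bar>s - r\<bar> < d" using segment_bound1[OF s] r'(2) by (simp add: abs_minus_commute)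
        then show "\<bar>u y s - u y r\<bar> \<le> e / (C + 1)" using d(2)[of s y] s sub y by (auto intro: less_imp_le)
      qed
      then have "\<bar>T t (\<lambda>y. integral {a..r'} (u y) - integral {a..r} (u y) - (r' - r) * u y r) x\<bar> \<le> C * (e / (C + 1) * \<bar>r' - r\<bar>)"
        by (intro operator_boundD[OF C(2) _ _ x]) (auto intro!: continuous_intros cI cu r r')
      also have "\<dots> \<le> e * \<bar>r' - r\<bar>"
        using C e by (simp add: divide_simps) (simp add: algebra_simps mult_left_mono)
      also have "T t (\<lambda>y. integral {a..r'} (u y) - integral {a..r} (u y) - (r' - r) * u y r) x
          = T t (\<lambda>y. integral {a..r'} (u y)) x - T t (\<lambda>y. integral {a..r} (u y)) x - (r' - r) * T t (\<lambda>y. u y r) x"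
        by (subst T_diff[OF t _ _ x], (intro continuous_intros cI cu r r')+)+
           (simp add: T_diff[OF t cI[OF r'(1)] cI[OF r] x] T_scale[OF t cu[OF r] x])
      finally show ?thesis by (simp add: mult.commute)
    qed
    then show "\<exists>d>0. \<forall>y\<in>{a..b}. norm (y - r) < d \<longrightarrow>
        norm (T t (\<lambda>ya. integral {a..y} (u ya)) x - T t (\<lambda>y. integral {a..r} (u y)) x - T t (\<lambda>y. u y r) x * (y - r)) \<le> e * norm (y - r)"
      using d(1) by blast
  qed
  have d2: "((\<lambda>r. integral {a..r} (\<lambda>s. T t (\<lambda>y. u y s) x)) has_field_derivative T t (\<lambda>y. u y r) x) (at r within {a..b})"
    if r: "r \<in> {a..b}" for r
    by (rule integral_has_real_derivative[OF cT r])
  have "\<exists>c. \<forall>r\<in>{a..b}. T t (\<lambda>y. integral {a..r} (u y)) x - integral {a..r} (\<lambda>s. T t (\<lambda>y. u y s) x) = c"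
    by (rule has_field_derivative_zero_constant) (auto intro!: derivative_eq_intros d1 d2)
  then obtain c where c: "\<And>r. r \<in> {a..b} \<Longrightarrow> T t (\<lambda>y. integral {a..r} (u y)) x - integral {a..r} (\<lambda>s. T t (\<lambda>y. u y s) x) = c"
    by blast
  have "T t (\<lambda>y. 0 :: real) x = 0" using T_scale[OF t continuous_on_const[of K 0] x, of 0] by simp
  then have "c = 0" using c[of a] \<open>a \<le> b\<close> by simp
  then show ?thesis using c[of b] \<open>a \<le> b\<close> by simp
qed

text \<open>By the mean value inequality the error of the difference quotient at \<open>x\<close> is controlled by the oscillation of
\<open>F' x\<close> near \<open>0\<close>, which is uniform in \<open>x\<close> because \<open>K\<close> is compact.\<close>

lemma uniform_difference_quotient:
  assumes F: "\<And>x s. x \<in> K \<Longrightarrow> s \<in> {0..1} \<Longrightarrow> (F x has_field_derivative F' x s) (at s within {0..1})"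
    and F': "continuous_on (K \<times> {0..1}) (\<lambda>(x, s). F' x s :: real)"
  shows "uniform_limit K (\<lambda>s x. (F x s - F x 0) / s) (\<lambda>x. F' x 0) (at_right 0)"
proof (rule uniform_limitI)
  fix e :: real assume "e > 0"
  then obtain d where d: "d > 0" "\<And>s x. s \<in> {0..1} \<Longrightarrow> \<bar>s - 0\<bar> < d \<Longrightarrow> x \<in> K \<Longrightarrow> \<bar>F' x s - F' x 0\<bar> < e / 2"
    using jointly_continuous_uniform[OF F', of 0 "e / 2"] by auto
  have "\<forall>\<^sub>F s::real in at_right 0. 0 < s \<and> s < min d 1"
    unfolding eventually_at_right_field using d(1) by (auto intro!: exI[of _ "min d 1"])
  then show "\<forall>\<^sub>F s in at_right 0. \<forall>x\<in>K. dist ((F x s - F x 0) / s) (F' x 0) < e"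
  proof eventually_elim
    case (elim s)
    show ?case
    proof
      fix x assume x: "x \<in> K"
      have sub: "closed_segment 0 s \<subseteq> {0..1}" and seg: "r \<in> {0..1} \<and> \<bar>r - 0\<bar> < d" if "r \<in> closed_segment 0 s" for r
        using elim that by (auto simp: closed_segment_eq_real_ivl)
      have "\<bar>F x s - F x 0 - (s - 0) * F' x 0\<bar> \<le> e / 2 * \<bar>s - 0\<bar>"
      proof (rule increment_bound)
        fix r assume r: "r \<in> closed_segment 0 s"
        show "(F x has_field_derivative F' x r) (at r within closed_segment 0 s)"
          using has_field_derivative_subset[OF F[OF x, of r] sub] seg[OF r] r by blast
        show "\<bar>F' x r - F' x 0\<bar> \<le> e / 2" using d(2)[of r x] seg[OF r] x by (auto intro: less_imp_le)
      qed
      moreover have "(F x s - F x 0) / s - F' x 0 = (F x s - F x 0 - (s - 0) * F' x 0) / s"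
        using elim by (simp add: field_simps)
      ultimately have "\<bar>(F x s - F x 0) / s - F' x 0\<bar> \<le> e / 2" using elim by (simp add: divide_simps mult.commute)
      then show "dist ((F x s - F x 0) / s) (F' x 0) < e" using \<open>e > 0\<close> by (simp add: dist_real_def)
    qed
  qed
qed

text \<open>Shifting the integral by the semigroup moves its limits, so that differentiating at time \<open>0\<close>
  leaves the boundary terms. If \<open>l > 0\<close> and \<open>T\<close> is bounded, the integral tends to the resolvent of \<open>v\<close>
  for large \<open>S\<close>; the case \<open>l = 0\<close> shows that the domain of the generator is dense.\<close>

lemma generator_truncated_resolvent:
  fixes S l :: real
  assumes v: "continuous_on K v" and "S \<ge> 0"
  defines "w \<equiv> \<lambda>x. integral {0..S} (\<lambda>s. exp (- l * s) * T s v x)"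
  shows "generator_on K T w (\<lambda>x. l * w x - v x + exp (- l * S) * T S v x)"
proof -
  define q where "q x r = exp (- l * r) * T (max r 0) v x" for x r
  have orb: "continuous_on (K \<times> {0..}) (\<lambda>(x, t). T t v x)" by (rule continuous_on_orbit[OF v])
  have cT: "continuous_on (K \<times> UNIV) (\<lambda>q. T (max (snd q) 0) v (fst q))"
    by (rule continuous_on_compose2[OF orb, of _ "\<lambda>q. (fst q, max (snd q) 0)", simplified])
      (auto intro!: continuous_intros)
  have cq: "continuous_on (K \<times> UNIV) (\<lambda>(x, r). q x r)"
    unfolding q_def case_prod_beta' by (intro continuous_intros cT)
  have cqx: "continuous_on A (q x)" if "x \<in> K" for A x
    by (rule continuous_on_subset[OF continuous_on_time[OF cq that]]) simp
  have wq: "w = (\<lambda>x. integral {0..S} (q x))"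
    unfolding w_def q_def by (intro ext integral_cong) auto
  have cw: "continuous_on K w"
    unfolding wq by (intro continuous_on_integral_curve continuous_on_subset[OF cq]) auto
  define J where "J x r = integral {-1..r} (q x)" for x r
  have dJ: "(J x has_field_derivative q x r) (at r)" if "x \<in> K" "r > - 1" for x r
  proof -
    have "((\<lambda>r. integral {-1..r} (q x)) has_real_derivative q x r) (at r within {-1..r + 1})"
      using that by (intro integral_has_real_derivative cqx) auto
    moreover have "at r within {-1..r + 1} = at r" using that by (intro at_within_interior) auto
    ultimately show ?thesis unfolding J_def by simp
  qed
  define F where "F x h = exp (l * h) * (J x (S + h) - J x h)" for x h
  have TwF: "T h w x = F x h" if "h \<ge> 0" "x \<in> K" for h x
  proof -
    have "T h w x = integral {0..S} (\<lambda>s. T h (\<lambda>y. q y s) x)"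
      unfolding wq by (rule T_integral) (use that assms(2) in \<open>auto intro!: continuous_on_subset[OF cq]\<close>)
    also have "\<dots> = integral {0..S} (\<lambda>s. exp (l * h) * (q x \<circ> (+) h) s)"
    proof (intro integral_cong)
      fix s assume s: "s \<in> {0..S}"
      have "T h (\<lambda>y. q y s) x = exp (- l * s) * T h (T s v) x"
        unfolding q_def using s that T_scale[OF that(1) continuous_on_T[OF _ v] that(2)] by simp
      also have "T h (T s v) x = T (s + h) v x" using T_add_time[of h s v x] s that v by (simp add: add.commute)
      also have "exp (- l * s) = exp (l * h) * exp (- l * (s + h))" by (simp add: exp_add[symmetric] algebra_simps)
      finally show "T h (\<lambda>y. q y s) x = exp (l * h) * (q x \<circ> (+) h) s" using s that by (simp add: q_def add.commute)
    qed
    also have "\<dots> = exp (l * h) * integral {0..S} (q x \<circ> (+) h)" by (rule integral_mult_right)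
    also have "integral {0..S} (q x \<circ> (+) h) = integral {0 + h..S + h} (q x)"
      by (rule integral_shift_Icc_real)
    also have "\<dots> = J x (S + h) - J x h"
      unfolding J_def using that assms(2)
      using Henstock_Kurzweil_Integration.integral_combine[where a = "-1" and c = h and b = "S + h" and f = "q x"]
      by (simp add: integrable_continuous_real cqx)
    finally show ?thesis by (simp add: F_def)
  qed
  define F' where "F' x h = l * F x h + exp (l * h) * (q x (S + h) - q x h)" for x h
  have "uniform_limit K (\<lambda>h x. (F x h - F x 0) / h) (\<lambda>x. F' x 0) (at_right 0)"
  proof (rule uniform_difference_quotient)
    fix x s assume x: "x \<in> K" and s: "s \<in> {0..1::real}"
    have "((\<lambda>h. J x (S + h)) has_field_derivative q x (S + s)) (at s)"
      using DERIV_shift[of "J x" "q x (S + s)" s S] dJ[OF x, of "S + s"] s assms(2) by (simp add: add.commute)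
    then have "(F x has_field_derivative F' x s) (at s)"
      unfolding F_def[abs_def] F'_def using dJ[OF x, of s] s
      by (auto intro!: derivative_eq_intros simp: algebra_simps)
    then show "(F x has_field_derivative F' x s) (at s within {0..1})" by (rule has_field_derivative_at_within)
  next
    have "continuous_on (K \<times> {0..1}) (\<lambda>(x, t). T t w x)"
      by (rule continuous_on_subset[OF continuous_on_orbit[OF cw]]) auto
    then have "continuous_on (K \<times> {0..1}) (\<lambda>(x, t). F x t)"
      by (rule continuous_on_cong[THEN iffD1, rotated 2]) (auto simp: TwF)
    then have 1: "continuous_on (K \<times> {0..1}) (\<lambda>q. F (fst q) (snd q))" by (simp add: case_prod_beta')
    have 2: "continuous_on (K \<times> {0..1}) (\<lambda>p. q (fst p) (S + snd p))" "continuous_on (K \<times> {0..1}) (\<lambda>p. q (fst p) (snd p))"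
      using jointly_continuous_reparametrize[OF cq continuous_on_add[OF continuous_on_const continuous_on_id], of "{0..1}" S]
        jointly_continuous_reparametrize[OF cq continuous_on_id, of "{0..1}"]
      by (simp_all add: case_prod_beta')
    show "continuous_on (K \<times> {0..1}) (\<lambda>(x, s). F' x s)"
      unfolding F'_def case_prod_beta' by (intro continuous_intros 1 2)
  qed
  then have lim: "uniform_limit K (\<lambda>h x. (T h w x - w x) / h) (\<lambda>x. l * w x - v x + exp (- l * S) * T S v x) (at_right 0)"
  proof (rule uniform_limit_cong[THEN iffD1, rotated 2])
    have F0: "F x 0 = w x" if "x \<in> K" for x using TwF[of 0 x] T_0[OF cw] that by simp
    show "F' x 0 = l * w x - v x + exp (- l * S) * T S v x" if "x \<in> K" for x
      using F0[OF that] T_0[OF v that] assms(2) by (simp add: F'_def q_def)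
    show "\<forall>\<^sub>F h in at_right 0. \<forall>x\<in>K. (F x h - F x 0) / h = (T h w x - w x) / h"
      unfolding eventually_at_right_field using TwF F0 by (intro exI[of _ 1]) auto
  qed
  show ?thesis unfolding generator_on_def
    by (intro conjI lim cw continuous_intros v continuous_on_T assms(2))
qed

lemma generator_on_T:
  assumes g: "generator_on K T v w" and t: "t \<ge> 0"
  shows "generator_on K T (T t v) (T t w)"
proof -
  have v: "continuous_on K v" and w: "continuous_on K w"
    and l: "uniform_limit K (\<lambda>t x. (T t v x - v x) / t) w (at_right 0)"
    using g unfolding generator_on_def by auto
  obtain C where C: "C \<ge> 0" "operator_bound t C" using operator_bound_exists[OF t] by blast
  have "uniform_limit K (\<lambda>h x. (T h (T t v) x - T t v x) / h) (T t w) (at_right 0)"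
  proof (rule uniform_limitI)
    fix e :: real assume e: "e > 0"
    have "\<forall>\<^sub>F h in at_right 0. \<forall>x\<in>K. dist ((T h v x - v x) / h) (w x) < e / (C + 1)"
      by (rule uniform_limitD[OF l]) (use e C in simp)
    moreover have "\<forall>\<^sub>F h::real in at_right 0. h > 0" by (rule eventually_at_right_less)
    ultimately show "\<forall>\<^sub>F h in at_right 0. \<forall>x\<in>K. dist ((T h (T t v) x - T t v x) / h) (T t w x) < e"
    proof eventually_elim
      case (elim h)
      then have h: "h \<ge> 0" by simp
      show ?case
      proof
        fix x assume x: "x \<in> K"
        have cTh: "continuous_on K (T h v)" by (rule continuous_on_T[OF h v])
        have "T h (T t v) x = T t (T h v) x"
          using T_add_time[OF h t v x] T_add_time[OF t h v x] by (simp add: add.commute)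
        then have "(T h (T t v) x - T t v x) / h - T t w x = (1 / h) * T t (\<lambda>y. T h v y - v y) x - T t w x"
          using T_diff[OF t cTh v x] by simp
        also have "\<dots> = T t (\<lambda>y. (1 / h) * (T h v y - v y)) x - T t w x"
          by (subst T_scale[OF t _ x]) (use elim in \<open>auto intro!: continuous_intros cTh v\<close>)
        also have "\<dots> = T t (\<lambda>y. (1 / h) * (T h v y - v y) - w y) x"
          by (subst T_diff[OF t _ w x]) (use elim in \<open>auto intro!: continuous_intros cTh v\<close>)
        also have "\<bar>\<dots>\<bar> \<le> C * (e / (C + 1))"
          by (rule operator_boundD[OF C(2) _ _ x])
            (use elim in \<open>auto intro!: continuous_on_diff continuous_on_divide continuous_on_const cTh v w simp: dist_real_def less_imp_le\<close>)
        also have "\<dots> < e" using C e by (simp add: field_simps)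
        finally show "dist ((T h (T t v) x - T t v x) / h) (T t w x) < e" by (simp add: dist_real_def)
      qed
    qed
  qed
  then show ?thesis unfolding generator_on_def by (intro conjI continuous_on_T t v w)
qed

end

section \<open>Dissipative semigroups and comparison\<close>

text \<open>Continuous induction: the set of times up to which a bound holds is closed, so it suffices that
  the bound extends a little to the right of every such time.\<close>

lemma bound_by_continuation:
  fixes w :: "'b \<Rightarrow> real \<Rightarrow> real"
  assumes cont_w: "\<And>x. x \<in> K \<Longrightarrow> continuous_on {a..b} (w x)" and cont_bd: "continuous_on {a..b} \<beta>"
    and init: "\<And>x. x \<in> K \<Longrightarrow> w x a \<le> \<beta> a"
    and step: "\<And>t. a \<le> t \<Longrightarrow> t < b \<Longrightarrow> (\<And>s x. a \<le> s \<Longrightarrow> s \<le> t \<Longrightarrow> x \<in> K \<Longrightarrow> w x s \<le> \<beta> s) \<Longrightarrow>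
      \<exists>d>0. \<forall>h. 0 < h \<and> h < d \<longrightarrow> (\<forall>x\<in>K. w x (t + h) \<le> \<beta> (t + h))"
    and t: "a \<le> t" "t \<le> b" and x: "x \<in> K"
  shows "w x t \<le> \<beta> t"
proof -
  define S where "S = {t \<in> {a..b}. \<forall>s\<in>{a..t}. \<forall>x\<in>K. w x s \<le> \<beta> s}"
  define c where "c = Sup S"
  have ab: "a \<le> b" using t by simp
  have aS: "a \<in> S" using ab init by (auto simp: S_def)
  have bdd: "bdd_above S" by (rule bdd_aboveI[of _ b]) (auto simp: S_def)
  have ac: "a \<le> c" unfolding c_def by (rule cSup_upper[OF aS bdd])
  have cb: "c \<le> b" unfolding c_def using aS by (intro cSup_least) (auto simp: S_def)
  have below: "w x s \<le> \<beta> s" if "a \<le> s" "s < c" "x \<in> K" for s x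
  proof -
    have "\<exists>r\<in>S. s < r" using less_cSupD[of S s] aS that(2) unfolding c_def by auto
    then show ?thesis using that by (auto simp: S_def)
  qed
  have upto: "w x s \<le> \<beta> s" if "a \<le> s" "s \<le> c" "x \<in> K" for s x
  proof (cases "s < c")
    case True then show ?thesis using below that by blast
  next
    case False
    then have [simp]: "s = c" using that by simp
    show ?thesis
    proof (cases "c = a")
      case True then show ?thesis using init that by simp
    next
      case False
      with ac have "a < c" by simp
      show ?thesis
      proof (rule ccontr)
        assume "\<not> w x s \<le> \<beta> s"
        then have pos: "w x c - \<beta> c > 0" by simp
        have "continuous_on {a..b} (\<lambda>s. w x s - \<beta> s)" by (intro continuous_intros cont_w that cont_bd)
        then obtain d where d: "d > 0" "\<And>r. r \<in> {a..b} \<Longrightarrow> dist r c < d \<Longrightarrow> dist (w x r - \<beta> r) (w x c - \<beta> c) < w x c - \<beta> c"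
          unfolding continuous_on_iff using pos ac cb by (meson atLeastAtMost_iff)
        define r where "r = max a (c - d / 2)"
        have r: "a \<le> r" "r < c" "dist r c < d" "r \<in> {a..b}" using \<open>a < c\<close> d(1) cb by (auto simp: r_def dist_real_def)
        show False using d(2)[OF r(4,3)] below[OF r(1,2) that(3)] by (simp add: dist_real_def)
      qed
    qed
  qed
  have "c = b"
  proof (rule ccontr)
    assume "c \<noteq> b"
    with cb have "c < b" by simp
    from step[OF ac this upto] obtain d where d: "d > 0"
      "\<And>h x. 0 < h \<Longrightarrow> h < d \<Longrightarrow> x \<in> K \<Longrightarrow> w x (c + h) \<le> \<beta> (c + h)" by blast
    define r where "r = min b (c + d / 2)"
    have "r \<in> S" unfolding S_def
    proof (intro CollectI conjI ballI)
      show "r \<in> {a..b}" using ac cb d(1) by (auto simp: r_def)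
      fix s x assume s: "s \<in> {a..r}" and x: "x \<in> K"
      show "w x s \<le> \<beta> s"
        using upto[of s x] d(2)[of "s - c" x] s x d(1) by (cases "s \<le> c") (auto simp: r_def)
    qed
    then have "r \<le> c" unfolding c_def by (rule cSup_upper[OF _ bdd])
    then show False using \<open>c < b\<close> d(1) by (auto simp: r_def min_def split: if_splits)
  qed
  then show ?thesis using upto t x by simp
qed

locale dissipative_semigroup = strongly_continuous_semigroup +
  assumes dissipative:
    "generator_on K T v w \<Longrightarrow> d > 0 \<Longrightarrow> (\<And>x. x \<in> K \<Longrightarrow> v x - d * w x \<le> c) \<Longrightarrow> x \<in> K \<Longrightarrow> v x \<le> c"
begin

text \<open>For \<open>v\<close> in the domain of the generator \<open>A\<close>, the orbit satisfies
  \<open>T (t + h) v - h A T (t + h) v = T t v + o(h)\<close>, and by dissipativity an upper bound of the left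
  hand side is an upper bound of \<open>T (t + h) v\<close>. Hence upper bounds cannot grow at a positive rate.\<close>

lemma T_le_of_generator_domain:
  assumes g: "generator_on K T v w" and le: "\<And>x. x \<in> K \<Longrightarrow> v x \<le> c" and t: "t \<ge> 0" and x: "x \<in> K"
  shows "T t v x \<le> c"
proof (rule field_le_epsilon)
  fix e' :: real assume "e' > 0"
  define e where "e = e' / (t + 1)"
  have e: "e > 0" "e * t \<le> e'" using \<open>e' > 0\<close> t by (simp_all add: e_def divide_simps)
  have v: "continuous_on K v" and w: "continuous_on K w" using g unfolding generator_on_def by auto
  have "T t v x \<le> c + e * t"
  proof (rule bound_by_continuation[of K 0 t "\<lambda>x s. T s v x" "\<lambda>s. c + e * s"])
    show "continuous_on {0..t} (\<lambda>s. T s v x)" if "x \<in> K" for x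
      by (rule continuous_on_time[OF continuous_on_subset[OF continuous_on_orbit[OF v]] that]) auto
    fix s assume s: "0 \<le> s" "s < t" and hist: "\<And>r x. 0 \<le> r \<Longrightarrow> r \<le> s \<Longrightarrow> x \<in> K \<Longrightarrow> T r v x \<le> c + e * r"
    have gs: "generator_on K T (T s v) (T s w)" by (rule generator_on_T[OF g s(1)])
    have cs: "continuous_on K (T s v)" "continuous_on K (T s w)" by (intro continuous_on_T s v w)+
    have "uniform_limit K (\<lambda>h x. (T h (T s v) x - T s v x) / h) (T s w) (at_right 0)"
      using gs unfolding generator_on_def by simp
    then have "\<forall>\<^sub>F h in at_right 0. \<forall>x\<in>K. dist ((T h (T s v) x - T s v x) / h) (T s w x) < e / 2"
      by (rule uniform_limitD) (use e in simp)
    then obtain d1 where d1: "d1 > 0"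
      "\<And>h x. 0 < h \<Longrightarrow> h < d1 \<Longrightarrow> x \<in> K \<Longrightarrow> dist ((T h (T s v) x - T s v x) / h) (T s w x) < e / 2"
      unfolding eventually_at_right_field by (metis)
    obtain d2 where d2: "d2 > 0" "\<And>h x. 0 \<le> h \<Longrightarrow> h < d2 \<Longrightarrow> x \<in> K \<Longrightarrow> \<bar>T h (T s w) x - T s w x\<bar> < e / 2"
      using T_near_0[OF cs(2), of "e / 2"] e by auto
    show "\<exists>d>0. \<forall>h. 0 < h \<and> h < d \<longrightarrow> (\<forall>x\<in>K. T (s + h) v x \<le> c + e * (s + h))"
    proof (intro exI[of _ "min d1 d2"] conjI allI impI ballI)
      show "min d1 d2 > 0" using d1 d2 by simp
      fix h y assume "0 < h \<and> h < min d1 d2" and y: "y \<in> K"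
      then have h: "0 < h" "h < d1" "h < d2" by auto
      have "T h (T s v) y \<le> c + e * (s + h)"
      proof (rule dissipative[OF generator_on_T[OF gs, of h] h(1) _ y])
        fix z assume z: "z \<in> K"
        have "T h (T s v) z - T s v z = h * ((T h (T s v) z - T s v z) / h)" using h by simp
        also have "\<dots> \<le> h * (T s w z + e / 2)"
        proof (rule mult_left_mono)
          show "(T h (T s v) z - T s v z) / h \<le> T s w z + e / 2"
            using d1(2)[OF h(1,2) z] unfolding dist_real_def by linarith
        qed (use h in simp)
        finally have 1: "T h (T s v) z \<le> T s v z + h * T s w z + h * e / 2" by (simp add: algebra_simps)
        have "h * T h (T s w) z \<ge> h * (T s w z - e / 2)"
        proof (rule mult_left_mono)
          show "T s w z - e / 2 \<le> T h (T s w) z" using d2(2)[of h z] h z by linarith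
        qed (use h in simp)
        with 1 show "T h (T s v) z - h * T h (T s w) z \<le> c + e * (s + h)"
          using hist[of s z] s z by (simp add: algebra_simps)
      qed (use h in simp)
      then show "T (s + h) v y \<le> c + e * (s + h)" using T_add_time[of h s v y] h s v y by (simp add: add.commute)
    qed
  qed (use t x le T_0[OF v] in \<open>auto intro!: continuous_intros\<close>)
  also have "\<dots> \<le> c + e'" using e by simp
  finally show "T t v x \<le> c + e'" .
qed

text \<open>The domain of the generator is dense: the averages of \<open>T s v\<close> over short intervals \<open>{0..S}\<close> belong to it,
are nearly bounded by \<open>c\<close>, and are mapped by \<open>T t\<close> to the averages over \<open>{t..t + S}\<close>, which are close
to \<open>T t v\<close>.\<close>

lemma T_le:
  assumes v: "continuous_on K v" and le: "\<And>x. x \<in> K \<Longrightarrow> v x \<le> c" and t: "t \<ge> 0" and x: "x \<in> K"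
  shows "T t v x \<le> c"
proof (rule field_le_epsilon)
  fix e' :: real assume "e' > 0"
  define e where "e = e' / 2"
  have e: "e > 0" using \<open>e' > 0\<close> by (simp add: e_def)
  obtain d where d: "d > 0" "\<And>s r y. 0 \<le> s \<Longrightarrow> s \<le> t + 1 \<Longrightarrow> 0 \<le> r \<Longrightarrow> r \<le> t + 1 \<Longrightarrow> \<bar>s - r\<bar> < d \<Longrightarrow> y \<in> K \<Longrightarrow> \<bar>T s v y - T r v y\<bar> < e"
    using T_uniformly_close[OF v e, of "t + 1"] t by auto
  define S where "S = min (d / 2) 1"
  have S: "S > 0" "S < d" "S \<le> 1" using d(1) by (auto simp: S_def)
  define w where "w x = integral {0..S} (\<lambda>s. T s v x)" for x
  have gw: "generator_on K T w (\<lambda>x. - v x + T S v x)"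
    using generator_truncated_resolvent[OF v, of S 0] S unfolding w_def by simp
  have orb: "continuous_on (K \<times> {0..S}) (\<lambda>(x, s). T s v x)"
    by (rule continuous_on_subset[OF continuous_on_orbit[OF v]]) auto
  have int: "(\<lambda>s. T s v y) integrable_on {0..S}" if "y \<in> K" for y
    by (intro integrable_continuous_real continuous_on_time[OF orb that])
  have wle: "w y \<le> S * (c + e)" if y: "y \<in> K" for y
  proof -
    have "w y \<le> integral {0..S} (\<lambda>s. c + e)"
      unfolding w_def
    proof (rule integral_le[OF int[OF y]])
      fix s assume s: "s \<in> {0..S}"
      have "\<bar>T s v y - T 0 v y\<bar> < e" by (rule d(2)) (use s S t y in auto)
      then show "T s v y \<le> c + e" using le[OF y] T_0[OF v y] by simp
    qed (rule integrable_const_ivl)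
    then show ?thesis using S by simp
  qed
  have "T t w x \<le> S * (c + e)" by (rule T_le_of_generator_domain[OF gw wle t x])
  moreover have "T t w x = integral {0..S} (\<lambda>s. T t (T s v) x)"
    unfolding w_def using T_integral[OF orb _ t x] S by simp
  moreover have "integral {0..S} (\<lambda>s. T t v x - e) \<le> integral {0..S} (\<lambda>s. T t (T s v) x)"
  proof (rule integral_le)
    have "continuous_on (K \<times> {0..S}) (\<lambda>(x, s). T t (\<lambda>y. T s v y) x)"
      by (rule continuous_on_T_curve'[OF orb]) (use t in \<open>auto intro!: continuous_intros\<close>)
    from integrable_continuous_real[OF continuous_on_time[OF this x]]
    show "(\<lambda>s. T t (T s v) x) integrable_on {0..S}" .
    fix s assume s: "s \<in> {0..S}"
    have "\<bar>T (t + s) v x - T t v x\<bar> < e" by (rule d(2)) (use s S t x in auto)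
    then show "T t v x - e \<le> T t (T s v) x" using T_add_time[OF t _ v x, of s] s by simp
  qed (rule integrable_const_ivl)
  moreover have "integral {0..S} (\<lambda>s. T t v x - e) = S * (T t v x - e)" using S by simp
  ultimately have "S * (T t v x - e) \<le> S * (c + e)" by linarith
  then have "T t v x - e \<le> c + e" by (rule mult_left_le_imp_le) (rule S(1))
  then show "T t v x \<le> c + e'" by (simp add: e_def)
qed

lemma T_ge:
  assumes "continuous_on K v" "\<And>x. x \<in> K \<Longrightarrow> c \<le> v x" "t \<ge> 0" "x \<in> K"
  shows "c \<le> T t v x"
  using T_le[of "\<lambda>y. - v y" "- c" t x] T_minus[OF assms(3,1,4)] assms by (simp add: continuous_on_minus)

lemma T_const: "t \<ge> 0 \<Longrightarrow> x \<in> K \<Longrightarrow> T t (\<lambda>_. c) x = c"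
  by (intro antisym T_le T_ge) auto

lemma T_mono:
  assumes "continuous_on K v" "continuous_on K w" "\<And>x. x \<in> K \<Longrightarrow> v x \<le> w x" "t \<ge> 0" "x \<in> K"
  shows "T t v x \<le> T t w x"
  using T_ge[of "\<lambda>y. w y - v y" 0 t x] T_diff[OF assms(4,2,1,5)] assms by (simp add: continuous_on_diff)

lemma T_abs_le:
  assumes "continuous_on K v" "\<And>x. x \<in> K \<Longrightarrow> \<bar>v x\<bar> \<le> c" "t \<ge> 0" "x \<in> K"
  shows "\<bar>T t v x\<bar> \<le> c"
  using T_le[OF assms(1) _ assms(3,4), of c] T_ge[OF assms(1) _ assms(3,4), of "- c"] assms(2)
  by (simp add: abs_le_iff minus_le_iff)

text \<open>The relation \<open>u' = A u + R\<close> near time \<open>t0\<close>, with \<open>A\<close> the generator, is used only in the form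
\<open>u (t + h) = T h (u t + h R t) + o(h)\<close> for \<open>h\<close> tending to \<open>0\<close> from the right. As \<open>T h\<close> preserves bounds, it
reduces maximum principles for \<open>u\<close> to pointwise estimates of \<open>u t + h R t\<close>. The error is required to be
uniform for \<open>t\<close> near \<open>t0\<close>, so that Euler steps that end at \<open>t0\<close> are covered besides those that start
there.\<close>

definition euler_consistent :: "('a \<Rightarrow> real \<Rightarrow> real) \<Rightarrow> ('a \<Rightarrow> real \<Rightarrow> real) \<Rightarrow> real \<Rightarrow> bool" where
  "euler_consistent u R t0 \<longleftrightarrow> (\<forall>e>0. \<exists>d>0. \<forall>t h. 0 \<le> t \<longrightarrow> \<bar>t - t0\<bar> < d \<longrightarrow> 0 < h \<longrightarrow> h < d \<longrightarrow>
     (\<forall>x\<in>K. \<bar>u x (t + h) - T h (\<lambda>y. u y t + h * R y t) x\<bar> \<le> e * h))"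

lemma euler_consistentD:
  assumes "euler_consistent u R t0" "e > 0"
  shows "\<exists>d>0. \<forall>t h. 0 \<le> t \<longrightarrow> \<bar>t - t0\<bar> < d \<longrightarrow> 0 < h \<longrightarrow> h < d \<longrightarrow>
     (\<forall>x\<in>K. \<bar>u x (t + h) - T h (\<lambda>y. u y t + h * R y t) x\<bar> \<le> e * h)"
  using assms(1)[unfolded euler_consistent_def, THEN spec, THEN mp, OF assms(2)] .

lemma variation_of_constants_shift:
  assumes R: "continuous_on (K \<times> {0..}) (\<lambda>(x, s). R x s)" and v: "continuous_on K v"
    and u: "\<And>x t. x \<in> K \<Longrightarrow> t \<ge> 0 \<Longrightarrow> u x t = T t v x + integral {0..t} (\<lambda>s. T (t - s) (\<lambda>y. R y s) x)"
    and t: "t \<ge> 0" and h: "h \<ge> 0" and x: "x \<in> K"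
  shows "u x (t + h) = T h (\<lambda>y. u y t) x + integral {0..h} (\<lambda>s. T (h - s) (\<lambda>y. R y (t + s)) x)"
proof -
  have cR: "continuous_on K (\<lambda>y. R y s)" if "s \<ge> 0" for s using jointly_continuous_slice[OF R, of s] that by simp
  have curve: "continuous_on (K \<times> {0..r}) (\<lambda>(x, s). T (r - s) (\<lambda>y. R y s) x)" for r
    by (rule continuous_on_T_curve'[OF R]) (auto intro!: continuous_intros)
  define I where "I s = T (t + h - s) (\<lambda>y. R y s) x" for s
  have cI: "continuous_on {0..t + h} I" unfolding I_def by (rule continuous_on_time[OF curve x])
  have "u x (t + h) = T (t + h) v x + integral {0..t + h} I" unfolding I_def using u[OF x] t h by simp
  also have "integral {0..t + h} I = integral {0..t} I + integral {t..t + h} I"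
    using Henstock_Kurzweil_Integration.integral_combine[where a = 0 and c = t and b = "t + h" and f = I] t h
    by (simp add: integrable_continuous_real cI)
  also have "integral {t..t + h} I = integral {0..h} (I \<circ> (+) t)"
    using integral_shift_Icc_real[of 0 h I t] by (simp add: add.commute)
  also have "integral {0..h} (I \<circ> (+) t) = integral {0..h} (\<lambda>s. T (h - s) (\<lambda>y. R y (t + s)) x)"
    by (intro integral_cong) (simp add: I_def)
  also have "integral {0..t} I = integral {0..t} (\<lambda>s. T h (T (t - s) (\<lambda>y. R y s)) x)"
  proof (intro integral_cong)
    fix s assume s: "s \<in> {0..t}"
    show "I s = T h (T (t - s) (\<lambda>y. R y s)) x"
      unfolding I_def using T_add_time[of h "t - s" "\<lambda>y. R y s" x] s h x cR by (simp add: algebra_simps)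
  qed
  also have "\<dots> = T h (\<lambda>y. integral {0..t} (\<lambda>s. T (t - s) (\<lambda>y. R y s) y)) x"
    by (rule T_integral[OF curve t h x, symmetric])
  also have "T (t + h) v x = T h (T t v) x" using T_add_time[OF h t v x] by (simp add: add.commute)
  also have "T h (T t v) x + (T h (\<lambda>y. integral {0..t} (\<lambda>s. T (t - s) (\<lambda>y. R y s) y)) x +
      integral {0..h} (\<lambda>s. T (h - s) (\<lambda>y. R y (t + s)) x)) =
    T h (\<lambda>y. T t v y + integral {0..t} (\<lambda>s. T (t - s) (\<lambda>y. R y s) y)) x + integral {0..h} (\<lambda>s. T (h - s) (\<lambda>y. R y (t + s)) x)"
    by (subst T_add[OF h continuous_on_T[OF t v] continuous_on_integral_curve[OF curve] x]) simp
  also have "T h (\<lambda>y. T t v y + integral {0..t} (\<lambda>s. T (t - s) (\<lambda>y. R y s) y)) x = T h (\<lambda>y. u y t) x"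
  proof (rule T_cong[OF h _ _ _ x])
    show c: "continuous_on K (\<lambda>y. T t v y + integral {0..t} (\<lambda>s. T (t - s) (\<lambda>y. R y s) y))"
      by (intro continuous_intros continuous_on_T t v continuous_on_integral_curve[OF curve])
    show "continuous_on K (\<lambda>y. u y t)"
      by (rule continuous_on_eq[OF c]) (use u t in simp)
  qed (use u t in simp)
  finally show ?thesis .
qed

text \<open>The error of an Euler step is the integral of \<open>T (h - s) (R (t + s) - T s (R t))\<close> over \<open>{0..h}\<close>. Its
integrand is small in norm, because both \<open>R\<close> and the orbit of \<open>R t0\<close> are continuous.\<close>

lemma euler_consistent_mild:
  assumes R: "continuous_on (K \<times> {0..}) (\<lambda>(x, s). R x s)" and v: "continuous_on K v"
    and u: "\<And>x t. x \<in> K \<Longrightarrow> t \<ge> 0 \<Longrightarrow> u x t = T t v x + integral {0..t} (\<lambda>s. T (t - s) (\<lambda>y. R y s) x)"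
    and cu: "continuous_on (K \<times> {0..}) (\<lambda>(x, s). u x s)" and t0: "t0 \<ge> 0"
  shows "euler_consistent u R t0"
  unfolding euler_consistent_def
proof (intro allI impI)
  fix e :: real assume e: "e > 0"
  have cR: "continuous_on K (\<lambda>y. R y s)" if "s \<ge> 0" for s using jointly_continuous_slice[OF R, of s] that by simp
  obtain d1 where d1: "d1 > 0" "\<And>s x. s \<ge> 0 \<Longrightarrow> \<bar>s - t0\<bar> < d1 \<Longrightarrow> x \<in> K \<Longrightarrow> \<bar>R x s - R x t0\<bar> < e / 3"
    using jointly_continuous_uniform[OF R, of t0 "e / 3"] t0 e by auto
  obtain d2 where d2: "d2 > 0" "\<And>s x. 0 \<le> s \<Longrightarrow> s < d2 \<Longrightarrow> x \<in> K \<Longrightarrow> \<bar>T s (\<lambda>y. R y t0) x - R x t0\<bar> < e / 3"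
    using T_near_0[OF cR[OF t0], of "e / 3"] e by auto
  show "\<exists>d>0. \<forall>t h. 0 \<le> t \<longrightarrow> \<bar>t - t0\<bar> < d \<longrightarrow> 0 < h \<longrightarrow> h < d \<longrightarrow>
     (\<forall>x\<in>K. \<bar>u x (t + h) - T h (\<lambda>y. u y t + h * R y t) x\<bar> \<le> e * h)"
  proof (intro exI[of _ "min (d1 / 2) d2"] conjI allI impI ballI)
    show "min (d1 / 2) d2 > 0" using d1 d2 by simp
    fix t h x assume t: "0 \<le> t" and td: "\<bar>t - t0\<bar> < min (d1 / 2) d2" and h: "0 < h" and hd: "h < min (d1 / 2) d2" and x: "x \<in> K"
    have h0: "0 \<le> h" using h by simp
    define I where "I s = T (h - s) (\<lambda>y. R y (t + s)) x" for s
    have cI: "continuous_on (K \<times> {0..h}) (\<lambda>(x, s). T (h - s) (\<lambda>y. R y (t + s)) x)"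
      by (rule continuous_on_T_curve'[OF jointly_continuous_reparametrize[OF R, of "{0..h}" "\<lambda>s. t + s"], of _ "\<lambda>s. h - s" "\<lambda>s. s"])
        (use t in \<open>auto intro!: continuous_intros\<close>)
    from continuous_on_time[OF this x] have cI: "continuous_on {0..h} I" unfolding I_def .
    have cu': "continuous_on K (\<lambda>y. u y t)" using jointly_continuous_slice[OF cu, of t] t by simp
    have "T h (\<lambda>y. 1 * u y t + h * R y t) x = 1 * T h (\<lambda>y. u y t) x + h * T h (\<lambda>y. R y t) x"
      by (rule T_linear[OF h0 cu' cR[OF t] x])
    then have "u x (t + h) - T h (\<lambda>y. u y t + h * R y t) x = integral {0..h} I - h * T h (\<lambda>y. R y t) x"
      using variation_of_constants_shift[OF R v u t h0 x] unfolding I_def by simp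
    also have "\<dots> = integral {0..h} I - integral {0..h} (\<lambda>_. T h (\<lambda>y. R y t) x)" using h by simp
    also have "\<dots> = integral {0..h} (\<lambda>s. I s - T h (\<lambda>y. R y t) x)"
      by (rule integral_diff[symmetric]) (auto intro!: integrable_continuous_real cI)
    also have "norm \<dots> \<le> integral {0..h} (\<lambda>s. e)"
    proof (rule integral_norm_bound_integral)
      show "(\<lambda>s. I s - T h (\<lambda>y. R y t) x) integrable_on {0..h}"
        by (intro integrable_continuous_real continuous_intros cI)
      fix s assume "s \<in> {0..h}"
      then have s: "0 \<le> s" "0 \<le> h - s" "s < d2" "t + s \<ge> 0" "\<bar>t + s - t0\<bar> < d1" "\<bar>t - t0\<bar> < d1"
        using t td hd d1(1) by (simp_all, linarith+)
      have "T h (\<lambda>y. R y t) x = T (h - s) (T s (\<lambda>y. R y t)) x"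
        using T_add_time[OF s(2,1) cR[OF t] x] by simp
      then have "I s - T h (\<lambda>y. R y t) x = T (h - s) (\<lambda>y. R y (t + s) - T s (\<lambda>y. R y t) y) x"
        unfolding I_def using T_diff[OF s(2) cR[OF s(4)] continuous_on_T[OF s(1) cR[OF t]] x] by simp
      moreover have "\<bar>T (h - s) (\<lambda>y. R y (t + s) - T s (\<lambda>y. R y t) y) x\<bar> \<le> e"
      proof (rule T_abs_le[OF _ _ s(2) x])
        show "continuous_on K (\<lambda>y. R y (t + s) - T s (\<lambda>y. R y t) y)"
          by (intro continuous_intros cR continuous_on_T s t)
        fix y assume y: "y \<in> K"
        have "\<bar>T s (\<lambda>y. R y t0 - R y t) y\<bar> \<le> e / 3"
        proof (rule T_abs_le[OF _ _ s(1) y])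
          show "continuous_on K (\<lambda>y. R y t0 - R y t)" by (intro continuous_intros cR t t0)
          show "\<bar>R z t0 - R z t\<bar> \<le> e / 3" if "z \<in> K" for z using d1(2)[OF t s(6) that] by linarith
        qed
        then have "\<bar>T s (\<lambda>y. R y t0) y - T s (\<lambda>y. R y t) y\<bar> \<le> e / 3"
          using T_diff[OF s(1) cR[OF t0] cR[OF t] y] by simp
        then show "\<bar>R y (t + s) - T s (\<lambda>y. R y t) y\<bar> \<le> e"
          using d1(2)[OF s(4,5) y] d2(2)[OF s(1,3) y] by linarith
      qed
      ultimately show "norm (I s - T h (\<lambda>y. R y t) x) \<le> e" by simp
    qed (rule integrable_const_ivl)
    finally show "\<bar>u x (t + h) - T h (\<lambda>y. u y t + h * R y t) x\<bar> \<le> e * h" using h by (simp add: mult.commute)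
  qed
qed

lemma euler_consistent_diff:
  assumes "euler_consistent u R t0" "euler_consistent u' R' t0"
    and cont: "\<And>t. t \<ge> 0 \<Longrightarrow> continuous_on K (\<lambda>y. u y t)" "\<And>t. t \<ge> 0 \<Longrightarrow> continuous_on K (\<lambda>y. R y t)"
      "\<And>t. t \<ge> 0 \<Longrightarrow> continuous_on K (\<lambda>y. u' y t)" "\<And>t. t \<ge> 0 \<Longrightarrow> continuous_on K (\<lambda>y. R' y t)"
  shows "euler_consistent (\<lambda>x t. u x t - u' x t) (\<lambda>x t. R x t - R' x t) t0"
  unfolding euler_consistent_def
proof (intro allI impI)
  fix e :: real assume "e > 0"
  then have e: "e / 2 > 0" by simp
  obtain d1 where "d1 > 0" and "\<forall>t h. 0 \<le> t \<longrightarrow> \<bar>t - t0\<bar> < d1 \<longrightarrow> 0 < h \<longrightarrow> h < d1 \<longrightarrow>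
     (\<forall>x\<in>K. \<bar>u x (t + h) - T h (\<lambda>y. u y t + h * R y t) x\<bar> \<le> e / 2 * h)" using euler_consistentD[OF assms(1) e] by (elim exE conjE)
  note d1 = this(1) this(2)[rule_format]
  obtain d2 where "d2 > 0" and "\<forall>t h. 0 \<le> t \<longrightarrow> \<bar>t - t0\<bar> < d2 \<longrightarrow> 0 < h \<longrightarrow> h < d2 \<longrightarrow>
     (\<forall>x\<in>K. \<bar>u' x (t + h) - T h (\<lambda>y. u' y t + h * R' y t) x\<bar> \<le> e / 2 * h)" using euler_consistentD[OF assms(2) e] by (elim exE conjE)
  note d2 = this(1) this(2)[rule_format]
  show "\<exists>d>0. \<forall>t h. 0 \<le> t \<longrightarrow> \<bar>t - t0\<bar> < d \<longrightarrow> 0 < h \<longrightarrow> h < d \<longrightarrow> (\<forall>x\<in>K.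
     \<bar>u x (t + h) - u' x (t + h) - T h (\<lambda>y. u y t - u' y t + h * (R y t - R' y t)) x\<bar> \<le> e * h)"
  proof (intro exI[of _ "min d1 d2"] conjI allI impI ballI)
    show "min d1 d2 > 0" using d1 d2 by simp
    fix t h x assume t: "0 \<le> t" and td: "\<bar>t - t0\<bar> < min d1 d2" and h: "0 < h" and hd: "h < min d1 d2" and x: "x \<in> K"
    have h0: "0 \<le> h" using h by simp
    have eq: "(\<lambda>y. u y t - u' y t + h * (R y t - R' y t)) = (\<lambda>y. (u y t + h * R y t) - (u' y t + h * R' y t))"
      by (simp add: algebra_simps)
    have "T h (\<lambda>y. u y t - u' y t + h * (R y t - R' y t)) x = T h (\<lambda>y. u y t + h * R y t) x - T h (\<lambda>y. u' y t + h * R' y t) x"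
      unfolding eq by (rule T_diff[OF h0 _ _ x]) (intro continuous_intros cont t)+
    then show "\<bar>u x (t + h) - u' x (t + h) - T h (\<lambda>y. u y t - u' y t + h * (R y t - R' y t)) x\<bar> \<le> e * h"
      using d1(2)[OF t _ h _ x] d2(2)[OF t _ h _ x] td hd by (simp; argo)
  qed
qed

text \<open>The identity and the absolute value are the two instances of \<open>N\<close>: \<open>T\<close> preserves upper bounds of \<open>v\<close> as well
as of \<open>\<bar>v\<bar>\<close>. As long as the bound holds, an Euler step raises it by at most \<open>h q + o(h)\<close>, whereas the
barrier rises by \<open>h \<beta>' t + o(h)\<close>, which is more.\<close>

lemma comparison_functional:
  fixes N :: "real \<Rightarrow> real"
  assumes N_lip: "\<And>r s. N r \<le> N s + \<bar>r - s\<bar>"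
    and N_T: "\<And>v c t x. continuous_on K v \<Longrightarrow> (\<And>x. x \<in> K \<Longrightarrow> N (v x) \<le> c) \<Longrightarrow> t \<ge> 0 \<Longrightarrow> x \<in> K \<Longrightarrow> N (T t v x) \<le> c"
    and cu: "continuous_on (K \<times> {a..}) (\<lambda>(x, t). u x t)" and cR: "\<And>t. t \<ge> a \<Longrightarrow> continuous_on K (\<lambda>y. R y t)"
    and a: "a \<ge> 0" and cons: "\<And>t. t \<ge> a \<Longrightarrow> euler_consistent u R t"
    and der: "\<And>t. t \<ge> a \<Longrightarrow> (\<beta> has_real_derivative \<beta>' t) (at t)"
    and init: "\<And>x. x \<in> K \<Longrightarrow> N (u x a) \<le> \<beta> a"
    and slope: "\<And>t. a \<le> t \<Longrightarrow> (\<And>s x. a \<le> s \<Longrightarrow> s \<le> t \<Longrightarrow> x \<in> K \<Longrightarrow> N (u x s) \<le> \<beta> s) \<Longrightarrow>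
      \<exists>q<\<beta>' t. \<exists>d>0. \<forall>h. 0 < h \<and> h < d \<longrightarrow> (\<forall>y\<in>K. N (u y t + h * R y t) \<le> \<beta> t + h * q)"
    and t: "a \<le> t" and x: "x \<in> K"
  shows "N (u x t) \<le> \<beta> t"
proof (rule bound_by_continuation[of K a t "\<lambda>x s. N (u x s)" \<beta>])
  have "1-lipschitz_on UNIV N"
  proof (rule lipschitz_onI)
    show "dist (N r) (N s) \<le> 1 * dist r s" for r s
      using N_lip[of r s] N_lip[of s r] abs_minus_commute[of r s] unfolding dist_real_def by (simp add: abs_le_iff)
  qed simp
  then have cN: "continuous_on UNIV N" by (rule lipschitz_on_continuous_on)
  show "continuous_on {a..t} (\<lambda>s. N (u x s))" if "x \<in> K" for x
    by (rule continuous_on_compose2[OF cN continuous_on_time[OF continuous_on_subset[OF cu] that]]) auto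
  show "continuous_on {a..t} \<beta>"
    by (rule DERIV_atLeastAtMost_imp_continuous_on) (use der in auto)
  fix s assume s: "a \<le> s" "s < t" and hist: "\<And>r x. a \<le> r \<Longrightarrow> r \<le> s \<Longrightarrow> x \<in> K \<Longrightarrow> N (u x r) \<le> \<beta> r"
  obtain q d0 where q: "q < \<beta>' s" and d0: "d0 > 0" "\<And>h y. 0 < h \<Longrightarrow> h < d0 \<Longrightarrow> y \<in> K \<Longrightarrow> N (u y s + h * R y s) \<le> \<beta> s + h * q"
    using slope[OF s(1) hist] by blast
  define e where "e = (\<beta>' s - q) / 2"
  have e: "e > 0" using q by (simp add: e_def)
  obtain d1 where "d1 > 0" and "\<forall>t h. 0 \<le> t \<longrightarrow> \<bar>t - s\<bar> < d1 \<longrightarrow> 0 < h \<longrightarrow> h < d1 \<longrightarrow>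
     (\<forall>x\<in>K. \<bar>u x (t + h) - T h (\<lambda>y. u y t + h * R y t) x\<bar> \<le> e * h)" using euler_consistentD[OF cons[OF s(1)] e] by (elim exE conjE)
  note d1 = this(1) this(2)[rule_format]
  have "(\<lambda>h. (\<beta> (s + h) - \<beta> s) / h) \<midarrow>0\<rightarrow> \<beta>' s" using der[OF s(1)] by (simp add: DERIV_def)
  then have "\<forall>\<^sub>F h in at 0. \<bar>(\<beta> (s + h) - \<beta> s) / h - \<beta>' s\<bar> < e" using e by (auto simp: tendsto_iff dist_real_def)
  then obtain d2 where d2: "d2 > 0" "\<And>h. h \<noteq> 0 \<Longrightarrow> \<bar>h\<bar> < d2 \<Longrightarrow> \<bar>(\<beta> (s + h) - \<beta> s) / h - \<beta>' s\<bar> < e"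
    unfolding eventually_at by (auto simp: dist_real_def)
  show "\<exists>d>0. \<forall>h. 0 < h \<and> h < d \<longrightarrow> (\<forall>x\<in>K. N (u x (s + h)) \<le> \<beta> (s + h))"
  proof (intro exI[of _ "min d0 (min d1 d2)"] conjI allI impI ballI)
    show "min d0 (min d1 d2) > 0" using d0 d1 d2 by simp
    fix h y assume "0 < h \<and> h < min d0 (min d1 d2)" and y: "y \<in> K"
    then have h: "0 < h" "0 \<le> h" "h < d0" "h < d1" "\<bar>h\<bar> < d2" "h \<noteq> 0" by auto
    have "N (T h (\<lambda>y. u y s + h * R y s) y) \<le> \<beta> s + h * q"
    proof (rule N_T[OF _ _ h(2) y])
      show "continuous_on K (\<lambda>y. u y s + h * R y s)"
        using jointly_continuous_slice[OF cu, of s] s by (intro continuous_intros cR) auto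
    qed (use d0(2)[OF h(1,3)] in blast)
    moreover have "\<bar>u y (s + h) - T h (\<lambda>y. u y s + h * R y s) y\<bar> \<le> e * h"
      by (rule d1(2)) (use h y s a d1(1) in auto)
    moreover have "\<beta> (s + h) \<ge> \<beta> s + h * (\<beta>' s - e)"
    proof -
      have "(\<beta> (s + h) - \<beta> s) / h > \<beta>' s - e" using d2(2)[OF h(6,5)] by simp
      then show ?thesis using h by (simp add: field_simps)
    qed
    moreover have "h * (\<beta>' s - e) = h * q + e * h" by (simp add: e_def field_simps)
    ultimately show "N (u y (s + h)) \<le> \<beta> (s + h)"
      using N_lip[of "u y (s + h)" "T h (\<lambda>y. u y s + h * R y s) y"] by linarith
  qed
qed (use init t x in auto)

lemma comparison:
  assumes "continuous_on (K \<times> {a..}) (\<lambda>(x, t). u x t)" "\<And>t. t \<ge> a \<Longrightarrow> continuous_on K (\<lambda>y. R y t)"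
    "a \<ge> 0" "\<And>t. t \<ge> a \<Longrightarrow> euler_consistent u R t"
    "\<And>t. t \<ge> a \<Longrightarrow> (\<beta> has_real_derivative \<beta>' t) (at t)"
    "\<And>x. x \<in> K \<Longrightarrow> u x a \<le> \<beta> a"
    "\<And>t. a \<le> t \<Longrightarrow> (\<And>s x. a \<le> s \<Longrightarrow> s \<le> t \<Longrightarrow> x \<in> K \<Longrightarrow> u x s \<le> \<beta> s) \<Longrightarrow>
      \<exists>q<\<beta>' t. \<exists>d>0. \<forall>h. 0 < h \<and> h < d \<longrightarrow> (\<forall>y\<in>K. u y t + h * R y t \<le> \<beta> t + h * q)"
    "a \<le> t" "x \<in> K"
  shows "u x t \<le> \<beta> t"
  by (rule comparison_functional[where N = "\<lambda>r. r", OF _ T_le assms(1-6) assms(7) assms(8,9)]) linarith+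

lemma comparison_abs:
  assumes "continuous_on (K \<times> {a..}) (\<lambda>(x, t). u x t)" "\<And>t. t \<ge> a \<Longrightarrow> continuous_on K (\<lambda>y. R y t)"
    "a \<ge> 0" "\<And>t. t \<ge> a \<Longrightarrow> euler_consistent u R t"
    "\<And>t. t \<ge> a \<Longrightarrow> (\<beta> has_real_derivative \<beta>' t) (at t)"
    "\<And>x. x \<in> K \<Longrightarrow> \<bar>u x a\<bar> \<le> \<beta> a"
    "\<And>t. a \<le> t \<Longrightarrow> (\<And>s x. a \<le> s \<Longrightarrow> s \<le> t \<Longrightarrow> x \<in> K \<Longrightarrow> \<bar>u x s\<bar> \<le> \<beta> s) \<Longrightarrow>
      \<exists>q<\<beta>' t. \<exists>d>0. \<forall>h. 0 < h \<and> h < d \<longrightarrow> (\<forall>y\<in>K. \<bar>u y t + h * R y t\<bar> \<le> \<beta> t + h * q)"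
    "a \<le> t" "x \<in> K"
  shows "\<bar>u x t\<bar> \<le> \<beta> t"
  by (rule comparison_functional[where N = abs, OF _ T_abs_le assms(1-6) assms(7) assms(8,9)]) linarith+

lemma euler_consistent_minus:
  assumes "euler_consistent u R t0"
    and cont: "\<And>t. t \<ge> 0 \<Longrightarrow> continuous_on K (\<lambda>y. u y t)" "\<And>t. t \<ge> 0 \<Longrightarrow> continuous_on K (\<lambda>y. R y t)"
  shows "euler_consistent (\<lambda>x t. - u x t) (\<lambda>x t. - R x t) t0"
proof -
  have "euler_consistent (\<lambda>x t. 0) (\<lambda>x t. 0) t0"
    unfolding euler_consistent_def by (auto simp: T_const intro!: exI[of _ 1])
  from euler_consistent_diff[OF this assms(1) _ _ cont] show ?thesis by simp
qed

lemma euler_consistent_minus_const: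
  assumes "euler_consistent u R t0"
    and cont: "\<And>t. t \<ge> 0 \<Longrightarrow> continuous_on K (\<lambda>y. u y t)" "\<And>t. t \<ge> 0 \<Longrightarrow> continuous_on K (\<lambda>y. R y t)"
  shows "euler_consistent (\<lambda>x t. u x t - c) R t0"
proof -
  have "euler_consistent (\<lambda>x t. c) (\<lambda>x t. 0) t0"
    unfolding euler_consistent_def by (auto simp: T_const intro!: exI[of _ 1])
  from euler_consistent_diff[OF assms(1) this cont] show ?thesis by simp
qed

lemma euler_consistent_shift:
  assumes "euler_consistent u R (c + t0)" "c \<ge> 0"
  shows "euler_consistent (\<lambda>x t. u x (c + t)) (\<lambda>x t. R x (c + t)) t0"
  unfolding euler_consistent_def
proof (intro allI impI)
  fix e :: real assume "e > 0"
  obtain d where "d > 0" and "\<forall>t h. 0 \<le> t \<longrightarrow> \<bar>t - (c + t0)\<bar> < d \<longrightarrow> 0 < h \<longrightarrow> h < d \<longrightarrow>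
     (\<forall>x\<in>K. \<bar>u x (t + h) - T h (\<lambda>y. u y t + h * R y t) x\<bar> \<le> e * h)"
    using euler_consistentD[OF assms(1) \<open>e > 0\<close>] by (elim exE conjE)
  note d = this(1) this(2)[rule_format]
  show "\<exists>d>0. \<forall>t h. 0 \<le> t \<longrightarrow> \<bar>t - t0\<bar> < d \<longrightarrow> 0 < h \<longrightarrow> h < d \<longrightarrow>
     (\<forall>x\<in>K. \<bar>u x (c + (t + h)) - T h (\<lambda>y. u y (c + t) + h * R y (c + t)) x\<bar> \<le> e * h)"
  proof (intro exI[of _ d] conjI allI impI ballI d(1))
    fix t h x assume h: "0 \<le> t" "\<bar>t - t0\<bar> < d" "0 < h" "h < d" "x \<in> K"
    have "0 \<le> c + t" "\<bar>(c + t) - (c + t0)\<bar> < d" using h assms(2) by auto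
    from d(2)[OF this h(3-5)] show "\<bar>u x (c + (t + h)) - T h (\<lambda>y. u y (c + t) + h * R y (c + t)) x\<bar> \<le> e * h"
      by (simp add: add.assoc)
  qed
qed

text \<open>The damped orbit solves \<open>p' = A p - l p\<close>.\<close>

lemma euler_consistent_damped_orbit:
  assumes v: "continuous_on K v" and l: "l \<ge> 0" and "t0 \<ge> 0"
  shows "euler_consistent (\<lambda>x t. exp (- l * t) * T t v x) (\<lambda>x t. - l * (exp (- l * t) * T t v x)) t0"
  unfolding euler_consistent_def
proof (intro allI impI)
  fix e :: real assume "e > 0"
  obtain c where c: "c > 0" "\<And>x. x \<in> K \<Longrightarrow> \<bar>v x\<bar> \<le> c" using bounded_on_K[OF v] by metis
  have "((\<lambda>h. exp (- l * h)) has_real_derivative - l) (at 0)" by (auto intro!: derivative_eq_intros)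
  then have "(\<lambda>h. (exp (- l * (0 + h)) - exp (- l * 0)) / h) \<midarrow>0\<rightarrow> - l" by (simp add: DERIV_def)
  then have "\<forall>\<^sub>F h in at 0. dist ((exp (- l * (0 + h)) - exp (- l * 0)) / h) (- l) < e / c"
    by (rule tendstoD) (use \<open>e > 0\<close> c in simp)
  then obtain d where d: "d > 0" "\<And>h. h \<noteq> 0 \<Longrightarrow> \<bar>h\<bar> < d \<Longrightarrow> \<bar>(exp (- l * h) - 1) / h + l\<bar> < e / c"
    unfolding eventually_at by (auto simp: dist_real_def)
  show "\<exists>d>0. \<forall>t h. 0 \<le> t \<longrightarrow> \<bar>t - t0\<bar> < d \<longrightarrow> 0 < h \<longrightarrow> h < d \<longrightarrow>
     (\<forall>x\<in>K. \<bar>exp (- l * (t + h)) * T (t + h) v x - T h (\<lambda>y. exp (- l * t) * T t v y + h * (- l * (exp (- l * t) * T t v y))) x\<bar> \<le> e * h)"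
  proof (intro exI[of _ d] conjI allI impI ballI d(1))
    fix t h x assume h: "0 \<le> t" "\<bar>t - t0\<bar> < d" "0 < h" "h < d" "x \<in> K"
    have eq: "(\<lambda>y. exp (- l * t) * T t v y + h * (- l * (exp (- l * t) * T t v y))) = (\<lambda>y. (exp (- l * t) * (1 - h * l)) * T t v y)"
      by (simp add: algebra_simps)
    have "T h (\<lambda>y. (exp (- l * t) * (1 - h * l)) * T t v y) x = exp (- l * t) * (1 - h * l) * T h (T t v) x"
      by (rule T_scale) (use h v in \<open>auto intro: continuous_on_T\<close>)
    also have "T h (T t v) x = T (t + h) v x" using T_add_time[of h t v x] h v by (simp add: add.commute)
    finally have orbit: "T h (\<lambda>y. (exp (- l * t) * (1 - h * l)) * T t v y) x = exp (- l * t) * (1 - h * l) * T (t + h) v x" .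
    have split: "exp (- l * (t + h)) = exp (- l * h) * exp (- l * t)" by (simp add: exp_add[symmetric] algebra_simps)
    have "exp (- l * (t + h)) * T (t + h) v x - T h (\<lambda>y. exp (- l * t) * T t v y + h * (- l * (exp (- l * t) * T t v y))) x
        = h * ((exp (- l * h) - 1) / h + l) * exp (- l * t) * T (t + h) v x"
      unfolding eq orbit split using h(3) by (simp add: field_simps)
    also have "\<bar>\<dots>\<bar> = h * \<bar>(exp (- l * h) - 1) / h + l\<bar> * exp (- l * t) * \<bar>T (t + h) v x\<bar>"
      using h(3) by (simp add: abs_mult)
    also have "\<dots> \<le> h * (e / c) * 1 * c"
    proof (intro mult_mono)
      show "\<bar>(exp (- l * h) - 1) / h + l\<bar> \<le> e / c" using d(2)[of h] h by (simp add: less_imp_le)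
      show "\<bar>T (t + h) v x\<bar> \<le> c" by (rule T_abs_le[OF v c(2)]) (use h in auto)
      show "exp (- l * t) \<le> 1" using l h by simp
    qed (use h c \<open>e > 0\<close> in auto)
    also have "\<dots> = e * h" using c(1) by simp
    finally show "\<bar>exp (- l * (t + h)) * T (t + h) v x - T h (\<lambda>y. exp (- l * t) * T t v y + h * (- l * (exp (- l * t) * T t v y))) x\<bar> \<le> e * h" .
  qed
qed

end

section \<open>Maximum principles for the Neumann Laplacian\<close>

lemma second_derivative_nonpos_at_right_max:
  fixes \<phi> \<phi>' :: "real \<Rightarrow> real"
  assumes "d > 0" and der: "\<And>t. 0 \<le> t \<Longrightarrow> t < d \<Longrightarrow> (\<phi> has_real_derivative \<phi>' t) (at t)"
    and "\<phi>' 0 = 0" and der2: "(\<phi>' has_real_derivative c) (at 0)"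
    and max: "\<And>t. 0 < t \<Longrightarrow> t < d \<Longrightarrow> \<phi> t \<le> \<phi> 0"
  shows "c \<le> 0"
proof (rule ccontr)
  assume "\<not> c \<le> 0"
  then obtain e where e: "e > 0" "\<And>h. 0 < h \<Longrightarrow> h < e \<Longrightarrow> \<phi>' 0 < \<phi>' (0 + h)"
    using DERIV_pos_inc_right[OF der2] by auto
  define t where "t = min d e / 2"
  have t: "0 < t" "t < d" "t < e" using e(1) \<open>d > 0\<close> by (auto simp: t_def)
  obtain s where s: "0 < s" "s < t" "\<phi> t - \<phi> 0 = (t - 0) * \<phi>' s"
    using MVT2[of 0 t \<phi> \<phi>'] der t by (metis dual_order.strict_trans2)
  have "\<phi>' s > 0" using e(2)[of s] s t \<open>\<phi>' 0 = 0\<close> by simp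
  then have "(t - 0) * \<phi>' s > 0" using t by simp
  then show False using s(3) max[OF t(1,2)] by linarith
qed

text \<open>First and second derivatives are carried as explicit data: \<open>E y b v\<close> is the derivative in
  direction \<open>v\<close> of the partial derivative in direction \<open>b\<close>.\<close>

definition second_derivatives_on ::
    "'a::euclidean_space set \<Rightarrow> ('a \<Rightarrow> real) \<Rightarrow> ('a \<Rightarrow> 'a \<Rightarrow> real) \<Rightarrow> ('a \<Rightarrow> 'a \<Rightarrow> 'a \<Rightarrow> real) \<Rightarrow> bool" where
  "second_derivatives_on U V D E \<longleftrightarrow>
     (\<forall>y\<in>U. (V has_derivative D y) (at y) \<and> (\<forall>b\<in>Basis. ((\<lambda>y. D y b) has_derivative E y b) (at y)))"

lemma second_derivatives_on_subset:
  "second_derivatives_on U V D E \<Longrightarrow> U' \<subseteq> U \<Longrightarrow> second_derivatives_on U' V D E"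
  unfolding second_derivatives_on_def by blast

lemma second_derivatives_on_Ck_2:
  assumes "Ck_on 2 U V"
  shows "second_derivatives_on U V (\<lambda>y. frechet_derivative V (at y))
      (\<lambda>y b. frechet_derivative (\<lambda>y. frechet_derivative V (at y) b) (at y))"
    and "b \<in> Basis \<Longrightarrow> continuous_on U (\<lambda>y. frechet_derivative (\<lambda>y. frechet_derivative V (at y) b) (at y) b)"
  using assms unfolding second_derivatives_on_def numeral_2_eq_2
  by (auto simp: frechet_derivative_works[symmetric])

lemma linear_basis_sum:
  fixes D :: "'a::euclidean_space \<Rightarrow> real"
  assumes "linear D"
  shows "D v = (\<Sum>b\<in>Basis. (v \<bullet> b) * D b)"
proof -
  have "D v = D (\<Sum>b\<in>Basis. (v \<bullet> b) *\<^sub>R b)" by (simp add: euclidean_representation)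
  also have "\<dots> = (\<Sum>b\<in>Basis. (v \<bullet> b) * D b)"
    using assms by (simp add: linear_sum linear_cmul)
  finally show ?thesis .
qed

lemma ray_derivative:
  fixes V :: "'a::euclidean_space \<Rightarrow> real"
  assumes "(V has_derivative L) (at (x + t *\<^sub>R v))"
  shows "((\<lambda>t. V (x + t *\<^sub>R v)) has_real_derivative L v) (at t)"
proof -
  have "((\<lambda>t. x + t *\<^sub>R v) has_derivative (\<lambda>h. h *\<^sub>R v)) (at t)"
    by (auto intro!: derivative_eq_intros)
  from has_derivative_compose[OF this assms] have "((\<lambda>t. V (x + t *\<^sub>R v)) has_derivative (\<lambda>h. L (h *\<^sub>R v))) (at t)" .
  moreover have "linear L" using assms has_derivative_linear by blast
  ultimately show ?thesis
    unfolding has_field_derivative_def by (simp add: linear_cmul mult.commute[of _ "L v"])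
qed

lemma ray_stays_in_open:
  fixes x :: "'a::euclidean_space"
  assumes "open U" "x \<in> U"
  obtains d where "d > 0" "\<And>t. \<bar>t\<bar> < d \<Longrightarrow> x + t *\<^sub>R v \<in> U"
proof -
  obtain e where e: "e > 0" "ball x e \<subseteq> U" using assms open_contains_ball by blast
  show thesis
  proof (rule that[of "e / (norm v + 1)"])
    show "e / (norm v + 1) > 0" using e by (simp add: add_nonneg_pos)
    fix t assume t: "\<bar>t\<bar> < e / (norm v + 1)"
    have "\<bar>t\<bar> * norm v \<le> \<bar>t\<bar> * (norm v + 1)" by (intro mult_left_mono) auto
    also have "\<dots> < e" using t by (simp add: pos_less_divide_eq add_nonneg_pos)
    finally show "x + t *\<^sub>R v \<in> U" using e(2) by (auto simp: dist_norm)
  qed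
qed

lemma second_derivative_nonpos_along_ray:
  assumes U: "open U" "x \<in> U" and VDE: "second_derivatives_on U V D E" and "D x v = 0"
    and "d0 > 0" and max: "\<And>t. 0 < t \<Longrightarrow> t < d0 \<Longrightarrow> V (x + t *\<^sub>R v) \<le> V x"
  shows "(\<Sum>b\<in>Basis. (v \<bullet> b) * E x b v) \<le> 0"
proof -
  obtain d where d: "d > 0" "\<And>t. \<bar>t\<bar> < d \<Longrightarrow> x + t *\<^sub>R v \<in> U" using ray_stays_in_open[OF U] by metis
  have V: "(V has_derivative D y) (at y)" and E: "b \<in> Basis \<Longrightarrow> ((\<lambda>y. D y b) has_derivative E y b) (at y)" if "y \<in> U" for y b
    using VDE that unfolding second_derivatives_on_def by blast+
  have "((\<lambda>y. \<Sum>b\<in>Basis. (v \<bullet> b) * D y b) has_derivative (\<lambda>w. \<Sum>b\<in>Basis. (v \<bullet> b) * E x b w)) (at x)"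
    by (intro has_derivative_sum has_derivative_mult_right E U)
  moreover have "(\<Sum>b\<in>Basis. (v \<bullet> b) * D y b) = D y v" if "y \<in> U" for y
    by (rule linear_basis_sum[OF has_derivative_linear[OF V[OF that]], symmetric])
  ultimately have "((\<lambda>y. D y v) has_derivative (\<lambda>w. \<Sum>b\<in>Basis. (v \<bullet> b) * E x b w)) (at x)"
    by (rule has_derivative_transform_within_open[OF _ U])
  then have d2: "((\<lambda>t. D (x + t *\<^sub>R v) v) has_real_derivative (\<Sum>b\<in>Basis. (v \<bullet> b) * E x b v)) (at 0)"
    using ray_derivative[of "\<lambda>y. D y v" _ x 0 v] by simp
  show ?thesis
  proof (rule second_derivative_nonpos_at_right_max[of "min d d0" "\<lambda>t. V (x + t *\<^sub>R v)", OF _ _ _ d2])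
    fix t assume "0 \<le> t" "t < min d d0"
    then show "((\<lambda>t. V (x + t *\<^sub>R v)) has_real_derivative D (x + t *\<^sub>R v) v) (at t)"
      by (intro ray_derivative V d) auto
  qed (use d \<open>d0 > 0\<close> max \<open>D x v = 0\<close> in auto)
qed

lemma laplacian_nonpos_at_interior_max:
  assumes U: "open U" "x \<in> U" and VDE: "second_derivatives_on U V D E" and max: "\<And>y. y \<in> U \<Longrightarrow> V y \<le> V x"
  shows "(\<Sum>b\<in>Basis. E x b b) \<le> 0"
proof (rule sum_nonpos)
  fix b :: 'a assume b: "b \<in> Basis"
  have "(V has_derivative D x) (at x)" using VDE U unfolding second_derivatives_on_def by blast
  then have "D x = (\<lambda>v. 0)"
    by (rule differential_zero_maxmin[OF U(2,1)]) (use max in blast)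
  moreover obtain d where "d > 0" "\<And>t. \<bar>t\<bar> < d \<Longrightarrow> x + t *\<^sub>R b \<in> U" using ray_stays_in_open[OF U] by metis
  ultimately have "(\<Sum>c\<in>Basis. (b \<bullet> c) * E x c b) \<le> 0"
    using max by (intro second_derivative_nonpos_along_ray[OF U VDE]) auto
  moreover have "(\<Sum>c\<in>Basis. (b \<bullet> c) * E x c b) = (\<Sum>c\<in>Basis. if c = b then E x c b else 0)"
    by (intro sum.cong) (auto simp: inner_Basis b)
  ultimately show "E x b b \<le> 0" using b by simp
qed

lemma gradient_inner:
  assumes "\<rho> differentiable (at x)"
  shows "frechet_derivative \<rho> (at x) v = gradient \<rho> x \<bullet> v"
  unfolding linear_basis_sum[OF linear_frechet_derivative[OF assms], of v] gradient_def inner_sum_left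
  by (intro sum.cong refl) (simp add: inner_commute)

lemma inward_ray:
  assumes ldf: "local_defining_function \<Omega> U \<rho>" and x: "x \<in> frontier \<Omega>" "x \<in> U" and v: "gradient \<rho> x \<bullet> v < 0"
  obtains d where "d > 0" "\<And>t. 0 < t \<Longrightarrow> t < d \<Longrightarrow> x + t *\<^sub>R v \<in> \<Omega>"
proof -
  have U: "open U" and sm: "smooth_on U \<rho>" and sets: "\<Omega> \<inter> U = {x \<in> U. \<rho> x < 0}" "frontier \<Omega> \<inter> U = {x \<in> U. \<rho> x = 0}"
    using ldf unfolding local_defining_function_def by auto
  have "Ck_on 1 U \<rho>" using sm unfolding smooth_on_def by blast
  then have diff: "\<rho> differentiable (at x)" using x by simp
  have "((\<lambda>t. \<rho> (x + t *\<^sub>R v)) has_real_derivative gradient \<rho> x \<bullet> v) (at 0)"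
    using ray_derivative[of \<rho> "frechet_derivative \<rho> (at x)" x 0 v] diff gradient_inner[OF diff, of v]
    by (simp add: frechet_derivative_works)
  from DERIV_neg_dec_right[OF this v] obtain d1 where d1: "d1 > 0"
    "\<And>t. 0 < t \<Longrightarrow> t < d1 \<Longrightarrow> \<rho> (x + (0 + t) *\<^sub>R v) < \<rho> (x + 0 *\<^sub>R v)" by metis
  obtain d2 where d2: "d2 > 0" "\<And>t. \<bar>t\<bar> < d2 \<Longrightarrow> x + t *\<^sub>R v \<in> U" using ray_stays_in_open[OF U x(2)] by metis
  have "\<rho> x = 0" using sets(2) x by blast
  show thesis
  proof (rule that[of "min d1 d2"])
    fix t assume "0 < t" "t < min d1 d2"
    then show "x + t *\<^sub>R v \<in> \<Omega>" using d1(2)[of t] d2(2)[of t] \<open>\<rho> x = 0\<close> sets(1) by auto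
  qed (use d1 d2 in simp)
qed

text \<open>At a maximum on the boundary all inward derivatives are nonpositive, and since every vector
  becomes inward after subtracting a multiple of the normal, along which the derivative vanishes, the
  whole gradient vanishes. Hence the second derivative is nonpositive along inward rays, thus, by continuity
  and symmetry under \<open>v \<mapsto> - v\<close>, in all directions.\<close>

lemma laplacian_nonpos_at_boundary_max:
  fixes \<Omega> :: "'a::euclidean_space set"
  assumes ldf: "local_defining_function \<Omega> U \<rho>" and x: "x \<in> frontier \<Omega>" "x \<in> U"
    and VDE: "second_derivatives_on UNIV V D E" and max: "\<And>y. y \<in> \<Omega> \<Longrightarrow> V y \<le> V x"
    and neumann: "D x (gradient \<rho> x) = 0"
  shows "(\<Sum>b\<in>Basis. E x b b) \<le> 0"
proof -
  define g where "g = gradient \<rho> x"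
  have "g \<noteq> 0" using ldf x unfolding local_defining_function_def g_def by blast
  then have gg: "g \<bullet> g > 0" by simp
  have V: "(V has_derivative D x) (at x)" and E: "b \<in> Basis \<Longrightarrow> ((\<lambda>y. D y b) has_derivative E x b) (at x)" for b
    using VDE unfolding second_derivatives_on_def by blast+
  have linD: "linear (D x)" by (rule has_derivative_linear[OF V])
  have linE: "linear (E x b)" if "b \<in> Basis" for b by (rule has_derivative_linear[OF E[OF that]])
  have inward: "D x v \<le> 0" if v: "g \<bullet> v < 0" for v
  proof (rule ccontr)
    assume "\<not> D x v \<le> 0"
    moreover have "((\<lambda>t. V (x + t *\<^sub>R v)) has_real_derivative D x v) (at 0)" by (rule ray_derivative) (use V in simp)
    ultimately obtain d1 where d1: "d1 > 0" "\<And>t. 0 < t \<Longrightarrow> t < d1 \<Longrightarrow> V (x + 0 *\<^sub>R v) < V (x + (0 + t) *\<^sub>R v)"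
      using DERIV_pos_inc_right by (metis linorder_not_le)
    obtain d2 where d2: "d2 > 0" "\<And>t. 0 < t \<Longrightarrow> t < d2 \<Longrightarrow> x + t *\<^sub>R v \<in> \<Omega>"
      using inward_ray[OF ldf x] v unfolding g_def by metis
    define t where "t = min d1 d2 / 2"
    have "0 < t" "t < d1" "t < d2" using d1(1) d2(1) by (auto simp: t_def)
    then show False using d1(2)[of t] d2(2)[of t] max by force
  qed
  have nonpos: "D x v \<le> 0" for v
  proof -
    define s where "s = (\<bar>g \<bullet> v\<bar> + 1) / (g \<bullet> g)"
    have "g \<bullet> (v - s *\<^sub>R g) = g \<bullet> v - (\<bar>g \<bullet> v\<bar> + 1)" using gg by (simp add: inner_diff_right s_def)
    then have "D x (v - s *\<^sub>R g) \<le> 0" by (intro inward) linarith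
    then show ?thesis using neumann linD by (simp add: linear_diff linear_cmul g_def)
  qed
  have Dx0: "D x v = 0" for v
    using nonpos[of v] nonpos[of "- v"] linD by (simp add: linear_neg)
  define Q where "Q v = (\<Sum>b\<in>Basis. (v \<bullet> b) * E x b v)" for v
  have Q_inward: "Q v \<le> 0" if v: "g \<bullet> v < 0" for v
  proof -
    obtain d2 where d2: "d2 > 0" "\<And>t. 0 < t \<Longrightarrow> t < d2 \<Longrightarrow> x + t *\<^sub>R v \<in> \<Omega>"
      using inward_ray[OF ldf x] v unfolding g_def by metis
    show ?thesis unfolding Q_def
      by (rule second_derivative_nonpos_along_ray[OF open_UNIV UNIV_I VDE Dx0 d2(1)]) (use d2 max in blast)
  qed
  have Q_tangential: "Q v \<le> 0" if v: "g \<bullet> v \<le> 0" for v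
  proof (rule tendsto_upperbound)
    have "((\<lambda>s. \<Sum>b\<in>Basis. (v \<bullet> b - s * (g \<bullet> b)) * (E x b v - s * E x b g)) \<longlongrightarrow>
       (\<Sum>b\<in>Basis. (v \<bullet> b - 0 * (g \<bullet> b)) * (E x b v - 0 * E x b g))) (at_right 0)"
      by (intro tendsto_intros)
    moreover have "(\<Sum>b\<in>Basis. (v \<bullet> b - s * (g \<bullet> b)) * (E x b v - s * E x b g)) = Q (v - s *\<^sub>R g)" for s
      unfolding Q_def by (intro sum.cong refl) (simp add: inner_diff_left linear_diff[OF linE] linear_cmul[OF linE])
    ultimately show "((\<lambda>s. Q (v - s *\<^sub>R g)) \<longlongrightarrow> Q v) (at_right 0)" by (simp add: Q_def)
    have "Q (v - s *\<^sub>R g) \<le> 0" if "s > 0" for s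
      by (rule Q_inward) (use v gg that in \<open>simp add: inner_diff_right add_nonpos_neg diff_less_eq order_le_less_trans\<close>)
    then show "\<forall>\<^sub>F s in at_right 0. Q (v - s *\<^sub>R g) \<le> 0"
      using eventually_at_right_less[of "0::real"] by (auto elim: eventually_mono)
  qed simp
  have Q_neg: "Q (- v) = Q v" for v
    unfolding Q_def by (intro sum.cong refl) (simp add: linear_neg[OF linE])
  have "Q v \<le> 0" for v
    using Q_tangential[of v] Q_tangential[of "- v"] Q_neg by (cases "g \<bullet> v \<le> 0") auto
  moreover have "Q b = E x b b" if b: "b \<in> Basis" for b
  proof -
    have "Q b = (\<Sum>c\<in>Basis. if c = b then E x c b else 0)"
      unfolding Q_def by (intro sum.cong) (auto simp: inner_Basis b)
    then show ?thesis using b by simp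
  qed
  ultimately show ?thesis by (intro sum_nonpos) metis
qed

lemma classical_neumann_laplacian_data:
  fixes \<Omega> :: "'a::euclidean_space set"
  assumes "classical_neumann_laplacian \<Omega> v w"
  shows "\<exists>V D E. second_derivatives_on UNIV V D E \<and> (\<forall>x\<in>closure \<Omega>. V x = v x) \<and>
    (\<forall>x\<in>closure \<Omega>. w x = (\<Sum>b\<in>Basis. E x b b)) \<and>
    (\<forall>x U \<rho>. x \<in> frontier \<Omega> \<longrightarrow> x \<in> U \<longrightarrow> local_defining_function \<Omega> U \<rho> \<longrightarrow> D x (gradient \<rho> x) = 0)"
proof -
  obtain V where V: "Ck_on 2 UNIV V" "\<And>x. x \<in> closure \<Omega> \<Longrightarrow> V x = v x \<and> laplacian V x = w x"
    "\<And>p n. p \<in> frontier \<Omega> \<Longrightarrow> outward_unit_normal \<Omega> p n \<Longrightarrow> frechet_derivative V (at p) n = 0"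
    using assms unfolding classical_neumann_laplacian_def by blast
  note VDE = second_derivatives_on_Ck_2(1)[OF V(1)]
  show ?thesis
  proof (rule exI[of _ V], rule exI[of _ "\<lambda>y. frechet_derivative V (at y)"],
      rule exI[of _ "\<lambda>y b. frechet_derivative (\<lambda>y. frechet_derivative V (at y) b) (at y)"],
      intro conjI VDE ballI allI impI)
    fix x U \<rho> assume x: "x \<in> frontier \<Omega>" "x \<in> U" and ldf: "local_defining_function \<Omega> U \<rho>"
    have "gradient \<rho> x \<noteq> 0" using ldf x unfolding local_defining_function_def by blast
    have "frechet_derivative V (at x) (gradient \<rho> x /\<^sub>R norm (gradient \<rho> x)) = 0"
      by (rule V(3)[OF x(1)]) (use x ldf in \<open>auto simp: outward_unit_normal_def\<close>)
    moreover have "linear (frechet_derivative V (at x))"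
      using VDE has_derivative_linear unfolding second_derivatives_on_def by blast
    ultimately show "frechet_derivative V (at x) (gradient \<rho> x) = 0"
      using \<open>gradient \<rho> x \<noteq> 0\<close> by (simp add: linear_cmul)
  qed (use V(2) in \<open>auto simp: laplacian_def\<close>)
qed

lemma classical_neumann_max:
  fixes \<Omega> :: "'a::euclidean_space set"
  assumes dom: "bounded_smooth_domain \<Omega>" and cl: "classical_neumann_laplacian \<Omega> v w"
  obtains x where "x \<in> closure \<Omega>" "\<And>y. y \<in> closure \<Omega> \<Longrightarrow> v y \<le> v x" "w x \<le> 0"
proof -
  obtain V D E where VDE: "second_derivatives_on UNIV V D E" and "\<forall>x\<in>closure \<Omega>. V x = v x"
    and "\<forall>x\<in>closure \<Omega>. w x = (\<Sum>b\<in>Basis. E x b b)"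
    and "\<forall>x U \<rho>. x \<in> frontier \<Omega> \<longrightarrow> x \<in> U \<longrightarrow> local_defining_function \<Omega> U \<rho> \<longrightarrow> D x (gradient \<rho> x) = 0"
    using classical_neumann_laplacian_data[OF cl] by (elim exE conjE)
  note v = this(2)[rule_format] and w = this(3)[rule_format] and neumann = this(4)[rule_format]
  have "continuous_on (closure \<Omega>) V"
    using VDE unfolding second_derivatives_on_def
    by (metis UNIV_I continuous_at_imp_continuous_on has_derivative_continuous)
  moreover have "compact (closure \<Omega>)" "closure \<Omega> \<noteq> {}" using dom unfolding bounded_smooth_domain_def by auto
  ultimately obtain x where x: "x \<in> closure \<Omega>" "\<And>y. y \<in> closure \<Omega> \<Longrightarrow> V y \<le> V x"
    using continuous_attains_sup[of "closure \<Omega>" V] by blast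
  have "(\<Sum>b\<in>Basis. E x b b) \<le> 0"
  proof (cases "x \<in> \<Omega>")
    case True
    show ?thesis
      by (rule laplacian_nonpos_at_interior_max[OF _ True second_derivatives_on_subset[OF VDE]])
        (use dom x closure_subset in \<open>auto simp: bounded_smooth_domain_def\<close>)
  next
    case False
    then have xf: "x \<in> frontier \<Omega>" using x(1) dom by (simp add: frontier_def bounded_smooth_domain_def interior_open)
    then obtain U \<rho> where U: "x \<in> U" "local_defining_function \<Omega> U \<rho>"
      using dom unfolding bounded_smooth_domain_def smooth_boundary_def by blast
    show ?thesis
      by (rule laplacian_nonpos_at_boundary_max[OF U(2) xf U(1) VDE _ neumann[OF xf U]])
        (use x(2) closure_subset in blast)
  qed
  then show thesis using that[OF x(1)] x v w by metis
qed

text \<open>At a maximum point \<open>x\<close> of a classical function \<open>V\<close> one has \<open>V y \<le> V x \<le> V x - d W x\<close>, with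
\<open>W\<close> its Laplacian. No derivative occurs in this inequality, so it survives uniform limits.\<close>

lemma neumann_laplacian_dissipative:
  assumes dom: "bounded_smooth_domain \<Omega>" and nl: "neumann_laplacian \<Omega> v w" and "d > 0"
    and le: "\<And>x. x \<in> closure \<Omega> \<Longrightarrow> v x - d * w x \<le> c" and y: "y \<in> closure \<Omega>"
  shows "v y \<le> c"
proof (rule field_le_epsilon)
  fix e' :: real assume "e' > 0"
  define e where "e = e' / (2 + d)"
  have e: "e > 0" "(2 + d) * e = e'" using \<open>e' > 0\<close> \<open>d > 0\<close> by (simp_all add: e_def)
  obtain V W where cl: "\<And>k::nat. classical_neumann_laplacian \<Omega> (V k) (W k)"
    and lim: "uniform_limit (closure \<Omega>) V v sequentially" "uniform_limit (closure \<Omega>) W w sequentially"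
    using nl unfolding neumann_laplacian_def by blast
  have "\<forall>\<^sub>F k in sequentially. (\<forall>x\<in>closure \<Omega>. dist (V k x) (v x) < e) \<and> (\<forall>x\<in>closure \<Omega>. dist (W k x) (w x) < e)"
    by (intro eventually_conj uniform_limitD[OF lim(1)] uniform_limitD[OF lim(2)] e)
  then obtain k where "(\<forall>x\<in>closure \<Omega>. dist (V k x) (v x) < e) \<and> (\<forall>x\<in>closure \<Omega>. dist (W k x) (w x) < e)"
    by (auto simp: eventually_sequentially)
  then have k: "\<And>x. x \<in> closure \<Omega> \<Longrightarrow> \<bar>V k x - v x\<bar> < e" "\<And>x. x \<in> closure \<Omega> \<Longrightarrow> \<bar>W k x - w x\<bar> < e"
    unfolding dist_real_def by blast+
  obtain x where x: "x \<in> closure \<Omega>" "\<And>y. y \<in> closure \<Omega> \<Longrightarrow> V k y \<le> V k x" "W k x \<le> 0"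
    using classical_neumann_max[OF dom cl] by metis
  have "w x \<le> e" using k(2)[OF x(1)] x(3) by linarith
  then have "d * w x \<le> d * e" using \<open>d > 0\<close> by simp
  then show "v y \<le> c + e'"
    using k(1)[OF y] k(1)[OF x(1)] x(2)[OF y] le[OF x(1)] e(2) by (simp add: algebra_simps)
qed

section \<open>Strong positivity of the Neumann heat semigroup\<close>

text \<open>A Hopf lemma for functions that are only uniform limits of classical ones. Suppose that \<open>w\<close>, with
\<open>\<Delta> w \<le> l w\<close>, vanishes at \<open>z\<close> although it is positive on the side \<open>\<rho> < 0\<close> of a smooth surface
through \<open>z\<close>. Replacing \<open>\<rho>\<close> by \<open>s y = \<rho> y + \<bar>y - z\<bar>\<^sup>2\<close> bends the surface so that
\<open>w\<close> is positive wherever \<open>s \<le> 0\<close>, except at \<open>z\<close>. For large \<open>k\<close> the barrier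
\<open>p = k s\<^sup>2 - s\<close> satisfies \<open>\<Delta> p > l p\<close> near \<open>z\<close>, and for small \<open>e\<close> the function \<open>w - e p\<close>
is positive on a small sphere around \<open>z\<close>, but it is zero at \<open>z\<close>. A classical approximation of it therefore
has a minimum inside the sphere, where the inequalities for the Laplacians contradict each other; if \<open>z\<close> is a
boundary point, the minimum may lie on the boundary, but this is excluded by the Neumann condition, because
\<open>p\<close> decreases strictly in the outward direction. All conditions on \<open>p\<close> are open, so it suffices to
have them at \<open>z\<close>.\<close>

lemma hopf:
  fixes \<Omega> :: "'a::euclidean_space set"
  assumes dom: "bounded_smooth_domain \<Omega>" and nl: "neumann_laplacian \<Omega> w q"
    and cw: "continuous_on (closure \<Omega>) w" and w0: "\<And>x. x \<in> closure \<Omega> \<Longrightarrow> 0 \<le> w x"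
    and super: "\<And>x. x \<in> closure \<Omega> \<Longrightarrow> q x \<le> l * w x" and l: "l \<ge> 0"
    and U: "open U" "z \<in> U" and z: "z \<in> closure \<Omega>"
    and RDE: "second_derivatives_on U \<rho> D E"
    and cE: "\<And>b. b \<in> Basis \<Longrightarrow> continuous_on U (\<lambda>y. E y b b)"
    and rz: "\<rho> z = 0" and grad: "\<exists>b\<in>Basis. D z b \<noteq> 0"
    and pos: "\<And>x. x \<in> closure \<Omega> \<Longrightarrow> x \<in> U \<Longrightarrow> \<rho> x < 0 \<Longrightarrow> 0 < w x"
    and front: "z \<in> frontier \<Omega> \<Longrightarrow> local_defining_function \<Omega> U \<rho>"
  shows "w z > 0"
proof (rule ccontr)
  assume "\<not> w z > 0"
  then have wz: "w z = 0" using w0[OF z] by simp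
  have op: "open \<Omega>" and K: "compact (closure \<Omega>)" using dom unfolding bounded_smooth_domain_def by auto
  have R: "(\<rho> has_derivative D y) (at y)" and DD: "b \<in> Basis \<Longrightarrow> ((\<lambda>y. D y b) has_derivative E y b) (at y)"
    if "y \<in> U" for y b
    using RDE that unfolding second_derivatives_on_def by blast+
  \<comment> \<open>the surface, bent away from the zero set\<close>
  define s where "s y = \<rho> y + (y - z) \<bullet> (y - z)" for y
  define Ds where "Ds y v = D y v + 2 * ((y - z) \<bullet> v)" for y v
  define Es where "Es y b v = E y b v + 2 * (v \<bullet> b)" for y b v
  have s: "(s has_derivative Ds y) (at y)" if "y \<in> U" for y
    unfolding s_def[abs_def] Ds_def[abs_def]
    by (auto intro!: derivative_eq_intros R[OF that] simp: fun_eq_iff inner_commute)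
  have Ds: "((\<lambda>y. Ds y b) has_derivative Es y b) (at y)" if "y \<in> U" "b \<in> Basis" for y b
    unfolding Es_def[abs_def] Ds_def
    by (auto intro!: derivative_eq_intros DD[OF that] simp: fun_eq_iff)
  have cs: "continuous_on U s"
    using s U(1) by (metis continuous_at_imp_continuous_on has_derivative_continuous)
  have cDs: "continuous_on U (\<lambda>y. Ds y b)" if "b \<in> Basis" for b
    using Ds[OF _ that] U(1) by (metis (mono_tags, lifting) continuous_at_imp_continuous_on has_derivative_continuous)
  have cEs: "continuous_on U (\<lambda>y. Es y b b)" if "b \<in> Basis" for b
    unfolding Es_def by (intro continuous_intros cE that)
  have sz: "s z = 0" by (simp add: s_def rz)
  have Dz: "Ds z v = D z v" for v by (simp add: Ds_def)
  have s_neg: "\<rho> y < 0" if "s y \<le> 0" "y \<noteq> z" for y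
  proof -
    have "(y - z) \<bullet> (y - z) > 0" using that(2) by simp
    then show ?thesis using that(1) unfolding s_def by linarith
  qed
  \<comment> \<open>the barrier\<close>
  define g2 where "g2 = (\<Sum>b\<in>Basis. (Ds z b)\<^sup>2)"
  obtain b0 where b0: "b0 \<in> Basis" "Ds z b0 \<noteq> 0" using grad Dz by auto
  then have "(Ds z b0)\<^sup>2 > 0" by simp
  moreover have "(Ds z b0)\<^sup>2 \<le> g2" unfolding g2_def by (rule member_le_sum) (use b0 in auto)
  ultimately have g2: "g2 > 0" by linarith
  \<comment> \<open>\<open>k\<close> is so large that the Laplacian of \<open>p\<close> is at least \<open>1\<close> at \<open>z\<close>\<close>
  define k where "k = (\<bar>\<Sum>b\<in>Basis. Es z b b\<bar> + 1) / (2 * g2)"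
  have k: "2 * k * g2 = \<bar>\<Sum>b\<in>Basis. Es z b b\<bar> + 1" "k > 0" using g2 by (simp_all add: k_def add_nonneg_pos)
  define p where "p y = k * (s y)\<^sup>2 - s y" for y
  define Dp where "Dp y v = (2 * k * s y - 1) * Ds y v" for y v
  define Ep where "Ep y b v = (2 * k * s y - 1) * Es y b v + 2 * k * Ds y v * Ds y b" for y b v
  define L where "L y = (\<Sum>b\<in>Basis. Ep y b b)" for y
  have Pp: "(p has_derivative Dp y) (at y)" if "y \<in> U" for y
    unfolding p_def[abs_def] Dp_def[abs_def]
    by (auto intro!: derivative_eq_intros s[OF that] simp: fun_eq_iff algebra_simps)
  have DDp: "((\<lambda>y. Dp y b) has_derivative Ep y b) (at y)" if "y \<in> U" "b \<in> Basis" for y b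
    unfolding Dp_def Ep_def[abs_def]
    by (auto intro!: derivative_eq_intros s[OF that(1)] Ds[OF that] simp: fun_eq_iff algebra_simps)
  have cp: "continuous_on U p" unfolding p_def[abs_def] by (intro continuous_intros cs)
  have cL: "continuous_on U L"
    unfolding L_def[abs_def] Ep_def by (intro continuous_intros cs cDs cEs)
  have pz: "p z = 0" by (simp add: p_def sz)
  have Lz: "L z \<ge> 1"
  proof -
    have "L z = - (\<Sum>b\<in>Basis. Es z b b) + 2 * k * g2"
      unfolding L_def Ep_def g2_def by (simp add: sz sum.distrib sum_subtractf sum_negf sum_distrib_left power2_eq_square mult.assoc)
    then show ?thesis using k(1) by linarith
  qed
  have ev_U: "\<forall>\<^sub>F y in nhds z. y \<in> U" by (rule eventually_nhds_in_open[OF U])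
  have ev: "\<forall>\<^sub>F y in nhds z. P (h y)" if "continuous_on U h" "open {r. P r}" "P (h z)" for h :: "'a \<Rightarrow> real" and P
  proof -
    have "isCont h z" using that(1) U by (simp add: continuous_on_eq_continuous_at)
    then have "(h \<longlongrightarrow> h z) (nhds z)" by (simp add: continuous_at tendsto_nhds_iff)
    from topological_tendstoD[OF this that(2)] that(3) show ?thesis by simp
  qed
  have ev1: "\<forall>\<^sub>F y in nhds z. L y - l * p y > 1 / 2"
    by (rule ev[where h = "\<lambda>y. L y - l * p y" and P = "\<lambda>r. r > 1 / 2"])
       (use Lz pz in \<open>auto intro!: continuous_intros cL cp open_Collect_less\<close>)
  have ev2: "\<forall>\<^sub>F y in nhds z. k * s y < 1"
    by (rule ev[where h = "\<lambda>y. k * s y" and P = "\<lambda>r. r < 1"])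
       (use sz in \<open>auto intro!: continuous_intros cs open_Collect_less\<close>)
  have ev3: "\<forall>\<^sub>F y in nhds z. y \<in> frontier \<Omega> \<longrightarrow> (local_defining_function \<Omega> U \<rho> \<and> Dp y (gradient \<rho> y) < 0)"
  proof (cases "z \<in> frontier \<Omega>")
    case False
    then have "z \<in> \<Omega>" using z op by (simp add: frontier_def interior_open)
    have "\<forall>\<^sub>F y in nhds z. y \<in> \<Omega>" by (rule eventually_nhds_in_open[OF op \<open>z \<in> \<Omega>\<close>])
    then show ?thesis by eventually_elim (use op in \<open>simp add: frontier_def interior_open\<close>)
  next
    case True
    have Dgrad: "Dp y (gradient \<rho> y) = (2 * k * s y - 1) * (\<Sum>b\<in>Basis. Ds y b * D y b)" if "y \<in> U" for y
    proof -
      have fd: "frechet_derivative \<rho> (at y) = D y" using frechet_derivative_at[OF R[OF that]] by simp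
      have "linear (Ds y)" by (rule has_derivative_linear[OF s[OF that]])
      then have "Ds y (gradient \<rho> y) = (\<Sum>b\<in>Basis. Ds y b * D y b)"
        unfolding gradient_def fd by (simp add: linear_sum linear_cmul mult.commute)
      then show ?thesis by (simp add: Dp_def)
    qed
    have cD: "continuous_on U (\<lambda>y. D y b)" if "b \<in> Basis" for b
      using DD[OF _ that] by (metis (mono_tags, lifting) continuous_at_imp_continuous_on has_derivative_continuous)
    have "\<forall>\<^sub>F y in nhds z. (2 * k * s y - 1) * (\<Sum>b\<in>Basis. Ds y b * D y b) < 0"
    proof (rule ev[where h = "\<lambda>y. (2 * k * s y - 1) * (\<Sum>b\<in>Basis. Ds y b * D y b)" and P = "\<lambda>r. r < 0"])
      show "(2 * k * s z - 1) * (\<Sum>b\<in>Basis. Ds z b * D z b) < 0"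
        using g2 by (simp add: sz Dz g2_def power2_eq_square)
    qed (auto intro!: continuous_intros cs cDs cD open_Collect_less)
    then show ?thesis using ev_U by eventually_elim (use front[OF True] Dgrad in auto)
  qed
  obtain d where d: "d > 0" "\<And>y. dist y z < d \<Longrightarrow> y \<in> U"
    "\<And>y. dist y z < d \<Longrightarrow> L y - l * p y > 1 / 2" "\<And>y. dist y z < d \<Longrightarrow> k * s y < 1"
    "\<And>y. dist y z < d \<Longrightarrow> y \<in> frontier \<Omega> \<Longrightarrow> local_defining_function \<Omega> U \<rho> \<and> Dp y (gradient \<rho> y) < 0"
    using eventually_conj[OF ev_U eventually_conj[OF ev1 eventually_conj[OF ev2 ev3]]]
    unfolding eventually_nhds_metric by (auto; blast)
  define r where "r = d / 2"
  have r: "r > 0" "r < d" using d(1) by (auto simp: r_def)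
  have near: "dist y z < d" if "y \<in> cball z r" for y using that r by (simp add: dist_commute)
  have cballU: "cball z r \<subseteq> U" using d(2) near by blast
  have fact_p: "p y = s y * (k * s y - 1)" for y by (simp add: p_def power2_eq_square algebra_simps)
  \<comment> \<open>positivity of \<open>w - e p\<close> on the sphere\<close>
  define Sph where "Sph = closure \<Omega> \<inter> sphere z r"
  have cSph: "compact Sph" unfolding Sph_def by (intro compact_Int K compact_sphere)
  have SphU: "Sph \<subseteq> U" and SphK: "Sph \<subseteq> closure \<Omega>" using cballU by (auto simp: Sph_def)
  have cSw: "continuous_on Sph w" and cSp: "continuous_on Sph p" and cSs: "continuous_on Sph s"
    using cw cp cs SphU SphK continuous_on_subset by blast+
  obtain e where e: "e > 0" "\<And>y. y \<in> Sph \<Longrightarrow> w y - e * p y > 0"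
  proof (cases "{y \<in> Sph. s y \<le> 0} = {}")
    case True
    have "w y - 1 * p y > 0" if y: "y \<in> Sph" for y
    proof -
      have "s y > 0" using True y by force
      moreover have "k * s y - 1 < 0" using d(4)[OF near] y by (force simp: Sph_def)
      ultimately have "p y < 0" unfolding fact_p by (rule mult_pos_neg)
      then show ?thesis using w0[of y] y SphK by auto
    qed
    then show thesis using that[of 1] by simp
  next
    case False
    have "closed {y \<in> Sph. s y \<le> 0}" (is "closed ?Z")
      using continuous_closed_preimage[OF cSs compact_imp_closed[OF cSph], of "{..0}"] by (simp add: vimage_def Int_def)
    from compact_Int_closed[OF cSph this] have "compact ?Z" by (simp add: Int_absorb1)
    moreover have "continuous_on ?Z w" "continuous_on ?Z p" by (auto intro: continuous_on_subset[OF cSw] continuous_on_subset[OF cSp])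
    ultimately have "\<exists>y1\<in>?Z. \<forall>y\<in>?Z. w y1 \<le> w y" "\<exists>y2\<in>?Z. \<forall>y\<in>?Z. p y \<le> p y2"
      using continuous_attains_inf[of ?Z w] continuous_attains_sup[of ?Z p] False by blast+
    then obtain y1 y2 where y1: "y1 \<in> ?Z" "\<And>y. y \<in> ?Z \<Longrightarrow> w y1 \<le> w y" and y2: "y2 \<in> ?Z" "\<And>y. y \<in> ?Z \<Longrightarrow> p y \<le> p y2"
      by blast
    have "w y1 > 0"
    proof (rule pos)
      show "y1 \<in> closure \<Omega>" "y1 \<in> U" using y1 SphK SphU by auto
      show "\<rho> y1 < 0" by (rule s_neg) (use y1 r in \<open>auto simp: Sph_def\<close>)
    qed
    define e where "e = w y1 / (\<bar>p y2\<bar> + 1)"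
    have e: "e > 0" "e * \<bar>p y2\<bar> < w y1" using \<open>w y1 > 0\<close> by (simp_all add: e_def divide_simps add_nonneg_pos)
    have "w y - e * p y > 0" if y: "y \<in> Sph" for y
    proof (cases "s y \<le> 0")
      case True
      then have "p y \<le> \<bar>p y2\<bar>" "w y1 \<le> w y" using y1(2)[of y] y2(2)[of y] y by auto
      then have "e * p y \<le> e * \<bar>p y2\<bar>" using e by (intro mult_left_mono) auto
      then show ?thesis using e(2) \<open>w y1 \<le> w y\<close> by linarith
    next
      case False
      moreover have "k * s y - 1 < 0" using d(4)[OF near] y by (force simp: Sph_def)
      ultimately have "p y < 0" unfolding fact_p by (intro mult_pos_neg) auto
      then have "e * p y < 0" using e(1) by (rule mult_pos_neg[rotated])
      then show ?thesis using w0[of y] y SphK by auto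
    qed
    with e(1) show thesis by (rule that)
  qed
  obtain m where m: "m > 0" "\<And>y. y \<in> Sph \<Longrightarrow> w y - e * p y \<ge> m"
  proof (cases "Sph = {}")
    case True then show thesis using that[of 1] by simp
  next
    case False
    have "continuous_on Sph (\<lambda>y. w y - e * p y)" by (intro continuous_intros cSw cSp)
    from continuous_attains_inf[OF cSph False this] e(2) that show thesis by blast
  qed
  \<comment> \<open>classical approximation\<close>
  define eps where "eps = min (m / 3) (e / (4 * (2 * l + 1)))"
  have eps: "eps > 0" "eps < m / 2" "(2 * l + 1) * eps < e / 2"
  proof -
    show "eps > 0" "eps < m / 2" using m e l by (auto simp: eps_def)
    have "(2 * l + 1) * eps \<le> (2 * l + 1) * (e / (4 * (2 * l + 1)))" using l by (intro mult_left_mono) (auto simp: eps_def)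
    also have "\<dots> = e / 4" using l by (simp add: divide_simps)
    finally show "(2 * l + 1) * eps < e / 2" using e by simp
  qed
  obtain V W where cl: "\<And>k::nat. classical_neumann_laplacian \<Omega> (V k) (W k)"
    and lim: "uniform_limit (closure \<Omega>) V w sequentially" "uniform_limit (closure \<Omega>) W q sequentially"
    using nl unfolding neumann_laplacian_def by blast
  have "\<forall>\<^sub>F k in sequentially. (\<forall>x\<in>closure \<Omega>. dist (V k x) (w x) < eps) \<and> (\<forall>x\<in>closure \<Omega>. dist (W k x) (q x) < eps)"
    by (intro eventually_conj uniform_limitD[OF lim(1)] uniform_limitD[OF lim(2)] eps)
  then obtain n where "(\<forall>x\<in>closure \<Omega>. dist (V n x) (w x) < eps) \<and> (\<forall>x\<in>closure \<Omega>. dist (W n x) (q x) < eps)"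
    by (auto simp: eventually_sequentially)
  then have n: "\<And>x. x \<in> closure \<Omega> \<Longrightarrow> \<bar>V n x - w x\<bar> < eps" "\<And>x. x \<in> closure \<Omega> \<Longrightarrow> \<bar>W n x - q x\<bar> < eps"
    unfolding dist_real_def by blast+
  obtain VV DV EV where VDE: "second_derivatives_on UNIV VV DV EV" and "\<forall>x\<in>closure \<Omega>. VV x = V n x"
    and "\<forall>x\<in>closure \<Omega>. W n x = (\<Sum>b\<in>Basis. EV x b b)"
    and "\<forall>x U \<rho>. x \<in> frontier \<Omega> \<longrightarrow> x \<in> U \<longrightarrow> local_defining_function \<Omega> U \<rho> \<longrightarrow> DV x (gradient \<rho> x) = 0"
    using classical_neumann_laplacian_data[OF cl[of n]] by (elim exE conjE)
  note VV = this(2)[rule_format] and WW = this(3)[rule_format] and neumann = this(4)[rule_format]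
  have V1: "(VV has_derivative DV y) (at y)" and V2: "b \<in> Basis \<Longrightarrow> ((\<lambda>y. DV y b) has_derivative EV y b) (at y)" for y b
    using VDE unfolding second_derivatives_on_def by blast+
  define F where "F y = VV y - e * p y" for y
  have F: "(F has_derivative (\<lambda>v. DV y v - e * Dp y v)) (at y)" if "y \<in> U" for y
    unfolding F_def[abs_def] by (intro derivative_intros V1 Pp that)
  define C where "C = closure \<Omega> \<inter> cball z r"
  have CU: "C \<subseteq> U" using cballU by (auto simp: C_def)
  have "compact C" unfolding C_def by (intro compact_Int K compact_cball)
  moreover have "z \<in> C" using z r by (simp add: C_def)
  moreover have "continuous_on C F"
    using F CU by (metis continuous_at_imp_continuous_on has_derivative_continuous subsetD)
  ultimately obtain x where x: "x \<in> C" "\<And>y. y \<in> C \<Longrightarrow> F x \<le> F y"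
    using continuous_attains_inf[of C F] by blast
  have xK: "x \<in> closure \<Omega>" and xU: "x \<in> U" using x(1) CU by (auto simp: C_def)
  have Fx: "F x < eps" using x(2)[OF \<open>z \<in> C\<close>] n(1)[OF z] VV[OF z] wz pz by (simp add: F_def)
  have "x \<notin> sphere z r"
  proof
    assume "x \<in> sphere z r"
    then have "w x - e * p x \<ge> m" using m(2) xK by (simp add: Sph_def)
    then show False using Fx n(1)[OF xK] VV[OF xK] eps(2) unfolding F_def by linarith
  qed
  then have xb: "x \<in> ball z r" using x(1) by (auto simp: C_def)
  have lap: "L x - l * p x > 1 / 2" by (rule d(3)) (use xb r in \<open>simp add: dist_commute\<close>)
  show False
  proof (cases "x \<in> \<Omega>")
    case True
    have opn: "open (\<Omega> \<inter> ball z r)" by (intro open_Int op open_ball)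
    have xin: "x \<in> \<Omega> \<inter> ball z r" using True xb by simp
    have sub: "\<Omega> \<inter> ball z r \<subseteq> C" using closure_subset[of \<Omega>] by (auto simp: C_def)
    have "(\<Sum>b\<in>Basis. e * Ep x b b - EV x b b) \<le> 0"
    proof (rule laplacian_nonpos_at_interior_max[OF opn xin, where V = "\<lambda>y. e * p y - VV y"
          and D = "\<lambda>y v. e * Dp y v - DV y v" and E = "\<lambda>y b v. e * Ep y b v - EV y b v"])
      show "second_derivatives_on (\<Omega> \<inter> ball z r) (\<lambda>y. e * p y - VV y) (\<lambda>y v. e * Dp y v - DV y v) (\<lambda>y b v. e * Ep y b v - EV y b v)"
        unfolding second_derivatives_on_def
        by (intro ballI conjI derivative_intros V1 V2 Pp DDp) (use sub CU in blast)+
      show "e * p y - VV y \<le> e * p x - VV x" if "y \<in> \<Omega> \<inter> ball z r" for y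
        using x(2)[of y] sub that unfolding F_def by force
    qed
    then have "e * L x \<le> W n x" unfolding L_def WW[OF xK] by (simp add: sum_subtractf sum_distrib_left)
    also have "\<dots> \<le> l * w x + eps" using n(2)[OF xK] super[OF xK] by linarith
    also have "\<dots> \<le> l * (2 * eps + e * p x) + eps"
    proof -
      have "w x \<le> 2 * eps + e * p x" using n(1)[OF xK] VV[OF xK] Fx unfolding F_def by linarith
      from mult_left_mono[OF this l] show ?thesis by simp
    qed
    finally have "e * (L x - l * p x) \<le> (2 * l + 1) * eps" by (simp add: algebra_simps)
    moreover have "e * (L x - l * p x) > e * (1 / 2)" using lap e(1) by (intro mult_strict_left_mono) auto
    ultimately show False using eps(3) by simp
  next
    case False
    then have xf: "x \<in> frontier \<Omega>" using xK op by (simp add: frontier_def interior_open)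
    have ldf: "local_defining_function \<Omega> U \<rho>" and neg: "Dp x (gradient \<rho> x) < 0"
      using d(5)[of x] xf xb r by (auto simp: dist_commute)
    define v where "v = - gradient \<rho> x"
    have "linear (\<lambda>v. DV x v - e * Dp x v)" by (rule has_derivative_linear[OF F[OF xU]])
    from linear_neg[OF this, of "gradient \<rho> x"] neumann[OF xf xU ldf]
    have "DV x v - e * Dp x v = e * Dp x (gradient \<rho> x)" by (simp add: v_def)
    then have Fv: "DV x v - e * Dp x v < 0" using neg e(1) by (simp add: mult_pos_neg)
    have "((\<lambda>t. F (x + t *\<^sub>R v)) has_real_derivative DV x v - e * Dp x v) (at 0)"
      by (rule ray_derivative) (use F[OF xU] in simp)
    from DERIV_neg_dec_right[OF this Fv] obtain d1 where d1: "d1 > 0"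
      "\<And>t. 0 < t \<Longrightarrow> t < d1 \<Longrightarrow> F (x + (0 + t) *\<^sub>R v) < F (x + 0 *\<^sub>R v)" by metis
    have "gradient \<rho> x \<noteq> 0" using ldf xU unfolding local_defining_function_def by blast
    then have "gradient \<rho> x \<bullet> v < 0" by (simp add: v_def)
    then obtain d2 where d2: "d2 > 0" "\<And>t. 0 < t \<Longrightarrow> t < d2 \<Longrightarrow> x + t *\<^sub>R v \<in> \<Omega>"
      using inward_ray[OF ldf xf xU] by metis
    obtain d3 where d3: "d3 > 0" "\<And>t. \<bar>t\<bar> < d3 \<Longrightarrow> x + t *\<^sub>R v \<in> ball z r"
      using ray_stays_in_open[OF open_ball xb] by metis
    define t where "t = min d1 (min d2 d3) / 2"
    have t: "0 < t" "t < d1" "t < d2" "\<bar>t\<bar> < d3" using d1(1) d2(1) d3(1) by (auto simp: t_def)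
    have "x + t *\<^sub>R v \<in> C" using d2(2)[OF t(1,3)] d3(2)[OF t(4)] closure_subset[of \<Omega>] by (auto simp: C_def)
    then show False using x(2) d1(2)[OF t(1,2)] by force
  qed
qed

text \<open>If \<open>w\<close> had zeros in \<open>\<Omega>\<close>, then, as \<open>\<Omega>\<close> is connected, some zero would be a limit of points where
\<open>w\<close> is positive. A ball around such a point, enlarged until it touches the zero set, provides the surface
for the Hopf lemma. On the boundary of \<open>\<Omega>\<close> the surface is the boundary itself.\<close>

lemma strong_maximum_principle:
  fixes \<Omega> :: "'a::euclidean_space set"
  assumes dom: "bounded_smooth_domain \<Omega>" and nl: "neumann_laplacian \<Omega> w q"
    and cw: "continuous_on (closure \<Omega>) w" and w0: "\<And>x. x \<in> closure \<Omega> \<Longrightarrow> 0 \<le> w x"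
    and super: "\<And>x. x \<in> closure \<Omega> \<Longrightarrow> q x \<le> l * w x" and l: "l \<ge> 0"
    and nz: "x0 \<in> closure \<Omega>" "w x0 \<noteq> 0" and x: "x \<in> closure \<Omega>"
  shows "w x > 0"
proof -
  have op: "open \<Omega>" and conn: "connected \<Omega>" using dom unfolding bounded_smooth_domain_def by auto
  have sub: "\<Omega> \<subseteq> closure \<Omega>" by (rule closure_subset)
  have cw': "continuous_on \<Omega> w" by (rule continuous_on_subset[OF cw sub])
  obtain x1 where x1: "x1 \<in> \<Omega>" "w x1 \<noteq> 0"
    using continuous_constant_on_closure[OF cw, of 0] nz by blast
  define P Z where "P = {y \<in> \<Omega>. w y \<noteq> 0}" and "Z = {y \<in> \<Omega>. w y = 0}"
  have "open P"
  proof -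
    have "P = \<Omega> \<inter> w -` (- {0})" by (auto simp: P_def)
    then show ?thesis using continuous_open_preimage[OF cw' op, of "- {0}"] by (simp add: open_Compl)
  qed
  have interior: "w y > 0" if "y \<in> \<Omega>" for y
  proof (rule ccontr)
    assume "\<not> w y > 0"
    then have "y \<in> Z" using w0[of y] that sub by (force simp: Z_def)
    have "\<not> open Z"
    proof
      assume "open Z"
      have "P \<inter> Z \<inter> \<Omega> = {}" "\<Omega> \<subseteq> P \<union> Z" "P \<inter> \<Omega> \<noteq> {}" "Z \<inter> \<Omega> \<noteq> {}"
        using x1 \<open>y \<in> Z\<close> by (auto simp: P_def Z_def)
      then show False using conn \<open>open P\<close> \<open>open Z\<close> unfolding connected_def by blast
    qed
    then obtain z0 where z0: "z0 \<in> Z" "\<And>e. e > 0 \<Longrightarrow> \<not> ball z0 e \<subseteq> Z" unfolding open_contains_ball by blast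
    have "z0 \<in> \<Omega>" using z0(1) by (simp add: Z_def)
    obtain d where d: "d > 0" "ball z0 d \<subseteq> \<Omega>" using op \<open>z0 \<in> \<Omega>\<close> open_contains_ball by blast
    have "\<not> ball z0 (d / 2) \<subseteq> Z" using z0(2)[of "d / 2"] d(1) by simp
    then obtain c where c: "dist z0 c < d / 2" "c \<notin> Z" by (metis mem_ball subsetI)
    have "c \<in> \<Omega>" using c(1) d by (intro subsetD[OF d(2)]) simp
    \<comment> \<open>\<open>z\<close> is a zero nearest to \<open>c\<close>\<close>
    define B where "B = cball c (dist c z0) \<inter> w -` {0}"
    have cb: "cball c (dist c z0) \<subseteq> \<Omega>"
    proof
      fix y assume "y \<in> cball c (dist c z0)"
      then have "dist z0 y < d" using dist_triangle[of z0 y c] c(1) by (simp add: dist_commute)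
      then show "y \<in> \<Omega>" using d(2) by auto
    qed
    have "closed B" unfolding B_def
      by (rule continuous_closed_preimage[OF continuous_on_subset[OF cw' cb]]) auto
    moreover have "z0 \<in> B" using z0(1) by (simp add: B_def Z_def)
    ultimately obtain z where z: "z \<in> B" "\<And>y. y \<in> B \<Longrightarrow> dist c z \<le> dist c y"
      using distance_attains_inf[of B c] by blast
    have "z \<in> \<Omega>" using z(1) cb by (auto simp: B_def)
    have "z \<noteq> c" using z(1) c(2) \<open>c \<in> \<Omega>\<close> by (auto simp: B_def Z_def)
    have "w z > 0"
    proof (rule hopf[OF dom nl cw w0 super l open_UNIV UNIV_I,
          where \<rho> = "\<lambda>y. (y - c) \<bullet> (y - c) - (z - c) \<bullet> (z - c)" and D = "\<lambda>y v. 2 * ((y - c) \<bullet> v)" and E = "\<lambda>y b v. 2 * (v \<bullet> b)"])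
      show "z \<in> closure \<Omega>" using \<open>z \<in> \<Omega>\<close> sub by blast
      show "second_derivatives_on UNIV (\<lambda>y. (y - c) \<bullet> (y - c) - (z - c) \<bullet> (z - c)) (\<lambda>y v. 2 * ((y - c) \<bullet> v)) (\<lambda>y b v. 2 * (v \<bullet> b))"
        unfolding second_derivatives_on_def
        by (auto intro!: derivative_eq_intros simp: fun_eq_iff inner_commute)
      show "\<exists>b\<in>Basis. 2 * ((z - c) \<bullet> b) \<noteq> 0"
        using \<open>z \<noteq> c\<close> euclidean_all_zero_iff[of "z - c"] by auto
      show "0 < w y" if "y \<in> closure \<Omega>" and "(y - c) \<bullet> (y - c) - (z - c) \<bullet> (z - c) < 0" for y
      proof -
        have "norm (y - c) < norm (z - c)" using that(2) by (simp add: norm_lt)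
        then have less: "dist c y < dist c z" by (metis dist_commute dist_norm)
        then have "y \<notin> B" using z(2)[of y] by auto
        moreover have "dist c z \<le> dist c z0" by (rule z(2)[OF \<open>z0 \<in> B\<close>])
        ultimately have "w y \<noteq> 0" using less by (simp add: B_def)
        then show ?thesis using w0[OF that(1)] by simp
      qed
      show "local_defining_function \<Omega> UNIV (\<lambda>y. (y - c) \<bullet> (y - c) - (z - c) \<bullet> (z - c))" if "z \<in> frontier \<Omega>"
        using that \<open>z \<in> \<Omega>\<close> op by (simp add: frontier_def interior_open)
    qed (auto intro!: continuous_intros)
    then show False using z(1) by (simp add: B_def)
  qed
  show ?thesis
  proof (cases "x \<in> \<Omega>")
    case True then show ?thesis by (rule interior)
  next
    case False
    then have xf: "x \<in> frontier \<Omega>" using x op by (simp add: frontier_def interior_open)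
    then obtain U \<rho> where xU: "x \<in> U" and ldf: "local_defining_function \<Omega> U \<rho>"
      using dom unfolding bounded_smooth_domain_def smooth_boundary_def by blast
    have U: "open U" and sm: "smooth_on U \<rho>" and sets: "\<Omega> \<inter> U = {x \<in> U. \<rho> x < 0}" "frontier \<Omega> \<inter> U = {x \<in> U. \<rho> x = 0}"
      and g: "gradient \<rho> x \<noteq> 0"
      using ldf xU unfolding local_defining_function_def by auto
    have Ck: "Ck_on 2 U \<rho>" using sm unfolding smooth_on_def by blast
    show ?thesis
    proof (rule hopf[OF dom nl cw w0 super l U xU x second_derivatives_on_Ck_2(1)[OF Ck] second_derivatives_on_Ck_2(2)[OF Ck]])
      show "\<rho> x = 0" using sets(2) xf xU by blast
      show "\<exists>b\<in>Basis. frechet_derivative \<rho> (at x) b \<noteq> 0"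
        using g unfolding gradient_def by (metis (no_types, lifting) scaleR_eq_0_iff sum.neutral)
      show "0 < w y" if "y \<in> U" "\<rho> y < 0" for y using that sets(1) interior by blast
    qed (use ldf in auto)
  qed
qed

lemma neumann_laplacian_closed:
  fixes \<Omega> :: "'a::euclidean_space set"
  assumes nl: "\<And>n::nat. neumann_laplacian \<Omega> (v n) (w n)"
    and v: "uniform_limit (closure \<Omega>) v v0 sequentially" and w: "uniform_limit (closure \<Omega>) w w0 sequentially"
  shows "neumann_laplacian \<Omega> v0 w0"
proof -
  have "\<forall>n. \<exists>V W. classical_neumann_laplacian \<Omega> V W \<and>
    (\<forall>x\<in>closure \<Omega>. dist (V x) (v n x) < 1 / real (Suc n)) \<and> (\<forall>x\<in>closure \<Omega>. dist (W x) (w n x) < 1 / real (Suc n))"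
  proof
    fix n
    obtain V W where cl: "\<forall>k::nat. classical_neumann_laplacian \<Omega> (V k) (W k)"
      and lim: "uniform_limit (closure \<Omega>) V (v n) sequentially" "uniform_limit (closure \<Omega>) W (w n) sequentially"
      using nl[of n] unfolding neumann_laplacian_def by (elim exE conjE)
    have "\<forall>\<^sub>F k in sequentially. (\<forall>x\<in>closure \<Omega>. dist (V k x) (v n x) < 1 / real (Suc n)) \<and> (\<forall>x\<in>closure \<Omega>. dist (W k x) (w n x) < 1 / real (Suc n))"
      by (intro eventually_conj uniform_limitD[OF lim(1)] uniform_limitD[OF lim(2)]) simp_all
    then obtain k where "(\<forall>x\<in>closure \<Omega>. dist (V k x) (v n x) < 1 / real (Suc n)) \<and> (\<forall>x\<in>closure \<Omega>. dist (W k x) (w n x) < 1 / real (Suc n))"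
      by (auto simp: eventually_sequentially)
    then show "\<exists>V W. classical_neumann_laplacian \<Omega> V W \<and>
      (\<forall>x\<in>closure \<Omega>. dist (V x) (v n x) < 1 / real (Suc n)) \<and> (\<forall>x\<in>closure \<Omega>. dist (W x) (w n x) < 1 / real (Suc n))"
      using cl by (intro exI[of _ "V k"] exI[of _ "W k"]) simp
  qed
  then have "\<exists>V W. \<forall>n. classical_neumann_laplacian \<Omega> (V n) (W n) \<and>
    (\<forall>x\<in>closure \<Omega>. dist (V n x) (v n x) < 1 / real (Suc n)) \<and> (\<forall>x\<in>closure \<Omega>. dist (W n x) (w n x) < 1 / real (Suc n))"
    by (simp only: choice_iff)
  then obtain V W where VW: "\<forall>n. classical_neumann_laplacian \<Omega> (V n) (W n) \<and>
    (\<forall>x\<in>closure \<Omega>. dist (V n x) (v n x) < 1 / real (Suc n)) \<and> (\<forall>x\<in>closure \<Omega>. dist (W n x) (w n x) < 1 / real (Suc n))"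
    by (elim exE)
  have diag: "uniform_limit (closure \<Omega>) F f0 sequentially"
    if F: "\<forall>n. \<forall>x\<in>closure \<Omega>. dist (F n x) (f n x) < 1 / real (Suc n)" and f: "uniform_limit (closure \<Omega>) f f0 sequentially"
    for F f :: "nat \<Rightarrow> 'a \<Rightarrow> real" and f0
  proof (rule uniform_limitI)
    fix e :: real assume e: "e > 0"
    have "\<forall>\<^sub>F n in sequentially. \<forall>x\<in>closure \<Omega>. dist (f n x) (f0 x) < e / 2" by (rule uniform_limitD[OF f]) (use e in simp)
    moreover have "\<forall>\<^sub>F n in sequentially. 1 / real (Suc n) < e / 2"
      using order_tendstoD(2)[OF LIMSEQ_inverse_real_of_nat, of "e / 2"] e by (simp add: inverse_eq_divide)
    ultimately show "\<forall>\<^sub>F n in sequentially. \<forall>x\<in>closure \<Omega>. dist (F n x) (f0 x) < e"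
    proof eventually_elim
      case (elim n)
      show ?case
      proof
        fix x assume x: "x \<in> closure \<Omega>"
        have "dist (F n x) (f n x) < e / 2" using F[rule_format, OF x, of n] elim(2) by linarith
        moreover have "dist (f n x) (f0 x) < e / 2" using elim(1) x by blast
        ultimately show "dist (F n x) (f0 x) < e" using dist_triangle[of "F n x" "f0 x" "f n x"] by linarith
      qed
    qed
  qed
  show ?thesis unfolding neumann_laplacian_def
  proof (intro exI conjI allI)
    show "classical_neumann_laplacian \<Omega> (V k) (W k)" for k using VW by blast
    show "uniform_limit (closure \<Omega>) V v0 sequentially" by (rule diag[OF _ v]) (use VW in blast)
    show "uniform_limit (closure \<Omega>) W w0 sequentially" by (rule diag[OF _ w]) (use VW in blast)
  qed
qed

lemma neumann_dissipative_semigroup: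
  assumes dom: "bounded_smooth_domain \<Omega>" and sg: "neumann_heat_semigroup \<Omega> T"
  shows "dissipative_semigroup (closure \<Omega>) T"
proof
  show "compact (closure \<Omega>)" "closure \<Omega> \<noteq> {}" using dom unfolding bounded_smooth_domain_def by auto
  show "C0_semigroup_on (closure \<Omega>) T" using sg unfolding neumann_heat_semigroup_def by (rule conjunct1)
  fix v w d c x
  assume g: "generator_on (closure \<Omega>) T v w" and d: "d > 0" and le: "\<And>x. x \<in> closure \<Omega> \<Longrightarrow> v x - d * w x \<le> c" and x: "x \<in> closure \<Omega>"
  have "neumann_laplacian \<Omega> v w" using sg g unfolding neumann_heat_semigroup_def by simp
  then show "v x \<le> c" by (rule neumann_laplacian_dissipative[OF dom _ d le x])
qed

text \<open>The resolvent \<open>w = \<integral> exp (- s) T s v ds\<close> over \<open>{0..}\<close> solves \<open>\<Delta> w = w - v \<le> w\<close>. If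
  \<open>T s v\<close> vanished at some point for all \<open>s\<close>, so would \<open>w\<close>; by the strong maximum principle
  \<open>w\<close> would then vanish everywhere, and hence so would \<open>v\<close>.\<close>

lemma neumann_heat_positive:
  fixes \<Omega> :: "'a::euclidean_space set"
  assumes dom: "bounded_smooth_domain \<Omega>" and sg: "neumann_heat_semigroup \<Omega> T"
    and v: "continuous_on (closure \<Omega>) v" and v0: "\<And>x. x \<in> closure \<Omega> \<Longrightarrow> 0 \<le> v x"
    and nz: "x0 \<in> closure \<Omega>" "v x0 \<noteq> 0" and x: "x \<in> closure \<Omega>"
  shows "\<exists>t\<ge>0. T t v x > 0"
proof (rule ccontr)
  assume contra: "\<not> (\<exists>t\<ge>0. T t v x > 0)"
  interpret dissipative_semigroup "closure \<Omega>" T by (rule neumann_dissipative_semigroup[OF dom sg])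
  have Tpos: "T t v y \<ge> 0" if "t \<ge> 0" "y \<in> closure \<Omega>" for t y
    using T_ge[OF v v0 that] .
  have Tx: "T t v x = 0" if "t \<ge> 0" for t using contra Tpos[OF that x] that by force
  obtain c where c: "c > 0" "\<And>x. x \<in> closure \<Omega> \<Longrightarrow> \<bar>v x\<bar> \<le> c" using bounded_on_K[OF v] by metis
  define w where "w n y = integral {0..real n} (\<lambda>s. exp (- 1 * s) * T s v y)" for n y
  define q where "q n y = 1 * w n y - v y + exp (- 1 * real n) * T (real n) v y" for n y
  have nl: "neumann_laplacian \<Omega> (w n) (q n)" for n
  proof -
    have "generator_on (closure \<Omega>) T (w n) (q n)"
      using generator_truncated_resolvent[OF v, of "real n" 1] unfolding w_def[abs_def] q_def[abs_def] by simp
    then show ?thesis using sg unfolding neumann_heat_semigroup_def by blast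
  qed
  have cw: "continuous_on (closure \<Omega>) (w n)" for n
    using generator_truncated_resolvent[OF v, of "real n" 1] unfolding w_def[abs_def] generator_on_def by simp
  have cI: "continuous_on A (\<lambda>s. exp (- 1 * s) * T s v y)" if "y \<in> closure \<Omega>" "A \<subseteq> {0..}" for y A
    using continuous_on_subset[OF continuous_on_time[OF continuous_on_orbit[OF v] that(1)] that(2)]
    by (intro continuous_intros)
  have step: "w n y \<le> w m y" "w m y - w n y \<le> c * exp (- real n)" if mn: "n \<le> m" and y: "y \<in> closure \<Omega>" for m n y
  proof -
    have "w n y + integral {real n..real m} (\<lambda>s. exp (- 1 * s) * T s v y) = w m y"
      unfolding w_def
      using Henstock_Kurzweil_Integration.integral_combine[where a = 0 and c = "real n" and b = "real m" and f = "\<lambda>s. exp (- 1 * s) * T s v y"] mn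
      by (simp add: integrable_continuous_real cI[OF y, simplified])
    moreover have "integral {real n..real m} (\<lambda>s. exp (- 1 * s) * T s v y) \<ge> 0"
      by (intro integral_nonneg integrable_continuous_real cI y) (auto intro!: mult_nonneg_nonneg Tpos y)
    moreover have "integral {real n..real m} (\<lambda>s. exp (- 1 * s) * T s v y) \<le> c * exp (- real n)"
    proof -
      have "((\<lambda>s. exp (- s) * c) has_integral (- exp (- real m) * c - - exp (- real n) * c)) {real n..real m}"
        by (rule fundamental_theorem_of_calculus)
          (use mn in \<open>auto simp: has_real_derivative_iff_has_vector_derivative[symmetric] intro!: derivative_eq_intros\<close>)
      note i = has_integral_integrable[OF this] integral_unique[OF this]
      have "integral {real n..real m} (\<lambda>s. exp (- 1 * s) * T s v y) \<le> integral {real n..real m} (\<lambda>s. exp (- s) * c)"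
      proof (rule integral_le[OF _ i(1)])
        show "(\<lambda>s. exp (- 1 * s) * T s v y) integrable_on {real n..real m}"
          by (intro integrable_continuous_real cI y) auto
        fix s assume s: "s \<in> {real n..real m}"
        have "\<bar>T s v y\<bar> \<le> c" by (rule T_abs_le[OF v c(2)]) (use s y in auto)
        then show "exp (- 1 * s) * T s v y \<le> exp (- s) * c" by simp
      qed
      also have "\<dots> \<le> c * exp (- real n)" unfolding i(2) using c(1) by (simp add: mult.commute)
      finally show ?thesis .
    qed
    ultimately show "w n y \<le> w m y" "w m y - w n y \<le> c * exp (- real n)" by linarith+
  qed
  have exp0: "(\<lambda>n. c * exp (- real n)) \<longlonglongrightarrow> 0"
    by real_asymp
  define w0 where "w0 y = lim (\<lambda>n. w n y)" for y
  have conv: "(\<lambda>n. w n y) \<longlonglongrightarrow> w0 y" if y: "y \<in> closure \<Omega>" for y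
  proof -
    have "convergent (\<lambda>n. w n y)"
    proof (rule Bseq_mono_convergent)
      show "Bseq (\<lambda>n. w n y)"
      proof (rule BseqI'[of _ "c"])
        fix n
        have "w 0 y = 0" by (simp add: w_def)
        then show "norm (w n y) \<le> c" using step[of 0 n y] y by simp
      qed
      show "\<forall>m n. m \<le> n \<longrightarrow> w m y \<le> w n y" using step(1) y by blast
    qed
    then show ?thesis by (simp add: w0_def convergent_LIMSEQ_iff)
  qed
  have bound: "w n y \<le> w0 y" "w0 y - w n y \<le> c * exp (- real n)" if y: "y \<in> closure \<Omega>" for n y
  proof -
    show "w n y \<le> w0 y" by (rule LIMSEQ_le_const[OF conv[OF y]]) (use step(1) y in blast)
    have "(\<lambda>m. w m y - w n y) \<longlonglongrightarrow> w0 y - w n y" by (intro tendsto_intros conv y)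
    then show "w0 y - w n y \<le> c * exp (- real n)" by (rule LIMSEQ_le_const2) (use step(2) y in blast)
  qed
  have ul: "uniform_limit (closure \<Omega>) w w0 sequentially"
  proof (rule uniform_limitI)
    fix e :: real assume "e > 0"
    with order_tendstoD(2)[OF exp0] have "\<forall>\<^sub>F n in sequentially. c * exp (- real n) < e" by blast
    then show "\<forall>\<^sub>F n in sequentially. \<forall>y\<in>closure \<Omega>. dist (w n y) (w0 y) < e"
    proof eventually_elim
      case (elim n)
      show ?case
      proof
        fix y assume "y \<in> closure \<Omega>"
        from bound[OF this, of n] elim show "dist (w n y) (w0 y) < e" unfolding dist_real_def by linarith
      qed
    qed
  qed
  have uq: "uniform_limit (closure \<Omega>) q (\<lambda>y. w0 y - v y) sequentially"
  proof (rule uniform_limitI)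
    fix e :: real assume e: "e > 0"
    then have "\<forall>\<^sub>F n in sequentially. c * exp (- real n) < e / 2" using order_tendstoD(2)[OF exp0, of "e / 2"] by simp
    moreover have "\<forall>\<^sub>F n in sequentially. \<forall>y\<in>closure \<Omega>. dist (w n y) (w0 y) < e / 2" by (rule uniform_limitD[OF ul]) (use e in simp)
    ultimately show "\<forall>\<^sub>F n in sequentially. \<forall>y\<in>closure \<Omega>. dist (q n y) (w0 y - v y) < e"
    proof eventually_elim
      case (elim n)
      show ?case
      proof
        fix y assume y: "y \<in> closure \<Omega>"
        have "\<bar>T (real n) v y\<bar> \<le> c" by (rule T_abs_le[OF v c(2)]) (use y in auto)
        then have "exp (- real n) * \<bar>T (real n) v y\<bar> \<le> exp (- real n) * c" by (intro mult_left_mono) auto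
        then have "exp (- real n) * \<bar>T (real n) v y\<bar> < e / 2" using elim(1) unfolding mult.commute[of c] by linarith
        then have "\<bar>exp (- real n) * T (real n) v y\<bar> < e / 2" by (simp add: abs_mult)
        moreover have "\<bar>w n y - w0 y\<bar> < e / 2" using elim(2) y by (simp add: dist_real_def)
        ultimately show "dist (q n y) (w0 y - v y) < e" unfolding dist_real_def q_def by simp argo
      qed
    qed
  qed
  have nl0: "neumann_laplacian \<Omega> w0 (\<lambda>y. w0 y - v y)" by (rule neumann_laplacian_closed[OF nl ul uq])
  have cw0: "continuous_on (closure \<Omega>) w0" by (rule uniform_limit_theorem[OF _ ul]) (use cw in auto)
  have w00: "w0 y \<ge> 0" if "y \<in> closure \<Omega>" for y using bound(1)[OF that, of 0] by (simp add: w_def)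
  have "w n x = 0" for n
  proof -
    have "integral {0..real n} (\<lambda>s. exp (- 1 * s) * T s v x) = integral {0..real n} (\<lambda>s. 0)"
      by (intro integral_cong) (simp add: Tx)
    then show ?thesis by (simp add: w_def)
  qed
  then have w0x: "w0 x = 0" by (simp add: w0_def)
  have "w0 x0 = 0"
  proof (rule ccontr)
    assume "w0 x0 \<noteq> 0"
    have "w0 x > 0"
      by (rule strong_maximum_principle[OF dom nl0 cw0 w00 _ _ nz(1) \<open>w0 x0 \<noteq> 0\<close> x, of 1]) (use v0 in auto)
    then show False using w0x by simp
  qed
  then have "w 1 x0 = 0" using bound(1)[OF nz(1), of 1] step(1)[of 0 1 x0] nz(1) by (simp add: w_def)
  then have "integral {0..1} (\<lambda>s. exp (- 1 * s) * T s v x0) = 0" by (simp add: w_def)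
  moreover have "continuous_on {0..1} (\<lambda>s. exp (- 1 * s) * T s v x0)" by (rule cI[OF nz(1)]) auto
  ultimately have "\<forall>s\<in>{0..1}. exp (- 1 * s) * T s v x0 = 0"
    using integral_eq_0_iff[of 0 1 "\<lambda>s. exp (- 1 * s) * T s v x0"] Tpos[OF _ nz(1)] by simp
  then have "T 0 v x0 = 0" by force
  then show False using T_0[OF v nz(1)] nz(2) by simp
qed

section \<open>Weighted averages\<close>

locale probability_weight =
  fixes h :: "real \<Rightarrow> real" and \<tau> :: real
  assumes tau_pos: "\<tau> > 0" and h_pos: "\<And>a. a \<in> {0..\<tau>} \<Longrightarrow> h a > 0"
    and h_integrable: "h absolutely_integrable_on {0..\<tau>}" and h_integral: "integral {0..\<tau>} h = 1"
begin

definition avg :: "(real \<Rightarrow> real) \<Rightarrow> real" where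
  "avg q = integral {0..\<tau>} (\<lambda>a. h a * q a)"

lemma avg_absolutely_integrable:
  assumes "continuous_on {0..\<tau>} q" shows "(\<lambda>a. h a * q a) absolutely_integrable_on {0..\<tau>}"
proof -
  have "(\<lambda>a. q a * h a) absolutely_integrable_on {0..\<tau>}"
    by (rule absolutely_integrable_bounded_measurable_product_real[OF continuous_imp_measurable_on_sets_lebesgue[OF assms]])
      (use assms h_integrable in \<open>auto intro!: compact_imp_bounded compact_continuous_image\<close>)
  then show ?thesis by (simp add: mult.commute)
qed

lemma avg_integrable: "continuous_on {0..\<tau>} q \<Longrightarrow> (\<lambda>a. h a * q a) integrable_on {0..\<tau>}"
  using avg_absolutely_integrable set_lebesgue_integral_eq_integral(1) by blast

lemma avg_const: "avg (\<lambda>_. c) = c"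
  unfolding avg_def using h_integral by simp

lemma avg_minus: "avg (\<lambda>a. - q a) = - avg q"
  unfolding avg_def by simp

lemma avg_diff:
  assumes "continuous_on {0..\<tau>} q" "continuous_on {0..\<tau>} r"
  shows "avg (\<lambda>a. q a - r a) = avg q - avg r"
  unfolding avg_def right_diff_distrib by (rule integral_diff) (intro avg_integrable assms)+

lemma avg_mono:
  assumes "continuous_on {0..\<tau>} q" "continuous_on {0..\<tau>} r" "\<And>a. a \<in> {0..\<tau>} \<Longrightarrow> q a \<le> r a"
  shows "avg q \<le> avg r"
  unfolding avg_def
  by (rule integral_le) (use avg_integrable assms h_pos in \<open>auto intro!: mult_left_mono less_imp_le\<close>)

lemma avg_le: "continuous_on {0..\<tau>} q \<Longrightarrow> (\<And>a. a \<in> {0..\<tau>} \<Longrightarrow> q a \<le> c) \<Longrightarrow> avg q \<le> c"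
  using avg_mono[of q "\<lambda>_. c"] avg_const by simp

lemma avg_ge: "continuous_on {0..\<tau>} q \<Longrightarrow> (\<And>a. a \<in> {0..\<tau>} \<Longrightarrow> c \<le> q a) \<Longrightarrow> c \<le> avg q"
  using avg_mono[of "\<lambda>_. c" q] avg_const by simp

lemma avg_abs_diff_le:
  assumes "continuous_on {0..\<tau>} q" "continuous_on {0..\<tau>} r" "\<And>a. a \<in> {0..\<tau>} \<Longrightarrow> \<bar>q a - r a\<bar> \<le> c"
  shows "\<bar>avg q - avg r\<bar> \<le> c"
proof -
  have c: "continuous_on {0..\<tau>} (\<lambda>a. q a - r a)" by (intro continuous_intros assms)
  have "avg (\<lambda>a. q a - r a) \<le> c" by (rule avg_le[OF c]) (use assms(3) in force)
  moreover have "- c \<le> avg (\<lambda>a. q a - r a)" by (rule avg_ge[OF c]) (use assms(3) in force)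
  ultimately show ?thesis using avg_diff[OF assms(1,2)] by simp
qed

text \<open>The weight being positive everywhere, an average of a nonnegative function vanishes only if the
  function vanishes almost everywhere, hence, by continuity, everywhere.\<close>

lemma avg_pos:
  assumes q: "continuous_on {0..\<tau>} q" and q0: "\<And>a. a \<in> {0..\<tau>} \<Longrightarrow> 0 \<le> q a" and a: "a \<in> {0..\<tau>}" "q a > 0"
  shows "avg q > 0"
proof (rule ccontr)
  assume "\<not> avg q > 0"
  moreover have "avg q \<ge> 0" by (rule avg_ge[OF q q0])
  ultimately have zero: "integral {0..\<tau>} (\<lambda>a. h a * q a) = 0" by (simp add: avg_def)
  have af: "(\<lambda>a. h a * q a) absolutely_integrable_on {0..\<tau>}" by (rule avg_absolutely_integrable[OF q])
  have "(LINT x|lebesgue. indicator {0..\<tau>} x *\<^sub>R (h x * q x)) = 0"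
    using set_lebesgue_integral_eq_integral(2)[OF af] zero by (simp add: set_lebesgue_integral_def)
  then have "AE x in lebesgue. indicator {0..\<tau>} x *\<^sub>R (h x * q x) = 0"
    by (subst (asm) integral_nonneg_eq_0_iff_AE)
      (use af q0 h_pos in \<open>auto simp: set_integrable_def indicator_def less_imp_le\<close>)
  then obtain N where N: "{x. indicator {0..\<tau>} x *\<^sub>R (h x * q x) \<noteq> 0} \<subseteq> N" "N \<in> null_sets lebesgue"
    unfolding eventually_ae_filter by auto
  obtain d where d: "d > 0" "\<And>b. b \<in> {0..\<tau>} \<Longrightarrow> \<bar>b - a\<bar> < d \<Longrightarrow> q b > 0"
  proof -
    obtain d where "d > 0" "\<And>b. b \<in> {0..\<tau>} \<Longrightarrow> dist b a < d \<Longrightarrow> dist (q b) (q a) < q a"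
      using q a unfolding continuous_on_iff by metis
    then show thesis using that[of d] by (force simp: dist_real_def)
  qed
  define l r where "l = max 0 (a - d)" and "r = min \<tau> (a + d)"
  have "l < r" using a(1) d(1) tau_pos by (auto simp: l_def r_def)
  have "{l<..<r} \<subseteq> N"
  proof
    fix b assume "b \<in> {l<..<r}"
    then have b: "b \<in> {0..\<tau>}" "\<bar>b - a\<bar> < d" by (auto simp: l_def r_def)
    then have "h b * q b > 0" using d(2) h_pos by simp
    then show "b \<in> N" using N(1) b(1) by auto
  qed
  then have "negligible {l<..<r}" using N(2) negligible_iff_null_sets negligible_subset by blast
  moreover have "\<not> negligible {l<..<r}" by (rule open_not_negligible) (use \<open>l < r\<close> in auto)
  ultimately show False by contradiction
qed

end

section \<open>Delay equations with a dissipative semigroup\<close>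

locale delay_equation = dissipative_semigroup K T + probability_weight h \<tau>
  for K :: "'a::euclidean_space set" and T and h and \<tau> +
  fixes f g :: "real \<Rightarrow> real" and L :: real
  assumes L_pos: "L > 0" and f_lip: "\<And>r s. \<bar>f r - f s\<bar> \<le> L * \<bar>r - s\<bar>" and g_lip: "\<And>r s. \<bar>g r - g s\<bar> \<le> L * \<bar>r - s\<bar>"
begin

definition rhs :: "('a \<Rightarrow> real \<Rightarrow> real) \<Rightarrow> 'a \<Rightarrow> real \<Rightarrow> real" where
  "rhs u x t = - f (u x t) + avg (\<lambda>a. g (u x (t - a)))"

text \<open>Only the Euler steps of a mild solution are retained. Unlike the notion of a nonnegative mild solution, this one
is invariant under reflection.\<close>

definition solution :: "('a \<Rightarrow> real \<Rightarrow> real) \<Rightarrow> bool" where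
  "solution u \<longleftrightarrow> continuous_on (K \<times> {-\<tau>..}) (\<lambda>(x, t). u x t) \<and> (\<forall>t\<ge>0. euler_consistent u (rhs u) t)"

lemma continuous_on_f: "continuous_on A f" and continuous_on_g: "continuous_on A g"
proof -
  have "L-lipschitz_on UNIV f" "L-lipschitz_on UNIV g"
    by (auto intro!: lipschitz_onI simp: dist_real_def f_lip g_lip less_imp_le L_pos)
  then show "continuous_on A f" "continuous_on A g"
    using lipschitz_on_continuous_on continuous_on_subset by blast+
qed

lemma continuous_on_history:
  assumes u: "continuous_on (K \<times> {-\<tau>..}) (\<lambda>(x, t). u x t)" and "x \<in> K" "t \<ge> 0"
  shows "continuous_on {0..\<tau>} (\<lambda>a. u x (t - a))"
proof -
  have "continuous_on {-\<tau>..} (u x)" by (rule continuous_on_time[OF u \<open>x \<in> K\<close>])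
  then show ?thesis by (rule continuous_on_compose2) (use \<open>t \<ge> 0\<close> in \<open>auto intro!: continuous_intros\<close>)
qed

lemma continuous_on_g_history:
  assumes "continuous_on (K \<times> {-\<tau>..}) (\<lambda>(x, t). u x t)" and "x \<in> K" "t \<ge> 0"
  shows "continuous_on {0..\<tau>} (\<lambda>a. g (u x (t - a)))"
  by (rule continuous_on_compose2[OF continuous_on_g[of UNIV] continuous_on_history[OF assms]]) auto

text \<open>The weight is merely integrable, but continuity is inherited from \<open>u\<close>, since averages of functions that are
uniformly close on \<open>{0..\<tau>}\<close> are close.\<close>

lemma continuous_on_avg_history:
  assumes u: "continuous_on (K \<times> {-\<tau>..}) (\<lambda>(x, t). u x t)"
  shows "continuous_on (K \<times> {0..}) (\<lambda>(x, t). avg (\<lambda>a. g (u x (t - a))))"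
proof (unfold continuous_on_iff, intro ballI allI impI)
  fix q0 :: "'a \<times> real" and e :: real assume q0: "q0 \<in> K \<times> {0..}" and e: "e > 0"
  have c: "continuous_on ((K \<times> {0..}) \<times> {0..\<tau>}) (\<lambda>(q, a). g (u (fst q) (snd q - a)))"
  proof -
    have "continuous_on ((K \<times> {0..}) \<times> {0..\<tau>}) (\<lambda>p. (fst (fst p), snd (fst p) - snd p))" by (intro continuous_intros)
    moreover have "(\<lambda>p. (fst (fst p), snd (fst p) - snd p)) ` ((K \<times> {0..}) \<times> {0..\<tau>}) \<subseteq> K \<times> {-\<tau>..}" by auto
    ultimately have "continuous_on ((K \<times> {0..}) \<times> {0..\<tau>}) (\<lambda>p. u (fst (fst p)) (snd (fst p) - snd p))"
      using continuous_on_compose2[OF u, of "(K \<times> {0..}) \<times> {0..\<tau>}" "\<lambda>p. (fst (fst p), snd (fst p) - snd p)"] by simp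
    from continuous_on_compose2[OF continuous_on_g[of UNIV] this] show ?thesis by (simp add: case_prod_beta')
  qed
  have "e / 2 > 0" using e by simp
  from continuous_on_prod_compactE[OF c compact_Icc q0 this]
  obtain X0 where X0: "q0 \<in> X0" "open X0"
    and b: "\<forall>q\<in>X0 \<inter> K \<times> {0..}. \<forall>a\<in>{0..\<tau>}. dist (g (u (fst q) (snd q - a))) (g (u (fst q0) (snd q0 - a))) \<le> e / 2"
    by (auto simp: case_prod_beta')
  obtain d where d: "d > 0" "ball q0 d \<subseteq> X0" using X0 open_contains_ball by blast
  show "\<exists>d>0. \<forall>q\<in>K \<times> {0..}. dist q q0 < d \<longrightarrow>
     dist (case q of (x, t) \<Rightarrow> avg (\<lambda>a. g (u x (t - a)))) (case q0 of (x, t) \<Rightarrow> avg (\<lambda>a. g (u x (t - a)))) < e"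
  proof (intro exI[of _ d] conjI ballI impI d(1))
    fix q assume q: "q \<in> K \<times> {0..}" "dist q q0 < d"
    have "q \<in> X0" using q(2) d(2) by (auto simp: dist_commute)
    then have "\<bar>avg (\<lambda>a. g (u (fst q) (snd q - a))) - avg (\<lambda>a. g (u (fst q0) (snd q0 - a)))\<bar> \<le> e / 2"
      using b q(1) q0 by (intro avg_abs_diff_le continuous_on_g_history[OF u]) (auto simp: dist_real_def)
    then show "dist (case q of (x, t) \<Rightarrow> avg (\<lambda>a. g (u x (t - a)))) (case q0 of (x, t) \<Rightarrow> avg (\<lambda>a. g (u x (t - a)))) < e"
      using e by (simp add: case_prod_beta' dist_real_def)
  qed
qed

lemma continuous_on_rhs:
  assumes u: "continuous_on (K \<times> {-\<tau>..}) (\<lambda>(x, t). u x t)"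
  shows "continuous_on (K \<times> {0..}) (\<lambda>(x, t). rhs u x t)"
proof -
  have "continuous_on (K \<times> {0..}) (\<lambda>(x, t). u x t)" by (rule continuous_on_subset[OF u]) (use tau_pos in auto)
  then have "continuous_on (K \<times> {0..}) (\<lambda>q. u (fst q) (snd q))" by (simp add: case_prod_beta')
  from continuous_on_compose2[OF continuous_on_f[of UNIV] this] continuous_on_avg_history[OF u]
  show ?thesis unfolding rhs_def case_prod_beta' by (auto intro!: continuous_intros)
qed

lemma solution_continuous:
  assumes "solution u"
  shows "continuous_on (K \<times> {-\<tau>..}) (\<lambda>(x, t). u x t)" and "a \<ge> 0 \<Longrightarrow> continuous_on (K \<times> {a..}) (\<lambda>(x, t). u x t)"
    and "t \<ge> 0 \<Longrightarrow> continuous_on K (\<lambda>y. u y t)" and "t \<ge> 0 \<Longrightarrow> continuous_on K (\<lambda>y. rhs u y t)"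
    and "t \<ge> 0 \<Longrightarrow> euler_consistent u (rhs u) t"
proof -
  show u: "continuous_on (K \<times> {-\<tau>..}) (\<lambda>(x, t). u x t)" using assms unfolding solution_def by simp
  show "a \<ge> 0 \<Longrightarrow> continuous_on (K \<times> {a..}) (\<lambda>(x, t). u x t)" by (rule continuous_on_subset[OF u]) (use tau_pos in auto)
  show "t \<ge> 0 \<Longrightarrow> continuous_on K (\<lambda>y. u y t)" using jointly_continuous_slice[OF u, of t] tau_pos by simp
  show "t \<ge> 0 \<Longrightarrow> continuous_on K (\<lambda>y. rhs u y t)" using jointly_continuous_slice[OF continuous_on_rhs[OF u], of t] by simp
  show "t \<ge> 0 \<Longrightarrow> euler_consistent u (rhs u) t" using assms unfolding solution_def by simp
qed

lemma solution_mild: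
  assumes ms: "mild_solution \<Omega> T f g h \<tau> \<phi> u" and K: "K = closure \<Omega>"
  shows "solution u"
proof -
  have cu: "continuous_on (K \<times> {-\<tau>..}) (\<lambda>(x, t). u x t)"
    and u0: "\<And>x. x \<in> K \<Longrightarrow> u x 0 = \<phi> x 0"
    and eq: "\<And>x t. x \<in> K \<Longrightarrow> t \<ge> 0 \<Longrightarrow> u x t = T t (\<lambda>y. \<phi> y 0) x +
                integral {0..t} (\<lambda>s. T (t - s) (reaction f g h \<tau> (segment u s)) x)"
    using ms tau_pos unfolding mild_solution_def K by auto
  have r: "reaction f g h \<tau> (segment u s) = (\<lambda>y. rhs u y s)" for s
    by (rule ext) (simp add: reaction_def segment_def rhs_def avg_def)
  have c0: "continuous_on K (\<lambda>y. \<phi> y 0)"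
    using jointly_continuous_slice[OF cu, of 0] tau_pos u0 by (simp cong: continuous_on_cong)
  have cu0: "continuous_on (K \<times> {0..}) (\<lambda>(x, t). u x t)" by (rule continuous_on_subset[OF cu]) (use tau_pos in auto)
  show ?thesis unfolding solution_def
    using cu euler_consistent_mild[OF continuous_on_rhs[OF cu] c0 eq[unfolded r] cu0] by blast
qed

text \<open>For \<open>d L \<le> 1\<close> the map \<open>s \<mapsto> s - d f s\<close> is nondecreasing. Hence \<open>u - d f u\<close> may be replaced
  by its value at the barrier also where \<open>u\<close> lies far below the barrier.\<close>

lemma solution_upper_barrier:
  assumes u: "solution u" and a: "a \<ge> 0" and der: "\<And>t. t \<ge> a \<Longrightarrow> (\<beta> has_real_derivative \<beta>' t) (at t)"
    and init: "\<And>x. x \<in> K \<Longrightarrow> u x a \<le> \<beta> a"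
    and super: "\<And>t. a \<le> t \<Longrightarrow> (\<And>s x. a \<le> s \<Longrightarrow> s \<le> t \<Longrightarrow> x \<in> K \<Longrightarrow> u x s \<le> \<beta> s) \<Longrightarrow>
      \<exists>q. (\<forall>x\<in>K. avg (\<lambda>b. g (u x (t - b))) \<le> q) \<and> - f (\<beta> t) + q < \<beta>' t"
    and t: "a \<le> t" and x: "x \<in> K"
  shows "u x t \<le> \<beta> t"
proof (rule comparison[OF solution_continuous(2)[OF u a] solution_continuous(4)[OF u] a solution_continuous(5)[OF u] der init _ t x])
  fix t assume t: "a \<le> t" and hist: "\<And>s x. a \<le> s \<Longrightarrow> s \<le> t \<Longrightarrow> x \<in> K \<Longrightarrow> u x s \<le> \<beta> s"
  obtain q where q: "\<And>x. x \<in> K \<Longrightarrow> avg (\<lambda>b. g (u x (t - b))) \<le> q" "- f (\<beta> t) + q < \<beta>' t"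
    using super[OF t hist] by blast
  show "\<exists>q<\<beta>' t. \<exists>d>0. \<forall>h. 0 < h \<and> h < d \<longrightarrow> (\<forall>y\<in>K. u y t + h * rhs u y t \<le> \<beta> t + h * q)"
  proof (rule exI[of _ "- f (\<beta> t) + q"], intro conjI q(2) exI[of _ "1 / L"] allI impI ballI)
    fix d y assume "0 < d \<and> d < 1 / L" and y: "y \<in> K"
    then have d: "0 < d" "d * L \<le> 1" using L_pos by (simp_all add: field_simps)
    have le: "u y t \<le> \<beta> t" by (rule hist) (use t y in auto)
    have "f (\<beta> t) - f (u y t) \<le> L * (\<beta> t - u y t)" using f_lip[of "\<beta> t" "u y t"] le by simp
    then have "d * (f (\<beta> t) - f (u y t)) \<le> d * (L * (\<beta> t - u y t))" using d by simp
    also have "\<dots> \<le> 1 * (\<beta> t - u y t)" using mult_right_mono[OF d(2), of "\<beta> t - u y t"] le by (simp add: mult.assoc)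
    finally have "u y t - d * f (u y t) \<le> \<beta> t - d * f (\<beta> t)" by (simp add: algebra_simps)
    moreover have "d * avg (\<lambda>b. g (u y (t - b))) \<le> d * q" using q(1)[OF y] d by simp
    ultimately show "u y t + d * rhs u y t \<le> \<beta> t + d * (- f (\<beta> t) + q)" by (simp add: rhs_def algebra_simps)
  qed (use L_pos in simp)
qed (use a in auto)

text \<open>Everything about lower bounds follows by the reflection \<open>u \<mapsto> - u\<close>.\<close>

lemma reflected_delay_equation: "delay_equation K T h \<tau> (\<lambda>s. - f (- s)) (\<lambda>s. - g (- s)) L"
proof (unfold_locales)
  show "\<bar>- f (- r) - - f (- s)\<bar> \<le> L * \<bar>r - s\<bar>" "\<bar>- g (- r) - - g (- s)\<bar> \<le> L * \<bar>r - s\<bar>" for r s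
    using f_lip[of "- s" "- r"] g_lip[of "- s" "- r"] by (simp_all add: abs_minus_commute)
qed (rule L_pos)

lemma reflected_solution:
  assumes u: "solution u"
  shows "delay_equation.solution K T h \<tau> (\<lambda>s. - f (- s)) (\<lambda>s. - g (- s)) (\<lambda>x t. - u x t)"
proof -
  interpret r: delay_equation K T h \<tau> "\<lambda>s. - f (- s)" "\<lambda>s. - g (- s)" L by (rule reflected_delay_equation)
  have "r.rhs (\<lambda>x t. - u x t) = (\<lambda>x t. - rhs u x t)"
    by (intro ext) (simp add: r.rhs_def rhs_def avg_minus)
  moreover have "continuous_on (K \<times> {-\<tau>..}) (\<lambda>(x, t). - u x t)"
    using solution_continuous(1)[OF u] by (auto simp: case_prod_beta' intro!: continuous_intros)
  moreover have "euler_consistent (\<lambda>x t. - u x t) (\<lambda>x t. - rhs u x t) t" if "t \<ge> 0" for t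
    by (rule euler_consistent_minus[OF solution_continuous(5)[OF u that] solution_continuous(3)[OF u] solution_continuous(4)[OF u]])
  ultimately show ?thesis unfolding r.solution_def by simp
qed

lemma solution_lower_barrier:
  assumes u: "solution u" and a: "a \<ge> 0" and der: "\<And>t. t \<ge> a \<Longrightarrow> (\<alpha> has_real_derivative \<alpha>' t) (at t)"
    and init: "\<And>x. x \<in> K \<Longrightarrow> \<alpha> a \<le> u x a"
    and sub: "\<And>t. a \<le> t \<Longrightarrow> (\<And>s x. a \<le> s \<Longrightarrow> s \<le> t \<Longrightarrow> x \<in> K \<Longrightarrow> \<alpha> s \<le> u x s) \<Longrightarrow>
      \<exists>q. (\<forall>x\<in>K. q \<le> avg (\<lambda>b. g (u x (t - b)))) \<and> \<alpha>' t < - f (\<alpha> t) + q"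
    and t: "a \<le> t" and x: "x \<in> K"
  shows "\<alpha> t \<le> u x t"
proof -
  interpret r: delay_equation K T h \<tau> "\<lambda>s. - f (- s)" "\<lambda>s. - g (- s)" L by (rule reflected_delay_equation)
  have "- u x t \<le> - \<alpha> t"
  proof (rule r.solution_upper_barrier[OF reflected_solution[OF u] a, where \<beta> = "\<lambda>t. - \<alpha> t" and \<beta>' = "\<lambda>t. - \<alpha>' t"])
    show "((\<lambda>t. - \<alpha> t) has_real_derivative - \<alpha>' t) (at t)" if "t \<ge> a" for t
      using der[OF that] by (rule DERIV_minus)
    fix t assume t: "a \<le> t" and "\<And>s x. a \<le> s \<Longrightarrow> s \<le> t \<Longrightarrow> x \<in> K \<Longrightarrow> - u x s \<le> - \<alpha> s"
    then have hist: "\<And>s x. a \<le> s \<Longrightarrow> s \<le> t \<Longrightarrow> x \<in> K \<Longrightarrow> \<alpha> s \<le> u x s" by simp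
    obtain q where q: "\<forall>x\<in>K. q \<le> avg (\<lambda>b. g (u x (t - b)))" "\<alpha>' t < - f (\<alpha> t) + q" using sub[OF t hist] by blast
    show "\<exists>q. (\<forall>x\<in>K. avg (\<lambda>b. - g (- (- u x (t - b)))) \<le> q) \<and> - (- f (- (- \<alpha> t))) + q < - \<alpha>' t"
      by (rule exI[of _ "- q"]) (use q in \<open>simp add: avg_minus\<close>)
  qed (use init t x in auto)
  then show ?thesis by simp
qed

text \<open>Comparison with the exponential \<open>C exp (l (t - a))\<close>. A large positive rate \<open>l\<close> gives uniqueness, a small
negative one stability.\<close>

lemma solution_diff_barrier:
  assumes w: "continuous_on (K \<times> {a..}) (\<lambda>(x, t). w x t)" "\<And>t. t \<ge> a \<Longrightarrow> continuous_on K (\<lambda>y. R y t)" "a \<ge> 0"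
      "\<And>t. t \<ge> a \<Longrightarrow> euler_consistent w R t"
    and t: "a \<le> t" "x \<in> K" and C: "C > 0"
    and init: "\<And>x. x \<in> K \<Longrightarrow> \<bar>w x a\<bar> \<le> C"
    and d0: "d0 > 0" and k: "k < l"
    and slope: "\<And>t h y. a \<le> t \<Longrightarrow> (\<And>s x. a \<le> s \<Longrightarrow> s \<le> t \<Longrightarrow> x \<in> K \<Longrightarrow> \<bar>w x s\<bar> \<le> C * exp (l * (s - a))) \<Longrightarrow>
       0 < h \<Longrightarrow> h < d0 \<Longrightarrow> y \<in> K \<Longrightarrow> \<bar>w y t + h * R y t\<bar> \<le> C * exp (l * (t - a)) * (1 + h * k)"
  shows "\<bar>w x t\<bar> \<le> C * exp (l * (t - a))"
proof (rule comparison_abs[OF w _ _ _ t, where \<beta>' = "\<lambda>t. l * (C * exp (l * (t - a)))"])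
  show "((\<lambda>t. C * exp (l * (t - a))) has_real_derivative l * (C * exp (l * (t - a)))) (at t)" for t
    by (auto intro!: derivative_eq_intros)
  show "\<bar>w x a\<bar> \<le> C * exp (l * (a - a))" if "x \<in> K" for x using init[OF that] by simp
  fix t assume t: "a \<le> t" and hist: "\<And>s x. a \<le> s \<Longrightarrow> s \<le> t \<Longrightarrow> x \<in> K \<Longrightarrow> \<bar>w x s\<bar> \<le> C * exp (l * (s - a))"
  show "\<exists>q<l * (C * exp (l * (t - a))). \<exists>d>0. \<forall>h. 0 < h \<and> h < d \<longrightarrow> (\<forall>y\<in>K. \<bar>w y t + h * R y t\<bar> \<le> C * exp (l * (t - a)) + h * q)"
  proof (rule exI[of _ "k * (C * exp (l * (t - a)))"], intro conjI exI[of _ d0] d0 allI impI ballI)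
    show "k * (C * exp (l * (t - a))) < l * (C * exp (l * (t - a)))" using k C by simp
    fix h y assume "0 < h \<and> h < d0" "y \<in> K"
    then show "\<bar>w y t + h * R y t\<bar> \<le> C * exp (l * (t - a)) + h * (k * (C * exp (l * (t - a))))"
      using slope[OF t hist, of h y] by (simp add: algebra_simps)
  qed
qed

text \<open>The right-hand side has Lipschitz constant \<open>2 L\<close> with respect to the supremum over the past, so the difference
of two solutions is below \<open>C exp ((2 L + 1) t)\<close> for every \<open>C > 0\<close>.\<close>

lemma solution_unique:
  assumes u: "solution u" and v: "solution v" and eq: "\<And>x t. x \<in> K \<Longrightarrow> t \<in> {-\<tau>..0} \<Longrightarrow> u x t = v x t"
    and t: "t \<ge> 0" and x: "x \<in> K"
  shows "u x t = v x t"
proof -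
  have "\<bar>u x t - v x t\<bar> \<le> e" if e: "e > 0" for e
  proof -
    define C where "C = e / exp ((2 * L + 1) * (t - 0))"
    have C: "C > 0" using e by (simp add: C_def)
    have "\<bar>u x t - v x t\<bar> \<le> C * exp ((2 * L + 1) * (t - 0))"
    proof (rule solution_diff_barrier[where w = "\<lambda>x t. u x t - v x t" and R = "\<lambda>x t. rhs u x t - rhs v x t" and ?d0.0 = 1 and k = "2 * L", OF _ _ _ _ t x C])
      show "continuous_on (K \<times> {0..}) (\<lambda>(x, t). u x t - v x t)"
        using solution_continuous(2)[OF u, of 0] solution_continuous(2)[OF v, of 0]
        by (auto simp: case_prod_beta' intro!: continuous_intros)
      show "continuous_on K (\<lambda>y. rhs u y t - rhs v y t)" if "t \<ge> 0" for t
        by (intro continuous_intros solution_continuous(4) u v that)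
      show "euler_consistent (\<lambda>x t. u x t - v x t) (\<lambda>x t. rhs u x t - rhs v x t) t" if "t \<ge> 0" for t
        by (intro euler_consistent_diff solution_continuous(3-5) u v that)
      show "\<bar>u x 0 - v x 0\<bar> \<le> C" if "x \<in> K" for x using eq[OF that, of 0] C tau_pos by simp
      fix t h :: real and y
      assume t: "0 \<le> t" and hist: "\<And>s x. 0 \<le> s \<Longrightarrow> s \<le> t \<Longrightarrow> x \<in> K \<Longrightarrow> \<bar>u x s - v x s\<bar> \<le> C * exp ((2 * L + 1) * (s - 0))"
        and h: "0 < h" and y: "y \<in> K"
      define E where "E = C * exp ((2 * L + 1) * (t - 0))"
      have hist': "\<bar>u y s - v y s\<bar> \<le> E" if s: "- \<tau> \<le> s" "s \<le> t" for s
      proof (cases "s \<ge> 0")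
        case True
        have "C * exp ((2 * L + 1) * (s - 0)) \<le> E" unfolding E_def using s C L_pos by simp
        then show ?thesis using hist[OF True s(2) y] by linarith
      qed (use eq[OF y, of s] s C in \<open>simp add: E_def\<close>)
      have 1: "\<bar>f (u y t) - f (v y t)\<bar> \<le> L * E"
        using f_lip[of "u y t" "v y t"] mult_left_mono[OF hist'[of t], of L] t tau_pos L_pos by linarith
      have 2: "\<bar>avg (\<lambda>a. g (u y (t - a))) - avg (\<lambda>a. g (v y (t - a)))\<bar> \<le> L * E"
      proof (rule avg_abs_diff_le[OF continuous_on_g_history[OF solution_continuous(1)[OF u] y t] continuous_on_g_history[OF solution_continuous(1)[OF v] y t]])
        fix a assume "a \<in> {0..\<tau>}"
        then have "L * \<bar>u y (t - a) - v y (t - a)\<bar> \<le> L * E" using t L_pos by (intro mult_left_mono hist') auto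
        then show "\<bar>g (u y (t - a)) - g (v y (t - a))\<bar> \<le> L * E" using g_lip[of "u y (t - a)" "v y (t - a)"] by linarith
      qed
      have "\<bar>rhs u y t - rhs v y t\<bar> \<le> 2 * L * E" unfolding rhs_def using 1 2 by (simp add: abs_le_iff)
      then have "h * \<bar>rhs u y t - rhs v y t\<bar> \<le> h * (2 * L * E)" using h by simp
      moreover have "\<bar>u y t - v y t\<bar> \<le> E" using hist'[of t] t tau_pos by simp
      ultimately have "\<bar>u y t - v y t + h * (rhs u y t - rhs v y t)\<bar> \<le> E + h * (2 * L * E)"
        using abs_triangle_ineq[of "u y t - v y t" "h * (rhs u y t - rhs v y t)"]
        unfolding abs_mult abs_of_pos[OF h] by linarith
      then show "\<bar>u y t - v y t + h * (rhs u y t - rhs v y t)\<bar> \<le> C * exp ((2 * L + 1) * (t - 0)) * (1 + h * (2 * L))"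
        unfolding E_def by (simp add: algebra_simps)
    qed auto
    then show ?thesis by (simp add: C_def)
  qed
  then have "\<bar>u x t - v x t\<bar> \<le> 0 + e" if "e > 0" for e using that by simp
  then have "\<bar>u x t - v x t\<bar> \<le> 0" by (rule field_le_epsilon)
  then show ?thesis by simp
qed

text \<open>Halanay's argument: near an equilibrium at which the instantaneous damping beats the delayed
  feedback, an exponential of sufficiently small rate is a strict supersolution.\<close>

lemma solution_exponential_decay:
  assumes u: "solution u" and a: "a \<ge> 0" and r: "r > 0"
    and near: "\<And>t x. t \<ge> a \<Longrightarrow> x \<in> K \<Longrightarrow> \<bar>u x t - c\<bar> \<le> r"
    and fc: "f c = g c" and k: "0 \<le> k'" "k' < k"
    and f_exp: "\<And>s. \<bar>s - c\<bar> \<le> r \<Longrightarrow> (f s - f c) * (s - c) \<ge> k * (s - c)\<^sup>2"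
    and g_contr: "\<And>s. \<bar>s - c\<bar> \<le> r \<Longrightarrow> \<bar>g s - g c\<bar> \<le> k' * \<bar>s - c\<bar>"
  shows "\<exists>C>0. \<exists>\<gamma>>0. \<forall>t\<ge>0. \<forall>x\<in>K. \<bar>u x t - c\<bar> \<le> C * exp (- \<gamma> * t)"
proof -
  have cu: "continuous_on (K \<times> {-\<tau>..}) (\<lambda>(x, t). u x t)" by (rule solution_continuous(1)[OF u])
  have "((\<lambda>\<gamma>. - k + k' * exp (\<gamma> * \<tau>) + \<gamma>) \<longlongrightarrow> - k + k' * exp (0 * \<tau>) + 0) (at_right 0)" by (intro tendsto_intros)
  then have "\<forall>\<^sub>F \<gamma> in at_right 0. - k + k' * exp (\<gamma> * \<tau>) + \<gamma> < 0" by (rule order_tendstoD) (use k in simp)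
  then have "\<forall>\<^sub>F \<gamma>::real in at_right 0. - k + k' * exp (\<gamma> * \<tau>) + \<gamma> < 0 \<and> 0 < \<gamma>"
    using eventually_at_right_less by (rule eventually_conj)
  then obtain \<gamma> where g: "- k + k' * exp (\<gamma> * \<tau>) + \<gamma> < 0" "\<gamma> > 0"
    using eventually_happens' trivial_limit_at_right_real by blast
  define b where "b = a + \<tau>"
  have b: "b \<ge> 0" "b \<ge> a" using a tau_pos by (auto simp: b_def)
  have decay: "\<bar>u x t - c\<bar> \<le> r * exp (- \<gamma> * (t - b))" if t: "t \<ge> b" and x: "x \<in> K" for t x
  proof (rule solution_diff_barrier[where w = "\<lambda>x t. u x t - c" and R = "rhs u" and ?d0.0 = "1 / L" and k = "- k + k' * exp (\<gamma> * \<tau>)", OF _ _ b(1) _ t x r])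
    show "continuous_on (K \<times> {b..}) (\<lambda>(x, t). u x t - c)"
      using solution_continuous(2)[OF u b(1)] by (auto simp: case_prod_beta' intro!: continuous_intros)
    show "continuous_on K (\<lambda>y. rhs u y t)" if "t \<ge> b" for t by (rule solution_continuous(4)[OF u]) (use that b in simp)
    show "euler_consistent (\<lambda>x t. u x t - c) (rhs u) t" if "t \<ge> b" for t
      by (intro euler_consistent_minus_const solution_continuous(3-5)[OF u]) (use that b in auto)
    show "\<bar>u x b - c\<bar> \<le> r" if "x \<in> K" for x using near that b by simp
    show "- k + k' * exp (\<gamma> * \<tau>) < - \<gamma>" using g(1) by simp
    fix t d y
    assume t: "b \<le> t" and hist: "\<And>s x. b \<le> s \<Longrightarrow> s \<le> t \<Longrightarrow> x \<in> K \<Longrightarrow> \<bar>u x s - c\<bar> \<le> r * exp (- \<gamma> * (s - b))"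
      and d: "0 < d" "d < 1 / L" and y: "y \<in> K"
    define E where "E = r * exp (- \<gamma> * (t - b))"
    have t0: "t \<ge> 0" "t \<ge> a" using t b by auto
    \<comment> \<open>before time \<open>b\<close> the factor \<open>exp (- \<gamma> * (s - b))\<close> is at least \<open>1\<close>\<close>
    have window: "\<bar>u y s - c\<bar> \<le> E * exp (\<gamma> * \<tau>)" if s: "t - \<tau> \<le> s" "s \<le> t" for s
    proof -
      have "\<bar>u y s - c\<bar> \<le> r * exp (- \<gamma> * (s - b))"
      proof (cases "b \<le> s")
        case True then show ?thesis using hist[OF _ s(2) y] by blast
      next
        case False
        then have "1 \<le> exp (- \<gamma> * (s - b))" using g(2) by (simp add: mult_nonneg_nonpos)
        then have "r * 1 \<le> r * exp (- \<gamma> * (s - b))" using r by (intro mult_left_mono) auto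
        moreover have "\<bar>u y s - c\<bar> \<le> r" by (rule near) (use s t y in \<open>auto simp: b_def\<close>)
        ultimately show ?thesis by linarith
      qed
      also have "\<dots> \<le> r * exp (- \<gamma> * (t - \<tau> - b))"
      proof (rule mult_left_mono)
        have "\<gamma> * (t - \<tau> - b) \<le> \<gamma> * (s - b)" using s g(2) by (intro mult_left_mono) auto
        then show "exp (- \<gamma> * (s - b)) \<le> exp (- \<gamma> * (t - \<tau> - b))" by simp
      qed (use r in simp)
      also have "\<dots> = E * exp (\<gamma> * \<tau>)" by (simp add: E_def exp_add[symmetric] algebra_simps)
      finally show ?thesis .
    qed
    have feedback: "\<bar>avg (\<lambda>a. g (u y (t - a))) - g c\<bar> \<le> k' * (E * exp (\<gamma> * \<tau>))"
    proof -
      have "\<bar>avg (\<lambda>a. g (u y (t - a))) - avg (\<lambda>_. g c)\<bar> \<le> k' * (E * exp (\<gamma> * \<tau>))"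
      proof (rule avg_abs_diff_le[OF continuous_on_g_history[OF cu y t0(1)]])
        fix s assume s: "s \<in> {0..\<tau>}"
        have "\<bar>u y (t - s) - c\<bar> \<le> r" by (rule near) (use s t y in \<open>auto simp: b_def\<close>)
        then have "\<bar>g (u y (t - s)) - g c\<bar> \<le> k' * \<bar>u y (t - s) - c\<bar>" by (rule g_contr)
        also have "\<dots> \<le> k' * (E * exp (\<gamma> * \<tau>))" using s k by (intro mult_left_mono window) auto
        finally show "\<bar>g (u y (t - s)) - g c\<bar> \<le> k' * (E * exp (\<gamma> * \<tau>))" .
      qed simp
      then show ?thesis by (simp add: avg_const)
    qed
    have damping: "\<bar>(u y t - c) - d * (f (u y t) - f c)\<bar> \<le> (1 - d * k) * \<bar>u y t - c\<bar>"
    proof (cases "u y t = c")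
      case False
      define p where "p = (f (u y t) - f c) / (u y t - c)"
      have fp: "f (u y t) - f c = p * (u y t - c)" using False by (simp add: p_def)
      have "k * (u y t - c)\<^sup>2 \<le> p * (u y t - c)\<^sup>2"
        using f_exp[OF near[OF t0(2) y]] unfolding fp by (simp add: power2_eq_square mult.assoc)
      then have "k \<le> p" using False by simp
      moreover have "\<bar>p\<bar> * \<bar>u y t - c\<bar> \<le> L * \<bar>u y t - c\<bar>" using f_lip[of "u y t" c] unfolding fp by (simp add: abs_mult)
      then have "p \<le> L" using False by (simp add: abs_le_iff)
      moreover have "d * L \<le> 1" using d L_pos by (simp add: field_simps)
      moreover from calculation have "d * p \<le> d * L" "d * k \<le> d * p" using d by (auto intro: mult_left_mono)
      ultimately have "d * k \<le> d * p" "d * p \<le> 1" by linarith+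
      then have "\<bar>1 - d * p\<bar> \<le> 1 - d * k" by simp
      moreover have "(u y t - c) - d * (f (u y t) - f c) = (1 - d * p) * (u y t - c)" unfolding fp by (simp add: algebra_simps)
      ultimately show ?thesis by (simp add: abs_mult mult_right_mono)
    qed simp
    have dk: "1 - d * k \<ge> 0"
    proof -
      have s: "\<bar>(c + r) - c\<bar> \<le> r" using r by simp
      have "k * r\<^sup>2 \<le> (f (c + r) - f c) * r" using f_exp[OF s] by simp
      also have "\<dots> \<le> (L * r) * r" using f_lip[of "c + r" c] r by (intro mult_right_mono) auto
      finally have "k \<le> L" using r by (simp add: power2_eq_square)
      then have "d * k \<le> d * L" using d by simp
      also have "\<dots> \<le> 1" using d L_pos by (simp add: field_simps)
      finally show ?thesis by simp
    qed
    have uE: "\<bar>u y t - c\<bar> \<le> E" unfolding E_def using hist[OF t _ y] by simp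
    have "u y t - c + d * rhs u y t = ((u y t - c) - d * (f (u y t) - f c)) + d * (avg (\<lambda>a. g (u y (t - a))) - g c)"
      by (simp add: rhs_def fc algebra_simps)
    then have "\<bar>u y t - c + d * rhs u y t\<bar> \<le> (1 - d * k) * \<bar>u y t - c\<bar> + d * \<bar>avg (\<lambda>a. g (u y (t - a))) - g c\<bar>"
      using damping d abs_triangle_ineq[of "(u y t - c) - d * (f (u y t) - f c)" "d * (avg (\<lambda>a. g (u y (t - a))) - g c)"]
      by (simp add: abs_mult)
    also have "\<dots> \<le> (1 - d * k) * E + d * (k' * (E * exp (\<gamma> * \<tau>)))"
      using uE dk feedback d by (intro add_mono mult_left_mono) auto
    also have "\<dots> = r * exp (- \<gamma> * (t - b)) * (1 + d * (- k + k' * exp (\<gamma> * \<tau>)))"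
      unfolding E_def by (simp add: algebra_simps)
    finally show "\<bar>u y t - c + d * rhs u y t\<bar> \<le> r * exp (- \<gamma> * (t - b)) * (1 + d * (- k + k' * exp (\<gamma> * \<tau>)))" .
  qed (use L_pos in simp)
  \<comment> \<open>on the compact initial interval any bound will do\<close>
  have "K \<times> {0..b} \<subseteq> K \<times> {-\<tau>..}" using tau_pos by auto
  from continuous_on_subset[OF cu this] have "continuous_on (K \<times> {0..b}) (\<lambda>(x, t). u x t - c)"
    by (auto simp: case_prod_beta' intro!: continuous_intros)
  then have "compact ((\<lambda>(x, t). u x t - c) ` (K \<times> {0..b}))" by (intro compact_continuous_image compact_Times compact_K) auto
  then have "bounded ((\<lambda>(x, t). u x t - c) ` (K \<times> {0..b}))" by (rule compact_imp_bounded)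
  then obtain m where m: "m > 0" and "\<forall>y\<in>(\<lambda>(x, t). u x t - c) ` (K \<times> {0..b}). norm y \<le> m"
    unfolding bounded_pos by blast
  then have m_bound: "\<bar>u x t - c\<bar> \<le> m" if "x \<in> K" "t \<in> {0..b}" for x t using that by force
  show ?thesis
  proof (rule exI[of _ "(m + r) * exp (\<gamma> * b)"], intro conjI exI[of _ \<gamma>] allI impI ballI)
    fix t x assume t: "(0::real) \<le> t" and x: "x \<in> K"
    have e: "(m + r) * exp (\<gamma> * b) * exp (- \<gamma> * t) = (m + r) * exp (- \<gamma> * (t - b))"
      by (simp add: exp_add[symmetric] algebra_simps)
    show "\<bar>u x t - c\<bar> \<le> (m + r) * exp (\<gamma> * b) * exp (- \<gamma> * t)"
    proof (cases "t \<ge> b")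
      case True
      have "r * exp (- \<gamma> * (t - b)) \<le> (m + r) * exp (- \<gamma> * (t - b))" using m by (intro mult_right_mono) auto
      then show ?thesis unfolding e using decay[OF True x] by linarith
    next
      case False
      then have "1 \<le> exp (- \<gamma> * (t - b))" using g(2) by (simp add: mult_nonneg_nonpos)
      then have "(m + r) * 1 \<le> (m + r) * exp (- \<gamma> * (t - b))" using m r by (intro mult_left_mono) auto
      then show ?thesis unfolding e using m_bound[OF x, of t] t False r by simp
    qed
  qed (use m r g in auto)
qed

end

section \<open>Asymptotic bounds\<close>

definition eventually_le :: "'a set \<Rightarrow> ('a \<Rightarrow> real \<Rightarrow> real) \<Rightarrow> real \<Rightarrow> bool" where
  "eventually_le K u c \<longleftrightarrow> (\<exists>t0\<ge>0. \<forall>t\<ge>t0. \<forall>x\<in>K. u x t \<le> c)"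

definition upper_limit :: "'a set \<Rightarrow> ('a \<Rightarrow> real \<Rightarrow> real) \<Rightarrow> real" where
  "upper_limit K u = Inf {c. eventually_le K u c}"

text \<open>Defined by reflection, so that facts about the upper limit carry over.\<close>

definition lower_limit :: "'a set \<Rightarrow> ('a \<Rightarrow> real \<Rightarrow> real) \<Rightarrow> real" where
  "lower_limit K u = - upper_limit K (\<lambda>x t. - u x t)"

lemma upper_limit_le:
  assumes "K \<noteq> {}" and lo: "\<And>t x. t \<ge> 0 \<Longrightarrow> x \<in> K \<Longrightarrow> lo \<le> u x t" and c: "eventually_le K u c"
  shows "upper_limit K u \<le> c"
  unfolding upper_limit_def
proof (rule cInf_lower)
  show "bdd_below {c. eventually_le K u c}"
  proof (rule bdd_belowI[of _ lo])
    fix c assume "c \<in> {c. eventually_le K u c}"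
    then obtain t0 where t0: "t0 \<ge> 0" "\<And>t x. t \<ge> t0 \<Longrightarrow> x \<in> K \<Longrightarrow> u x t \<le> c" unfolding eventually_le_def by blast
    obtain x where "x \<in> K" using \<open>K \<noteq> {}\<close> by blast
    then show "lo \<le> c" using lo[OF t0(1), of x] t0(2)[of t0 x] by simp
  qed
qed (use c in simp)

lemma eventually_le_above_upper_limit:
  assumes hi: "\<And>t x. t \<ge> 0 \<Longrightarrow> x \<in> K \<Longrightarrow> u x t \<le> hi" and c: "upper_limit K u < c"
  shows "eventually_le K u c"
proof -
  have "hi \<in> {c. eventually_le K u c}" using hi unfolding eventually_le_def by auto
  then obtain b where "b \<in> {c. eventually_le K u c}" "b < c"
    using cInf_lessD[of "{c. eventually_le K u c}" c] c unfolding upper_limit_def by blast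
  then obtain t0 where "t0 \<ge> 0" "\<And>t x. t \<ge> t0 \<Longrightarrow> x \<in> K \<Longrightarrow> u x t \<le> b" unfolding eventually_le_def by blast
  then show ?thesis unfolding eventually_le_def using \<open>b < c\<close> by (intro exI[of _ t0]) force
qed

lemma eventually_between_limits:
  assumes lo: "\<And>t x. t \<ge> 0 \<Longrightarrow> x \<in> K \<Longrightarrow> lo \<le> u x t" and hi: "\<And>t x. t \<ge> 0 \<Longrightarrow> x \<in> K \<Longrightarrow> u x t \<le> hi" and e: "e > 0"
  shows "\<exists>t0\<ge>0. \<forall>t\<ge>t0. \<forall>x\<in>K. lower_limit K u - e \<le> u x t \<and> u x t \<le> upper_limit K u + e"
proof -
  have "eventually_le K u (upper_limit K u + e)"
    by (rule eventually_le_above_upper_limit[OF hi]) (use e in auto)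
  then obtain t1 where t1: "t1 \<ge> 0" "\<And>t x. t \<ge> t1 \<Longrightarrow> x \<in> K \<Longrightarrow> u x t \<le> upper_limit K u + e"
    unfolding eventually_le_def by blast
  have "eventually_le K (\<lambda>x t. - u x t) (- lower_limit K u + e)"
    by (rule eventually_le_above_upper_limit[where hi = "- lo"]) (use lo e in \<open>auto simp: lower_limit_def\<close>)
  then obtain t2 where t2: "t2 \<ge> 0" "\<And>t x. t \<ge> t2 \<Longrightarrow> x \<in> K \<Longrightarrow> - u x t \<le> - lower_limit K u + e"
    unfolding eventually_le_def by blast
  show ?thesis
  proof (intro exI[of _ "max t1 t2"] conjI allI impI ballI)
    fix t x assume "t \<ge> max t1 t2" "x \<in> K"
    then show "lower_limit K u - e \<le> u x t" "u x t \<le> upper_limit K u + e" using t1(2)[of t x] t2(2)[of t x] by auto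
  qed (use t1 in simp)
qed

lemma lower_limit_le_upper_limit:
  assumes "K \<noteq> {}" "\<And>t x. t \<ge> 0 \<Longrightarrow> x \<in> K \<Longrightarrow> lo \<le> u x t" "\<And>t x. t \<ge> 0 \<Longrightarrow> x \<in> K \<Longrightarrow> u x t \<le> hi"
  shows "lower_limit K u \<le> upper_limit K u"
proof (rule field_le_epsilon)
  fix e :: real assume "e > 0"
  then have "e / 2 > 0" by simp
  obtain t0 where t0: "t0 \<ge> 0" "\<And>t x. t \<ge> t0 \<Longrightarrow> x \<in> K \<Longrightarrow> lower_limit K u - e / 2 \<le> u x t"
    "\<And>t x. t \<ge> t0 \<Longrightarrow> x \<in> K \<Longrightarrow> u x t \<le> upper_limit K u + e / 2"
    using eventually_between_limits[where K = K and u = u, OF assms(2,3) \<open>e / 2 > 0\<close>] by blast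
  obtain x where "x \<in> K" using \<open>K \<noteq> {}\<close> by blast
  then show "lower_limit K u \<le> upper_limit K u + e" using t0(2)[of t0 x] t0(3)[of t0 x] by simp
qed

context delay_equation
begin

text \<open>If \<open>f\<close> exceeded \<open>q\<close> at the upper limit \<open>U\<close>, then the solution, once it is close to \<open>U\<close> from
  above, would be pushed below \<open>U\<close> at a fixed rate and would stay there.\<close>

lemma f_upper_limit_le:
  assumes u: "solution u" and lo: "\<And>t x. t \<ge> 0 \<Longrightarrow> x \<in> K \<Longrightarrow> lo \<le> u x t"
    and hi: "\<And>t x. t \<ge> 0 \<Longrightarrow> x \<in> K \<Longrightarrow> u x t \<le> hi"
    and q: "t0 \<ge> 0" "\<And>t x. t \<ge> t0 \<Longrightarrow> x \<in> K \<Longrightarrow> avg (\<lambda>a. g (u x (t - a))) \<le> q"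
  shows "f (upper_limit K u) \<le> q"
proof (rule ccontr)
  define U where "U = upper_limit K u"
  assume "\<not> f (upper_limit K u) \<le> q"
  then have gap: "f U > q" by (simp add: U_def)
  define n where "n = (f U - q) / 2"
  define e where "e = n / L"
  have n: "n > 0" using gap by (simp add: n_def)
  have e: "e > 0" "L * e = n" using n L_pos by (simp_all add: e_def)
  have f_near: "f s \<ge> q + n" if "\<bar>s - U\<bar> \<le> e" for s
  proof -
    have "L * \<bar>s - U\<bar> \<le> L * e" using that L_pos by simp
    then show ?thesis using f_lip[of s U] e(2) unfolding n_def by argo
  qed
  have "eventually_le K u (U + e)"
    by (rule eventually_le_above_upper_limit[OF hi]) (use e in \<open>auto simp: U_def\<close>)
  then obtain t1 where t1: "t1 \<ge> 0" "\<And>t x. t \<ge> t1 \<Longrightarrow> x \<in> K \<Longrightarrow> u x t \<le> U + e"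
    unfolding eventually_le_def by blast
  define t2 where "t2 = max t0 t1"
  have t2: "t2 \<ge> 0" "t2 \<ge> t0" "t2 \<ge> t1" using t1 by (auto simp: t2_def)
  define k where "k = n / (4 * e)"
  have k: "k > 0" "2 * e * k = n / 2" using n e(1) by (simp_all add: k_def)
  define \<beta> where "\<beta> t = U - e + 2 * e * exp (- k * (t - t2))" for t
  have barrier: "u x t \<le> \<beta> t" if t: "t \<ge> t2" and x: "x \<in> K" for t x
  proof (rule solution_upper_barrier[OF u t2(1) _ _ _ t x, where \<beta>' = "\<lambda>t. - (2 * e * k * exp (- k * (t - t2)))"])
    show "(\<beta> has_real_derivative - (2 * e * k * exp (- k * (t - t2)))) (at t)" for t
      unfolding \<beta>_def[abs_def] by (auto intro!: derivative_eq_intros)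
    show "u x t2 \<le> \<beta> t2" if "x \<in> K" for x using t1(2)[OF t2(3) that] by (simp add: \<beta>_def)
    fix t assume t: "t2 \<le> t"
    then have ex: "exp (- k * (t - t2)) \<le> 1" "exp (- k * (t - t2)) > 0" using k by simp_all
    have "2 * e * exp (- k * (t - t2)) \<le> 2 * e * 1" "2 * e * exp (- k * (t - t2)) > 0"
      using mult_left_mono[OF ex(1), of "2 * e"] mult_pos_pos[OF _ ex(2), of "2 * e"] e(1) by simp_all
    then have "\<bar>\<beta> t - U\<bar> \<le> e" unfolding \<beta>_def by simp
    then have "f (\<beta> t) \<ge> q + n" by (rule f_near)
    moreover have "2 * e * k * exp (- k * (t - t2)) \<le> n / 2" unfolding k(2) using mult_left_mono[OF ex(1), of "n / 2"] n by simp
    ultimately have "- f (\<beta> t) + q < - (2 * e * k * exp (- k * (t - t2)))" using n by linarith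
    then show "\<exists>q. (\<forall>x\<in>K. avg (\<lambda>b. g (u x (t - b))) \<le> q) \<and> - f (\<beta> t) + q < - (2 * e * k * exp (- k * (t - t2)))"
      using q(2) t t2(2) by (intro exI[of _ q]) auto
  qed
  have "eventually_le K u (U - e / 2)"
    unfolding eventually_le_def
  proof (intro exI[of _ "t2 + 3 / k"] conjI allI impI ballI)
    show "t2 + 3 / k \<ge> 0" using t2 k by simp
    fix t x assume t: "t2 + 3 / k \<le> t" and x: "x \<in> K"
    have "t2 \<le> t" using t k by (smt (verit) divide_nonneg_pos)
    have "3 \<le> k * (t - t2)" using t k by (simp add: field_simps)
    then have "4 \<le> exp (k * (t - t2))" using exp_ge_add_one_self[of "k * (t - t2)"] by linarith
    then have "exp (- k * (t - t2)) \<le> 1 / 4" by (simp add: exp_minus inverse_eq_divide divide_simps)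
    then have "2 * e * exp (- k * (t - t2)) \<le> 2 * e * (1 / 4)" using e(1) by (intro mult_left_mono) auto
    then show "u x t \<le> U - e / 2" using barrier[OF \<open>t2 \<le> t\<close> x] unfolding \<beta>_def by linarith
  qed
  from upper_limit_le[where K = K and u = u, OF K_nonempty lo this] have "U \<le> U - e / 2" unfolding U_def .
  then show False using e(1) by simp
qed

text \<open>After a long time all values in the delay interval lie within a small distance of \<open>[Lo, U]\<close>, with \<open>Lo\<close> and
\<open>U\<close> the two limits, so that the delayed term is at most slightly larger than the maximum of \<open>g\<close> on
\<open>[Lo, U]\<close>.\<close>

lemma f_upper_limit_le_max_g:
  assumes u: "solution u" and lo: "\<And>t x. t \<ge> 0 \<Longrightarrow> x \<in> K \<Longrightarrow> lo \<le> u x t"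
    and hi: "\<And>t x. t \<ge> 0 \<Longrightarrow> x \<in> K \<Longrightarrow> u x t \<le> hi"
    and q: "\<And>s. lower_limit K u \<le> s \<Longrightarrow> s \<le> upper_limit K u \<Longrightarrow> g s \<le> q"
  shows "f (upper_limit K u) \<le> q"
proof (rule field_le_epsilon)
  fix e' :: real assume "e' > 0"
  define e where "e = e' / L"
  have e: "e > 0" "L * e = e'" using \<open>e' > 0\<close> L_pos by (simp_all add: e_def)
  obtain t0 where t0: "t0 \<ge> 0" "\<And>t x. t \<ge> t0 \<Longrightarrow> x \<in> K \<Longrightarrow> lower_limit K u - e \<le> u x t"
    "\<And>t x. t \<ge> t0 \<Longrightarrow> x \<in> K \<Longrightarrow> u x t \<le> upper_limit K u + e"
    using eventually_between_limits[where K = K and u = u, OF lo hi e(1)] by blast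
  have le: "lower_limit K u \<le> upper_limit K u" by (rule lower_limit_le_upper_limit[OF K_nonempty lo hi])
  have t0_tau: "0 \<le> t0 + \<tau>" using t0(1) tau_pos by linarith
  show "f (upper_limit K u) \<le> q + e'"
  proof (rule f_upper_limit_le[OF u lo hi, of "t0 + \<tau>"])
    fix t x assume t: "t0 + \<tau> \<le> t" and x: "x \<in> K"
    show "avg (\<lambda>a. g (u x (t - a))) \<le> q + e'"
    proof (rule avg_le[OF continuous_on_g_history[OF solution_continuous(1)[OF u] x]])
      fix a assume a: "a \<in> {0..\<tau>}"
      define s where "s = u x (t - a)"
      define s' where "s' = max (lower_limit K u) (min (upper_limit K u) s)"
      have "lower_limit K u - e \<le> s" "s \<le> upper_limit K u + e"
        unfolding s_def using t0(2)[of "t - a" x] t0(3)[of "t - a" x] t a x by auto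
      then have "\<bar>s - s'\<bar> \<le> e" using le e(1) by (auto simp: s'_def)
      then have "L * \<bar>s - s'\<bar> \<le> e'" using e(2) L_pos by (metis mult_left_mono less_imp_le)
      moreover have "g s' \<le> q" by (rule q) (use le in \<open>auto simp: s'_def\<close>)
      ultimately show "g (u x (t - a)) \<le> q + e'" using g_lip[of s s'] unfolding s_def[symmetric] by linarith
    qed (use t t0 tau_pos in simp)
  qed (use t0_tau in auto)
qed

lemma f_lower_limit_ge_min_g:
  assumes u: "solution u" and lo: "\<And>t x. t \<ge> 0 \<Longrightarrow> x \<in> K \<Longrightarrow> lo \<le> u x t"
    and hi: "\<And>t x. t \<ge> 0 \<Longrightarrow> x \<in> K \<Longrightarrow> u x t \<le> hi"
    and q: "\<And>s. lower_limit K u \<le> s \<Longrightarrow> s \<le> upper_limit K u \<Longrightarrow> q \<le> g s"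
  shows "q \<le> f (lower_limit K u)"
proof -
  interpret r: delay_equation K T h \<tau> "\<lambda>s. - f (- s)" "\<lambda>s. - g (- s)" L by (rule reflected_delay_equation)
  have "- f (- upper_limit K (\<lambda>x t. - u x t)) \<le> - q"
  proof (rule r.f_upper_limit_le_max_g[OF reflected_solution[OF u], where lo = "- hi" and hi = "- lo"])
    fix s assume s: "lower_limit K (\<lambda>x t. - u x t) \<le> s" "s \<le> upper_limit K (\<lambda>x t. - u x t)"
    have "q \<le> g (- s)" by (rule q) (use s in \<open>simp_all add: lower_limit_def\<close>)
    then show "- g (- s) \<le> - q" by simp
  qed (use lo hi in auto)
  then show ?thesis by (simp add: lower_limit_def)
qed

section \<open>Positivity\<close>

text \<open>If \<open>u x\<close> vanished at time \<open>t\<close> in spite of a positive value within the preceding delay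
  interval, the delayed term would be a source that is strictly positive at \<open>(x, t)\<close>, and the Euler
  step ending at \<open>t\<close> would give a positive value.\<close>

lemma positive_history_imp_positive:
  assumes u: "solution u" and u0: "\<And>x t. x \<in> K \<Longrightarrow> t \<ge> - \<tau> \<Longrightarrow> 0 \<le> u x t"
    and g0: "f 0 = g 0" "\<And>s. s > 0 \<Longrightarrow> g s > g 0"
    and x: "x \<in> K" and t: "t > 0" and s: "t - \<tau> \<le> s" "s \<le> t" "u x s > 0"
  shows "u x t > 0"
proof (rule ccontr)
  assume "\<not> u x t > 0"
  then have ut: "u x t = 0" using u0[OF x, of t] t tau_pos by simp
  have cu: "continuous_on (K \<times> {-\<tau>..}) (\<lambda>(x, t). u x t)" by (rule solution_continuous(1)[OF u])
  have g_ge: "g s \<ge> g 0" if "s \<ge> 0" for s using g0(2)[of s] that by (cases "s = 0") auto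
  define Q where "Q y r = avg (\<lambda>a. g (u y (r - a))) - g 0" for y r
  have cQ: "continuous_on (K \<times> {0..}) (\<lambda>(y, r). Q y r)"
    using continuous_on_avg_history[OF cu] unfolding Q_def case_prod_beta' by (intro continuous_intros)
  have cQy: "continuous_on K (\<lambda>y. Q y r)" if "r \<ge> 0" for r using jointly_continuous_slice[OF cQ, of r] that by simp
  have Q0: "Q y r \<ge> 0" if "y \<in> K" "r \<ge> 0" for y r
    unfolding Q_def using avg_ge[OF continuous_on_g_history[OF cu that], of "g 0"] g_ge u0 that by auto
  have "Q x t > 0"
  proof -
    have c: "continuous_on {0..\<tau>} (\<lambda>a. g (u x (t - a)))" by (rule continuous_on_g_history[OF cu x]) (use t in simp)
    have "avg (\<lambda>a. g (u x (t - a)) - g 0) > 0"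
    proof (rule avg_pos)
      show "continuous_on {0..\<tau>} (\<lambda>a. g (u x (t - a)) - g 0)" by (intro continuous_intros c)
      show "0 \<le> g (u x (t - a)) - g 0" if "a \<in> {0..\<tau>}" for a using g_ge u0[OF x] that t by simp
      show "t - s \<in> {0..\<tau>}" using s by simp
      show "0 < g (u x (t - (t - s))) - g 0" using g0(2) s by simp
    qed
    then show ?thesis using avg_diff[OF c continuous_on_const] avg_const by (simp add: Q_def)
  qed
  define p where "p = Q x t"
  have p: "p > 0" using \<open>Q x t > 0\<close> by (simp add: p_def)
  have "continuous_on (K \<times> {0..t}) (\<lambda>(y, d). T d (\<lambda>z. Q z (t - d)) y)"
    by (rule continuous_on_T_curve'[OF cQ]) (auto intro!: continuous_intros)
  from continuous_on_time[OF this x] have cT: "continuous_on {0..t} (\<lambda>d. T d (\<lambda>z. Q z (t - d)) x)" .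
  have "T 0 (\<lambda>z. Q z (t - 0)) x = p" using T_0[OF cQy x, of t] t by (simp add: p_def)
  then obtain d1 where d1: "d1 > 0" "\<And>d. d \<in> {0..t} \<Longrightarrow> dist d 0 < d1 \<Longrightarrow> dist (T d (\<lambda>z. Q z (t - d)) x) p < p / 2"
    using cT t p unfolding continuous_on_iff by (metis atLeastAtMost_iff half_gt_zero less_imp_le order_refl)
  obtain d2 where "d2 > 0" and "\<forall>r h. 0 \<le> r \<longrightarrow> \<bar>r - t\<bar> < d2 \<longrightarrow> 0 < h \<longrightarrow> h < d2 \<longrightarrow>
     (\<forall>x\<in>K. \<bar>u x (r + h) - T h (\<lambda>y. u y r + h * rhs u y r) x\<bar> \<le> p / 4 * h)"
    using euler_consistentD[OF solution_continuous(5)[OF u, of t], of "p / 4"] t p by auto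
  note d2 = this(1) this(2)[rule_format]
  define i where "i = 1 / L"
  have i: "i > 0" using L_pos by (simp add: i_def)
  define d where "d = min (min d1 d2) (min t i) / 2"
  have d: "0 < d" "d < d1" "d < d2" "d < t" and "d \<le> i"
    using d1(1) d2(1) t i unfolding d_def by (auto simp: min_def)
  then have "d \<le> 1 / L" by (simp add: i_def)
  then have dL: "d * L \<le> 1" using L_pos by (simp add: field_simps)
  define r where "r = t - d"
  have r: "r \<ge> 0" "\<bar>r - t\<bar> < d2" "r + d = t" using d by (auto simp: r_def)
  have cur: "continuous_on K (\<lambda>y. u y r)" "continuous_on K (\<lambda>y. rhs u y r)"
    using solution_continuous(3,4)[OF u r(1)] .
  have "T d (\<lambda>y. d * Q y r) x \<le> T d (\<lambda>y. u y r + d * rhs u y r) x"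
  proof (rule T_mono[OF _ _ _ _ x])
    show "continuous_on K (\<lambda>y. d * Q y r)" "continuous_on K (\<lambda>y. u y r + d * rhs u y r)"
      by (intro continuous_intros cQy r(1) cur)+
    fix y assume y: "y \<in> K"
    have uy: "u y r \<ge> 0" using u0[OF y] r(1) tau_pos by simp
    have "f (u y r) - f 0 \<le> L * u y r" using f_lip[of "u y r" 0] uy by simp
    then have "d * (f (u y r) - f 0) \<le> (d * L) * u y r" using d(1) by (simp add: mult.assoc)
    also have "\<dots> \<le> 1 * u y r" by (rule mult_right_mono[OF dL uy])
    finally show "d * Q y r \<le> u y r + d * rhs u y r" by (simp add: Q_def rhs_def g0(1) algebra_simps)
  qed (use d in simp)
  moreover have "T d (\<lambda>y. d * Q y r) x = d * T d (\<lambda>y. Q y r) x" by (rule T_scale[OF _ cQy[OF r(1)] x]) (use d in simp)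
  moreover have "T d (\<lambda>y. Q y r) x \<ge> p / 2"
    using d1(2)[of d] d unfolding r_def dist_real_def by (simp; argo)
  then have "d * T d (\<lambda>y. Q y r) x \<ge> d * (p / 2)" using d(1) by (intro mult_left_mono) auto
  moreover have "\<bar>u x (r + d) - T d (\<lambda>y. u y r + d * rhs u y r) x\<bar> \<le> p / 4 * d"
    by (rule d2(2)[OF r(1,2) d(1,3) x])
  moreover have "d * (p / 2) = p / 4 * d + p / 4 * d" by simp
  moreover have "p / 4 * d > 0" using p d(1) by simp
  ultimately show False unfolding r(3) ut by linarith
qed

lemma positive_forever:
  assumes u: "solution u" and u0: "\<And>x t. x \<in> K \<Longrightarrow> t \<ge> - \<tau> \<Longrightarrow> 0 \<le> u x t"
    and g0: "f 0 = g 0" "\<And>s. s > 0 \<Longrightarrow> g s > g 0"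
    and x: "x \<in> K" and s: "s > 0" "u x s > 0" and t: "t \<ge> s"
  shows "u x t > 0"
proof -
  have "u x t > 0" if "s \<le> t" "t \<le> s + real n * \<tau>" for n t
    using that
  proof (induction n arbitrary: t)
    case 0 then show ?case using s by simp
  next
    case (Suc n)
    define r where "r = max s (t - \<tau>)"
    have "u x r > 0" by (rule Suc.IH) (use Suc.prems tau_pos in \<open>auto simp: r_def algebra_simps\<close>)
    have r: "t > 0" "t - \<tau> \<le> r" "r \<le> t" using Suc.prems s tau_pos by (auto simp: r_def)
    show ?case by (rule positive_history_imp_positive[OF u u0 g0 x r \<open>u x r > 0\<close>])
  qed
  moreover obtain n where "(t - s) / \<tau> \<le> real n" using real_arch_simple by blast
  then have "t \<le> s + real n * \<tau>" using tau_pos by (simp add: field_simps)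
  ultimately show ?thesis using t by blast
qed

text \<open>For nonnegative \<open>u\<close> the delayed term is at least \<open>g 0 = f 0\<close>, so the right-hand side is at least \<open>- L u\<close>, and
the solution lies above that of the linear equation \<open>p' = A p - L p\<close>.\<close>

lemma solution_ge_damped_orbit:
  assumes u: "solution u" and u0: "\<And>x t. x \<in> K \<Longrightarrow> t \<ge> - \<tau> \<Longrightarrow> 0 \<le> u x t"
    and g0: "f 0 = g 0" "\<And>s. s > 0 \<Longrightarrow> g s > g 0"
    and x: "x \<in> K" and a: "a \<ge> 0" and t: "t \<ge> 0"
  shows "exp (- L * t) * T t (\<lambda>y. u y a) x \<le> u x (a + t)"
proof (rule field_le_epsilon)
  fix e :: real assume e: "e > 0"
  have cu: "continuous_on (K \<times> {-\<tau>..}) (\<lambda>(x, t). u x t)" by (rule solution_continuous(1)[OF u])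
  have cua: "continuous_on K (\<lambda>y. u y a)" by (rule solution_continuous(3)[OF u a])
  have g_ge: "g s \<ge> g 0" if "s \<ge> 0" for s using g0(2)[of s] that by (cases "s = 0") auto
  define p where "p y t = exp (- L * t) * T t (\<lambda>y. u y a) y" for y t
  have cp: "continuous_on (K \<times> {0..}) (\<lambda>(y, t). p y t)"
    using continuous_on_orbit[OF cua] unfolding p_def case_prod_beta' by (intro continuous_intros)
  have cshift: "continuous_on (K \<times> {0..}) (\<lambda>(y, t). u y (a + t))"
    by (rule jointly_continuous_reparametrize[OF cu]) (use a tau_pos in \<open>auto intro!: continuous_intros\<close>)
  have cps: "continuous_on K (\<lambda>y. p y t)" if "t \<ge> 0" for t using jointly_continuous_slice[OF cp, of t] that by simp
  have cus: "continuous_on K (\<lambda>y. u y (a + t))" "continuous_on K (\<lambda>y. rhs u y (a + t))" if "t \<ge> 0" for t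
    using solution_continuous(3,4)[OF u, of "a + t"] a that by auto
  have "p x t - u x (a + t) \<le> e"
  proof (rule comparison[where u = "\<lambda>y t. p y t - u y (a + t)" and R = "\<lambda>y t. - L * p y t - rhs u y (a + t)" and \<beta> = "\<lambda>_. e" and \<beta>' = "\<lambda>_. 0", OF _ _ order_refl _ _ _ _ t x])
    show "continuous_on (K \<times> {0..}) (\<lambda>(y, t). p y t - u y (a + t))"
      using cp cshift unfolding case_prod_beta' by (intro continuous_intros)
    show "continuous_on K (\<lambda>y. - L * p y t - rhs u y (a + t))" if "t \<ge> 0" for t
      by (intro continuous_intros cps cus that)
    show "euler_consistent (\<lambda>y t. p y t - u y (a + t)) (\<lambda>y t. - L * p y t - rhs u y (a + t)) t" if t: "t \<ge> 0" for t
    proof (rule euler_consistent_diff)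
      show "euler_consistent p (\<lambda>y t. - L * p y t) t"
        using euler_consistent_damped_orbit[OF cua _ t, of L] L_pos unfolding p_def[abs_def] by simp
      show "euler_consistent (\<lambda>y t. u y (a + t)) (\<lambda>y t. rhs u y (a + t)) t"
        by (rule euler_consistent_shift[OF solution_continuous(5)[OF u] a]) (use a t in simp)
    qed (auto intro!: continuous_intros cps cus)
    show "p y 0 - u y (a + 0) \<le> e" if "y \<in> K" for y using T_0[OF cua that] e by (simp add: p_def)
    fix t assume t: "(0::real) \<le> t" and hist: "\<And>s y. 0 \<le> s \<Longrightarrow> s \<le> t \<Longrightarrow> y \<in> K \<Longrightarrow> p y s - u y (a + s) \<le> e"
    show "\<exists>q<0. \<exists>d>0. \<forall>h. 0 < h \<and> h < d \<longrightarrow> (\<forall>y\<in>K. p y t - u y (a + t) + h * (- L * p y t - rhs u y (a + t)) \<le> e + h * q)"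
    proof (rule exI[of _ "- L * e"], intro conjI exI[of _ "1 / L"] allI impI ballI)
      show "- L * e < 0" using L_pos e by simp
      fix d y assume "0 < d \<and> d < 1 / L" and y: "y \<in> K"
      then have d: "0 < d" "d * L \<le> 1" using L_pos by (simp_all add: field_simps)
      have uy: "u y (a + t) \<ge> 0" using u0[OF y] a t tau_pos by simp
      have "g 0 \<le> avg (\<lambda>b. g (u y (a + t - b)))"
        by (rule avg_ge[OF continuous_on_g_history[OF cu y]]) (use a t g_ge u0[OF y] in auto)
      moreover have "f (u y (a + t)) - f 0 \<le> L * u y (a + t)" using f_lip[of "u y (a + t)" 0] uy by simp
      ultimately have "- rhs u y (a + t) \<le> L * u y (a + t)" using g0(1) by (simp add: rhs_def)
      then have "- L * p y t - rhs u y (a + t) \<le> - L * (p y t - u y (a + t))" by (simp add: algebra_simps)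
      then have "d * (- L * p y t - rhs u y (a + t)) \<le> d * (- L * (p y t - u y (a + t)))" using d(1) by (intro mult_left_mono) auto
      then have "p y t - u y (a + t) + d * (- L * p y t - rhs u y (a + t)) \<le> (1 - d * L) * (p y t - u y (a + t))"
        by (simp add: algebra_simps)
      also have "\<dots> \<le> (1 - d * L) * e" by (rule mult_left_mono) (use hist[OF t order_refl y] d in auto)
      finally show "p y t - u y (a + t) + d * (- L * p y t - rhs u y (a + t)) \<le> e + d * (- L * e)" by (simp add: algebra_simps)
    qed (use L_pos in simp)
  qed auto
  then show "exp (- L * t) * T t (\<lambda>y. u y a) x \<le> u x (a + t) + e" by (simp add: p_def)
qed

text \<open>The semigroup carries positivity to each point at some time, depending on the point; the delayed
  term keeps it there, so that by compactness one time serves for all points.\<close>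

lemma eventually_uniformly_positive:
  assumes u: "solution u" and u0: "\<And>x t. x \<in> K \<Longrightarrow> t \<ge> - \<tau> \<Longrightarrow> 0 \<le> u x t"
    and g0: "f 0 = g 0" "\<And>s. s > 0 \<Longrightarrow> g s > g 0"
    and T_pos: "\<And>v x x0. continuous_on K v \<Longrightarrow> (\<And>x. x \<in> K \<Longrightarrow> 0 \<le> v x) \<Longrightarrow> x0 \<in> K \<Longrightarrow> v x0 \<noteq> 0 \<Longrightarrow> x \<in> K \<Longrightarrow>
      \<exists>t\<ge>0. T t v x > 0"
    and nz: "x0 \<in> K" "s0 \<in> {-\<tau>..0}" "u x0 s0 \<noteq> 0"
  shows "\<exists>t1\<ge>0. \<exists>c>0. \<forall>x\<in>K. \<forall>t\<in>{t1..t1 + \<tau>}. c \<le> u x t"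
proof -
  have cu: "continuous_on (K \<times> {-\<tau>..}) (\<lambda>(x, t). u x t)" by (rule solution_continuous(1)[OF u])
  have us0: "u x0 s0 > 0" using u0[OF nz(1), of s0] nz by simp
  obtain s1 where s1: "s1 > - \<tau>" "s1 \<le> s0 + \<tau> / 2" "u x0 s1 > 0"
  proof -
    have "continuous_on {-\<tau>..} (u x0)" by (rule continuous_on_time[OF cu nz(1)])
    then obtain d where d: "d > 0" "\<And>s. s \<in> {-\<tau>..} \<Longrightarrow> dist s s0 < d \<Longrightarrow> dist (u x0 s) (u x0 s0) < u x0 s0"
      using us0 nz(2) unfolding continuous_on_iff by (metis atLeastAtMost_iff atLeast_iff)
    define s1 where "s1 = s0 + min d \<tau> / 2"
    have "dist (u x0 s1) (u x0 s0) < u x0 s0"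
      by (rule d(2)) (use d(1) tau_pos nz(2) in \<open>auto simp: s1_def dist_real_def\<close>)
    then have "u x0 s1 > 0" by (simp add: dist_real_def)
    moreover have "s1 > - \<tau>" "s1 \<le> s0 + \<tau> / 2" using d(1) tau_pos nz(2) by (auto simp: s1_def)
    ultimately show thesis using that by blast
  qed
  define a where "a = s1 + \<tau>"
  have a: "a > 0" using s1 by (simp add: a_def)
  have ua: "u x0 a > 0"
    by (rule positive_history_imp_positive[OF u u0 g0 nz(1) a, where s = s1]) (use s1 tau_pos in \<open>auto simp: a_def\<close>)
  have cua: "continuous_on K (\<lambda>y. u y a)" by (rule solution_continuous(3)[OF u]) (use a in simp)
  have "\<exists>s\<ge>a. u x s > 0" if x: "x \<in> K" for x
  proof -
    obtain t where t: "t \<ge> 0" "T t (\<lambda>y. u y a) x > 0"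
      using T_pos[OF cua _ nz(1) _ x] u0 ua a tau_pos by force
    have "0 < exp (- L * t) * T t (\<lambda>y. u y a) x" using t by simp
    also have "\<dots> \<le> u x (a + t)" by (rule solution_ge_damped_orbit[OF u u0 g0 x _ t(1)]) (use a in auto)
    finally show ?thesis using t(1) by (intro exI[of _ "a + t"]) simp
  qed
  then obtain s where s: "\<And>x. x \<in> K \<Longrightarrow> s x \<ge> a" "\<And>x. x \<in> K \<Longrightarrow> u x (s x) > 0" by metis
  have "\<exists>N. open N \<and> x \<in> N \<and> (\<forall>y\<in>K \<inter> N. u y (s x) > 0)" if x: "x \<in> K" for x
  proof -
    have "continuous_on K (\<lambda>y. u y (s x))" by (rule solution_continuous(3)[OF u]) (use s(1)[OF x] a in simp)
    then obtain d where d: "d > 0" "\<And>y. y \<in> K \<Longrightarrow> dist y x < d \<Longrightarrow> dist (u y (s x)) (u x (s x)) < u x (s x)"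
      using s(2)[OF x] x unfolding continuous_on_iff by metis
    show ?thesis
    proof (intro exI[of _ "ball x d"] conjI ballI)
      fix y assume "y \<in> K \<inter> ball x d"
      then have "dist (u y (s x)) (u x (s x)) < u x (s x)" by (intro d(2)) (auto simp: dist_commute)
      then show "u y (s x) > 0" by (simp add: dist_real_def)
    qed (use d in auto)
  qed
  then obtain N where N: "\<And>x. x \<in> K \<Longrightarrow> open (N x)" "\<And>x. x \<in> K \<Longrightarrow> x \<in> N x" "\<And>x y. x \<in> K \<Longrightarrow> y \<in> K \<Longrightarrow> y \<in> N x \<Longrightarrow> u y (s x) > 0"
    by (metis IntI)
  obtain F where F: "F \<subseteq> K" "finite F" "K \<subseteq> (\<Union>x\<in>F. N x)"
    using compactE_image[OF compact_K, of K N] N(1,2) by blast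
  have "F \<noteq> {}" using F(3) K_nonempty by auto
  define t1 where "t1 = Max (s ` F)"
  have t1: "s x \<le> t1" if "x \<in> F" for x using that F(2) by (simp add: t1_def)
  have "t1 \<in> s ` F" unfolding t1_def using F(2) \<open>F \<noteq> {}\<close> by (intro Max_in) auto
  then have "t1 \<ge> a" using s(1) F(1) by auto
  have pos: "u y t > 0" if y: "y \<in> K" and t: "t \<ge> t1" for y t
  proof -
    obtain x where x: "x \<in> F" "y \<in> N x" using F(3) y by blast
    then have "x \<in> K" using F(1) by blast
    show ?thesis
      by (rule positive_forever[OF u u0 g0 y _ N(3)[OF \<open>x \<in> K\<close> y x(2)]])
        (use s(1)[OF \<open>x \<in> K\<close>] a t1[OF x(1)] t in auto)
  qed
  have "K \<times> {t1..t1 + \<tau>} \<subseteq> K \<times> {-\<tau>..}" using \<open>t1 \<ge> a\<close> a tau_pos by auto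
  then have cc: "continuous_on (K \<times> {t1..t1 + \<tau>}) (\<lambda>(x, t). u x t)" by (rule continuous_on_subset[OF cu])
  have cK: "compact (K \<times> {t1..t1 + \<tau>})" by (intro compact_Times compact_K compact_Icc)
  have ne: "K \<times> {t1..t1 + \<tau>} \<noteq> {}" using K_nonempty tau_pos by auto
  obtain p where p: "p \<in> K \<times> {t1..t1 + \<tau>}" "\<And>q. q \<in> K \<times> {t1..t1 + \<tau>} \<Longrightarrow> (case p of (x, t) \<Rightarrow> u x t) \<le> (case q of (x, t) \<Rightarrow> u x t)"
    using continuous_attains_inf[OF cK ne cc] by blast
  show ?thesis
  proof (rule exI[of _ t1], rule conjI)
    show "t1 \<ge> 0" using \<open>t1 \<ge> a\<close> a by simp
    have "0 < (case p of (x, t) \<Rightarrow> u x t)" using p(1) pos by auto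
    moreover have "\<forall>x\<in>K. \<forall>t\<in>{t1..t1 + \<tau>}. (case p of (x, t) \<Rightarrow> u x t) \<le> u x t"
      using p(2) by (force simp del: atLeastAtMost_iff)
    ultimately show "\<exists>c>0. \<forall>x\<in>K. \<forall>t\<in>{t1..t1 + \<tau>}. c \<le> u x t" by blast
  qed
qed

end

section \<open>Convergence to the equilibrium\<close>

context delay_equation
begin

text \<open>Let \<open>Lo\<close> and \<open>U\<close> be the lower and upper limits. From \<open>f U \<le> max g\<close> and \<open>min g \<le> f Lo\<close>
  over \<open>[Lo, U]\<close> one gets \<open>U \<le> B\<close>, then \<open>U \<le> A\<close>, then \<open>Lo \<ge> M\<close>. On \<open>[M, A]\<close> the function
  \<open>f\<close> expands more than \<open>g\<close> does, so that \<open>f U - f Lo \<le> max g - min g\<close> forces \<open>U = Lo\<close>. The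
  solution thus converges, and near the equilibrium the decay is exponential.\<close>

lemma exponential_convergence:
  assumes u: "solution u" and u0: "\<And>x t. x \<in> K \<Longrightarrow> t \<ge> - \<tau> \<Longrightarrow> 0 \<le> u x t"
    and T_pos: "\<And>v x x0. continuous_on K v \<Longrightarrow> (\<And>x. x \<in> K \<Longrightarrow> 0 \<le> v x) \<Longrightarrow> x0 \<in> K \<Longrightarrow> v x0 \<noteq> 0 \<Longrightarrow> x \<in> K \<Longrightarrow>
      \<exists>t\<ge>0. T t v x > 0"
    and nz: "x0 \<in> K" "s0 \<in> {-\<tau>..0}" "u x0 s0 \<noteq> 0"
    and g0: "f 0 = g 0" "\<And>s. s > 0 \<Longrightarrow> g s > g 0"
    and M: "M > 0" "\<And>s. s \<ge> 0 \<Longrightarrow> g s \<le> g M"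
    and order: "M < c" "c < A" "A \<le> B" and fc: "f c = g c"
    and large: "\<And>s v. s > B \<Longrightarrow> 0 \<le> v \<Longrightarrow> v \<le> s \<Longrightarrow> g v < f s"
    and below: "\<And>s v. 0 < s \<Longrightarrow> s < c \<Longrightarrow> s \<le> v \<Longrightarrow> v \<le> c \<Longrightarrow> f s < g v"
    and fA: "\<And>s. A < s \<Longrightarrow> s \<le> B \<Longrightarrow> f A < f s" "g M \<le> f A"
    and fM: "\<And>s. 0 \<le> s \<Longrightarrow> s < M \<Longrightarrow> f s < f M"
    and gA: "\<And>s. c \<le> s \<Longrightarrow> s \<le> A \<Longrightarrow> f M \<le> g s"
    and k: "0 \<le> k'" "k' < k"
    and f_exp: "\<And>s t. M \<le> s \<Longrightarrow> s \<le> t \<Longrightarrow> t \<le> A \<Longrightarrow> k * (t - s) \<le> f t - f s"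
    and g_contr: "\<And>s t. M \<le> s \<Longrightarrow> s \<le> t \<Longrightarrow> t \<le> A \<Longrightarrow> \<bar>g t - g s\<bar> \<le> k' * (t - s)"
  shows "\<exists>C>0. \<exists>\<gamma>>0. \<forall>t\<ge>0. \<forall>x\<in>K. \<bar>u x t - c\<bar> \<le> C * exp (- \<gamma> * t)"
proof -
  have cu: "continuous_on (K \<times> {-\<tau>..}) (\<lambda>(x, t). u x t)" by (rule solution_continuous(1)[OF u])
  have g_contr': "\<bar>g t - g s\<bar> \<le> k' * \<bar>t - s\<bar>" if "s \<in> {M..A}" "t \<in> {M..A}" for s t
  proof (cases "s \<le> t")
    case True then show ?thesis using g_contr[of s t] that by simp
  next
    case False then show ?thesis using g_contr[of t s] that by (simp add: abs_minus_commute)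
  qed
  \<comment> \<open>an upper bound for all times\<close>
  obtain H where H: "H > B" "\<And>x. x \<in> K \<Longrightarrow> u x 0 \<le> H"
  proof -
    obtain b where "\<And>x. x \<in> K \<Longrightarrow> \<bar>u x 0\<bar> \<le> b"
      using bounded_on_K[OF solution_continuous(3)[OF u order_refl]] by metis
    then have "\<And>x. x \<in> K \<Longrightarrow> u x 0 \<le> max (B + 1) b" by (metis abs_le_D1 max.coboundedI2)
    then show thesis using that[of "max (B + 1) b"] by simp
  qed
  have hi: "u x t \<le> H" if "t \<ge> 0" "x \<in> K" for x t
  proof (rule solution_upper_barrier[OF u order_refl, where \<beta> = "\<lambda>_. H" and \<beta>' = "\<lambda>_. 0", OF _ H(2) _ that])
    fix t assume t: "(0::real) \<le> t"
    show "\<exists>q. (\<forall>x\<in>K. avg (\<lambda>b. g (u x (t - b))) \<le> q) \<and> - f H + q < 0"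
    proof (rule exI[of _ "g M"], rule conjI)
      show "\<forall>x\<in>K. avg (\<lambda>b. g (u x (t - b))) \<le> g M"
        using u0 t M(2) by (intro ballI avg_le[OF continuous_on_g_history[OF cu _ t]]) auto
      show "- f H + g M < 0" using large[of H M] H(1) M(1) order by simp
    qed
  qed auto
  \<comment> \<open>a positive lower bound for all large times\<close>
  have "\<exists>t1\<ge>0. \<exists>c0>0. \<forall>x\<in>K. \<forall>t\<in>{t1..t1 + \<tau>}. c0 \<le> u x t"
    by (rule eventually_uniformly_positive[OF u u0 g0 T_pos nz])
  then obtain t1 c0 where t1: "t1 \<ge> 0" and c0: "c0 > 0" "\<And>x t. x \<in> K \<Longrightarrow> t \<in> {t1..t1 + \<tau>} \<Longrightarrow> c0 \<le> u x t"
    by (elim exE conjE) auto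
  have "c \<le> H" using order H(1) by simp
  obtain s1 where s1: "s1 \<in> {c..H}" "\<And>s. s \<in> {c..H} \<Longrightarrow> g s1 \<le> g s"
    using continuous_attains_inf[of "{c..H}" g] continuous_on_g \<open>c \<le> H\<close> by auto
  have m0: "g s1 > f 0" using g0 s1(1) M(1) order by simp
  \<comment> \<open>the last term keeps \<open>f l\<close> below \<open>g s1\<close>, the minimum of \<open>g\<close> on \<open>[c, H]\<close>\<close>
  define l where "l = min c0 (min (c / 2) ((g s1 - f 0) / (2 * L)))"
  have l: "l > 0" "l \<le> c0" "l < c" "L * l < g s1 - f 0"
  proof -
    show "l > 0" "l \<le> c0" "l < c" using c0(1) M(1) order m0 L_pos by (auto simp: l_def)
    have "L * l \<le> L * ((g s1 - f 0) / (2 * L))" using L_pos by (intro mult_left_mono) (auto simp: l_def)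
    also have "\<dots> = (g s1 - f 0) / 2" using L_pos by simp
    finally show "L * l < g s1 - f 0" using m0 by simp
  qed
  have fl: "f l < g s" if "l \<le> s" "s \<le> H" for s
  proof (cases "s \<le> c")
    case True then show ?thesis using below[OF l(1,3) that(1)] by simp
  next
    case False
    have "f l \<le> f 0 + L * l" using f_lip[of l 0] l(1) by simp
    also have "\<dots> < g s1" using l(4) by simp
    also have "\<dots> \<le> g s" using s1(2) False that by simp
    finally show ?thesis .
  qed
  obtain s2 where s2: "s2 \<in> {l..H}" "\<And>s. s \<in> {l..H} \<Longrightarrow> g s2 \<le> g s"
    using continuous_attains_inf[of "{l..H}" g] continuous_on_g \<open>c \<le> H\<close> l(3) by auto
  have lo: "l \<le> u x t" if "t \<ge> t1 + \<tau>" "x \<in> K" for x t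
  proof (rule solution_lower_barrier[OF u, where \<alpha> = "\<lambda>_. l" and \<alpha>' = "\<lambda>_. 0", OF _ _ _ _ that])
    show "0 \<le> t1 + \<tau>" using t1 tau_pos by simp
    show "l \<le> u x (t1 + \<tau>)" if "x \<in> K" for x using c0(2)[OF that, of "t1 + \<tau>"] l(2) tau_pos by simp
    fix t assume t: "t1 + \<tau> \<le> t" and hist: "\<And>s x. t1 + \<tau> \<le> s \<Longrightarrow> s \<le> t \<Longrightarrow> x \<in> K \<Longrightarrow> l \<le> u x s"
    have t': "t \<ge> 0" using t t1 tau_pos by simp
    show "\<exists>q. (\<forall>x\<in>K. q \<le> avg (\<lambda>b. g (u x (t - b)))) \<and> 0 < - f l + q"
    proof (rule exI[of _ "g s2"], intro conjI ballI)
      show "0 < - f l + g s2" using fl s2(1) by simp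
      fix x assume x: "x \<in> K"
      show "g s2 \<le> avg (\<lambda>b. g (u x (t - b)))"
      proof (rule avg_ge[OF continuous_on_g_history[OF cu x t']], rule s2(2))
        fix a assume a: "a \<in> {0..\<tau>}"
        have "l \<le> u x (t - a)"
        proof (cases "t - a \<ge> t1 + \<tau>")
          case True then show ?thesis using hist[OF True _ x] a by simp
        next
          case False then show ?thesis using c0(2)[OF x, of "t - a"] l(2) a t by simp
        qed
        moreover have "u x (t - a) \<le> H" by (rule hi[OF _ x]) (use a t t1 in simp)
        ultimately show "u x (t - a) \<in> {l..H}" by simp
      qed
    qed
  qed auto
  \<comment> \<open>the upper and lower limits\<close>
  have u00: "0 \<le> u x t" if "t \<ge> 0" "x \<in> K" for x t using u0[OF that(2), of t] that(1) tau_pos by simp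
  define U Lo where "U = upper_limit K u" and "Lo = lower_limit K u"
  have LoU: "Lo \<le> U" unfolding U_def Lo_def by (rule lower_limit_le_upper_limit[OF K_nonempty u00 hi])
  have "eventually_le K (\<lambda>x t. - u x t) (- l)"
    unfolding eventually_le_def using lo t1 tau_pos by (intro exI[of _ "t1 + \<tau>"]) auto
  from upper_limit_le[where lo = "- H", OF K_nonempty _ this] hi have "Lo \<ge> l"
    unfolding Lo_def lower_limit_def by force
  then have Lo_pos: "Lo > 0" using l(1) by simp
  obtain p where p: "p \<in> {Lo..U}" "\<And>s. s \<in> {Lo..U} \<Longrightarrow> g s \<le> g p"
    using continuous_attains_sup[of "{Lo..U}" g] continuous_on_g LoU by auto
  obtain q where q: "q \<in> {Lo..U}" "\<And>s. s \<in> {Lo..U} \<Longrightarrow> g q \<le> g s"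
    using continuous_attains_inf[of "{Lo..U}" g] continuous_on_g LoU by auto
  have fU: "f U \<le> g p"
    unfolding U_def by (rule f_upper_limit_le_max_g[OF u u00 hi]) (use p(2) in \<open>auto simp: U_def Lo_def\<close>)
  have fLo: "g q \<le> f Lo"
    unfolding Lo_def by (rule f_lower_limit_ge_min_g[OF u u00 hi]) (use q(2) in \<open>auto simp: U_def Lo_def\<close>)
  have "U \<le> B"
  proof (rule ccontr)
    assume "\<not> U \<le> B"
    then have "g p < f U" using large[of U p] p(1) Lo_pos by simp
    then show False using fU by simp
  qed
  have UA: "U \<le> A"
  proof (rule ccontr)
    assume "\<not> U \<le> A"
    then have "f A < f U" using fA(1)[of U] \<open>U \<le> B\<close> by simp
    moreover have "g p \<le> g M" using M(2)[of p] p(1) Lo_pos by simp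
    ultimately show False using fU fA(2) by simp
  qed
  have LoM: "M \<le> Lo"
  proof (rule ccontr)
    assume Lo: "\<not> M \<le> Lo"
    have "f Lo < g q"
    proof (cases "q \<le> c")
      case True then show ?thesis using below[of Lo q] Lo Lo_pos order q(1) by simp
    next
      case False then show ?thesis using fM[of Lo] gA[of q] Lo Lo_pos q(1) UA by simp
    qed
    then show False using fLo by simp
  qed
  have "k * (U - Lo) \<le> f U - f Lo" by (rule f_exp[OF LoM LoU UA])
  also have "\<dots> \<le> \<bar>g p - g q\<bar>" using fU fLo by simp
  also have "\<dots> \<le> k' * \<bar>p - q\<bar>" by (rule g_contr') (use p(1) q(1) LoM UA in auto)
  also have "\<dots> \<le> k' * (U - Lo)" using p(1) q(1) k(1) by (intro mult_left_mono) auto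
  finally have "U \<le> Lo" using k(2) by (smt (verit) mult_strict_right_mono)
  then have eq: "Lo = U" using LoU by simp
  have "p = U" "q = U" using p(1) q(1) eq by auto
  then have fU_eq: "f U = g U" using fU fLo eq by simp
  have "U = c"
  proof (rule ccontr)
    assume "U \<noteq> c"
    have "k * \<bar>U - c\<bar> \<le> \<bar>f U - f c\<bar>"
    proof (cases "c \<le> U")
      case True then show ?thesis using f_exp[of c U] order UA by simp
    next
      case False then show ?thesis using f_exp[of U c] order LoM eq by simp
    qed
    also have "\<dots> \<le> k' * \<bar>U - c\<bar>" unfolding fU_eq fc by (rule g_contr') (use order UA LoM eq in auto)
    finally show False using \<open>U \<noteq> c\<close> k(2) by (smt (verit) mult_strict_right_mono)
  qed
  \<comment> \<open>exponential decay near the equilibrium\<close>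
  define r where "r = min (c - M) (A - c)"
  have r: "r > 0" using order by (simp add: r_def)
  obtain a where a: "a \<ge> 0" "\<And>t x. t \<ge> a \<Longrightarrow> x \<in> K \<Longrightarrow> lower_limit K u - r \<le> u x t \<and> u x t \<le> upper_limit K u + r"
    using eventually_between_limits[where K = K and u = u, OF u00 hi r] by blast
  show ?thesis
  proof (rule solution_exponential_decay[OF u a(1) r _ fc k])
    show "\<bar>u x t - c\<bar> \<le> r" if "t \<ge> a" "x \<in> K" for t x
      using a(2)[OF that] \<open>U = c\<close> eq unfolding U_def Lo_def by (simp add: abs_le_iff)
    fix s assume s: "\<bar>s - c\<bar> \<le> r"
    then have sMA: "M \<le> s" "s \<le> A" by (auto simp: r_def abs_le_iff)
    show "k * (s - c)\<^sup>2 \<le> (f s - f c) * (s - c)"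
    proof (cases "c \<le> s")
      case True
      have "k * (s - c) * (s - c) \<le> (f s - f c) * (s - c)"
        by (rule mult_right_mono[OF f_exp]) (use True sMA order in auto)
      then show ?thesis by (simp add: power2_eq_square mult.assoc)
    next
      case False
      have "k * (c - s) * (c - s) \<le> (f c - f s) * (c - s)"
        by (rule mult_right_mono[OF f_exp]) (use False sMA order in auto)
      then show ?thesis by (simp add: power2_eq_square algebra_simps)
    qed
    show "\<bar>g s - g c\<bar> \<le> k' * \<bar>s - c\<bar>" by (rule g_contr') (use sMA order in auto)
  qed
qed

end

lemma DERIV_abs_le_of_lipschitz:
  fixes f :: "real \<Rightarrow> real"
  assumes "(f has_real_derivative D) (at x)" and lip: "\<And>r s. \<bar>f r - f s\<bar> \<le> L * \<bar>r - s\<bar>"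
  shows "\<bar>D\<bar> \<le> L"
proof (rule tendsto_upperbound)
  show "((\<lambda>h. \<bar>(f (x + h) - f x) / h\<bar>) \<longlongrightarrow> \<bar>D\<bar>) (at 0)"
    using assms(1) unfolding DERIV_def by (rule tendsto_rabs)
  show "\<forall>\<^sub>F h in at 0. \<bar>(f (x + h) - f x) / h\<bar> \<le> L"
    unfolding eventually_at using lip[of "x + h" x for h]
    by (intro exI[of _ 1]) (auto simp: abs_divide divide_simps)
qed simp

lemma steady_state_equilibrium:
  fixes \<Omega> :: "'a::euclidean_space set"
  assumes "dissipative_semigroup (closure \<Omega>) T" and "c \<ge> 0" and "f c = g c" and "integral {0..\<tau>} h = 1"
  shows "steady_state \<Omega> T f g h \<tau> c"
proof -
  interpret dissipative_semigroup "closure \<Omega>" T by (rule assms(1))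
  have "reaction f g h \<tau> (segment (\<lambda>x t. c) s) = (\<lambda>_::'a. 0)" for s
    by (rule ext) (simp add: reaction_def segment_def assms)
  moreover have "integral {0..t} (\<lambda>s. T (t - s) (\<lambda>_. 0) x) = 0" if "x \<in> closure \<Omega>" for t x
  proof -
    have "integral {0..t} (\<lambda>s. T (t - s) (\<lambda>_. 0) x) = integral {0..t} (\<lambda>s. 0)"
      by (intro integral_cong) (simp add: T_const that)
    then show ?thesis by simp
  qed
  ultimately show ?thesis
    unfolding steady_state_def mild_solution_def using assms(2) by (simp add: T_const case_prod_beta')
qed

theorem theorem4p4:
  fixes \<Omega> :: "'a::euclidean_space set"
    and T :: "real \<Rightarrow> ('a \<Rightarrow> real) \<Rightarrow> 'a \<Rightarrow> real"
    and f g h G :: "real \<Rightarrow> real"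
    and \<tau> B M A ustar :: real
  assumes tau: "\<tau> > 0"
    and domain: "bounded_smooth_domain \<Omega>"
    and semigroup: "neumann_heat_semigroup \<Omega> T"
    and h_pos: "\<forall>a\<in>{0..\<tau>}. h a > 0"
    and h_integrable: "h absolutely_integrable_on {0..\<tau>}"
    and h_integral: "integral {0..\<tau>} h = 1"
    and T1: "\<exists>L. L-lipschitz_on UNIV f" "\<exists>L. L-lipschitz_on UNIV g" "f 0 = g 0"
    and T2: "\<forall>s>0. g s > g 0" "B > 0" "\<forall>s>B. (SUP v\<in>{0..s}. g v) < f s"
    and ustar_pos: "ustar > 0"
    and below: "\<forall>s. 0 < s \<and> s < ustar \<longrightarrow> (INF \<sigma>\<in>{s..ustar}. g \<sigma>) > f s"
    and above: "\<forall>s. ustar < s \<and> s \<le> B \<longrightarrow> (SUP \<sigma>\<in>{ustar..s}. g \<sigma>) < f s"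
    and deriv_zero: "f differentiable (at 0)" "g differentiable (at 0)"
      "deriv g 0 > deriv f 0" "deriv f 0 > 0"
    and f_gt: "\<forall>s>0. f s > f 0"
    and M_unique_max: "\<forall>m. (m > 0 \<and> (\<forall>s\<ge>0. g s \<le> g m)) \<longleftrightarrow> m = M"
    and g_mono: "mono_on {0<..<M} g" "antimono_on {M<..<B} g"
    and ustar_M: "ustar > M"
    and f_M: "\<forall>s. 0 \<le> s \<and> s < M \<longrightarrow> f s < f M" "\<forall>s. M < s \<and> s \<le> B \<longrightarrow> f s > f M"
    and A_set: "{s\<in>{M<..B}. g s = f M} \<noteq> {}"
    and A_min: "A = (LEAST s. s \<in> {s\<in>{M<..B}. g s = f M})"
    and f_A: "\<forall>s. ustar \<le> s \<and> s < A \<longrightarrow> f s < f A" "\<forall>s. A < s \<and> s \<le> B \<longrightarrow> f s > f A"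
      "f A \<ge> g M"
    and differentiable: "\<forall>s. f differentiable (at s)" "\<forall>s. g differentiable (at s)"
    and f_strict: "strict_mono_on {M..A} f"
    and G: "\<forall>s\<in>{M..A}. G s = the_inv_into {M..A} f (g s)"
    and H: "mono_on {M..A} (\<lambda>s. (f s - f 0) * (g s - g 0)) \<or>
      mono_on {M..A} (\<lambda>s. f s + g s) \<or>
      mono_on {M..A} (\<lambda>s. (f s - f 0) * (g s - g 0) + f s + g s) \<or>
      antimono_on {M..ustar} (\<lambda>s. (G \<circ> G) s / s) \<or>
      antimono_on {ustar..A} (\<lambda>s. (G \<circ> G) s / s)"
    and deriv_gap: "(INF s\<in>{M..A}. deriv f s) > (SUP s\<in>{M..A}. \<bar>deriv g s\<bar>)"
  shows "steady_state \<Omega> T f g h \<tau> ustar \<and> globally_exponentially_stable \<Omega> T f g h \<tau> ustar"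
proof -
  obtain Lf Lg where Lf: "Lf-lipschitz_on UNIV f" and Lg: "Lg-lipschitz_on UNIV g" using T1 by blast
  define L where "L = max Lf Lg + 1"
  have "Lf \<ge> 0" using Lf by (rule lipschitz_on_nonneg)
  then have L: "L > 0" by (simp add: L_def)
  have f_lip: "\<bar>f r - f s\<bar> \<le> L * \<bar>r - s\<bar>" and g_lip: "\<bar>g r - g s\<bar> \<le> L * \<bar>r - s\<bar>" for r s
  proof -
    have "\<bar>f r - f s\<bar> \<le> Lf * \<bar>r - s\<bar>" "\<bar>g r - g s\<bar> \<le> Lg * \<bar>r - s\<bar>"
      using lipschitz_onD[OF Lf, of r s] lipschitz_onD[OF Lg, of r s] by (simp_all add: dist_real_def)
    moreover have "Lf * \<bar>r - s\<bar> \<le> L * \<bar>r - s\<bar>" "Lg * \<bar>r - s\<bar> \<le> L * \<bar>r - s\<bar>"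
      by (intro mult_right_mono; simp add: L_def)+
    ultimately show "\<bar>f r - f s\<bar> \<le> L * \<bar>r - s\<bar>" "\<bar>g r - g s\<bar> \<le> L * \<bar>r - s\<bar>" by linarith+
  qed
  have diss: "dissipative_semigroup (closure \<Omega>) T" by (rule neumann_dissipative_semigroup[OF domain semigroup])
  have weight: "probability_weight h \<tau>" by unfold_locales (use tau h_pos h_integrable h_integral in auto)
  have delay: "delay_equation (closure \<Omega>) T h \<tau> f g L"
    by (intro delay_equation.intro diss weight delay_equation_axioms.intro L f_lip g_lip)
  interpret delay_equation "closure \<Omega>" T h \<tau> f g L by (rule delay)
  have bdd: "bdd_below (g ` {a..b})" "bdd_above (g ` {a..b})" for a b
    using compact_continuous_image[OF continuous_on_g compact_Icc, of a b]
    by (auto intro: bounded_imp_bdd_below bounded_imp_bdd_above compact_imp_bounded)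
  \<comment> \<open>the extremal conditions, pointwise\<close>
  have below': "f s < g v" if "0 < s" "s < ustar" "s \<le> v" "v \<le> ustar" for s v
    using below that cINF_lower[OF bdd(1)[of s ustar], of v] by (meson atLeastAtMost_iff less_le_trans)
  have above': "g v < f s" if "ustar < s" "s \<le> B" "ustar \<le> v" "v \<le> s" for s v
    using above that cSUP_upper[OF _ bdd(2)[of ustar s], of v] by (meson atLeastAtMost_iff le_less_trans)
  have large: "g v < f s" if "s > B" "0 \<le> v" "v \<le> s" for s v
    using T2(3) that cSUP_upper[OF _ bdd(2)[of 0 s], of v] by (meson atLeastAtMost_iff le_less_trans)
  have M: "M > 0" "\<And>s. s \<ge> 0 \<Longrightarrow> g s \<le> g M" using M_unique_max by blast+
  \<comment> \<open>the position of \<open>A\<close>\<close>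
  have gfM: "f M < g v" if "M \<le> v" "v \<le> ustar" for v using below'[OF M(1) ustar_M that] .
  have A: "A \<in> {M<..B}" "g A = f M"
  proof -
    have "closed (g -` {f M})" by (rule closed_vimage[OF _ continuous_on_g]) simp
    from compact_Int_closed[OF compact_Icc this] have cS: "compact ({M..B} \<inter> g -` {f M})" .
    have S: "{s\<in>{M<..B}. g s = f M} = {M..B} \<inter> g -` {f M}"
      using gfM[of M] ustar_M by (auto simp: less_le)
    obtain m where m: "m \<in> {s\<in>{M<..B}. g s = f M}" "\<And>s. s \<in> {s\<in>{M<..B}. g s = f M} \<Longrightarrow> m \<le> s"
      using compact_attains_inf[OF cS] A_set unfolding S by blast
    have "A = m" unfolding A_min by (rule Least_equality) (use m in auto)
    then show "A \<in> {M<..B}" "g A = f M" using m(1) by auto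
  qed
  have uA: "ustar < A" using gfM[of A] A by force
  \<comment> \<open>the equilibrium\<close>
  have equilibrium: "f ustar = g ustar"
  proof (rule antisym)
    show "f ustar \<le> g ustar"
    proof (rule field_le_epsilon)
      fix e :: real assume e: "e > 0"
      \<comment> \<open>close enough to \<open>ustar\<close> for the Lipschitz bound to cost at most \<open>e\<close>\<close>
      define s where "s = max (ustar / 2) (ustar - e / L)"
      have s: "0 < s" "s < ustar" "ustar - s \<le> e / L" using ustar_pos e L by (auto simp: s_def)
      have "f ustar \<le> f s + L * (ustar - s)" using f_lip[of ustar s] s(2) by simp
      also have "L * (ustar - s) \<le> e" using s(3) L by (simp add: field_simps)
      finally show "f ustar \<le> g ustar + e" using below'[OF s(1,2), of ustar] s(2) by simp
    qed
    show "g ustar \<le> f ustar"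
    proof (rule field_le_epsilon)
      fix e :: real assume e: "e > 0"
      define s where "s = min A (ustar + e / L)"
      have s: "s \<le> B" "ustar < s" "s - ustar \<le> e / L" using uA e L A by (auto simp: s_def)
      have "f s \<le> f ustar + L * (s - ustar)" using f_lip[of s ustar] s(2) by simp
      also have "L * (s - ustar) \<le> e" using s(3) L by (simp add: field_simps)
      finally show "g ustar \<le> f ustar + e" using above'[OF s(2,1), of ustar] s(2) by simp
    qed
  qed
  have gA: "f M \<le> g s" if s: "ustar \<le> s" "s \<le> A" for s
  proof (cases "s = A")
    case False
    show ?thesis
    proof (rule field_le_epsilon)
      fix e :: real assume e: "e > 0"
      define r where "r = max s (A - e / L)"
      have r: "s \<le> r" "r < A" "A - r \<le> e / L" using s False e L by (auto simp: r_def)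
      have "g A \<le> g r + L * (A - r)" using g_lip[of A r] r(2) by simp
      also have "L * (A - r) \<le> e" using r(3) L by (simp add: field_simps)
      also have "g r \<le> g s"
        using g_mono(2) r s A ustar_M unfolding monotone_on_def by auto
      finally show "f M \<le> g s + e" using A(2) by simp
    qed
  qed (use A in simp)
  \<comment> \<open>the derivative gap\<close>
  define k k' where "k = (INF s\<in>{M..A}. deriv f s)" and "k' = (SUP s\<in>{M..A}. \<bar>deriv g s\<bar>)"
  have df: "(f has_real_derivative deriv f s) (at s)" and dg: "(g has_real_derivative deriv g s) (at s)" for s
    using differentiable by (auto simp: DERIV_deriv_iff_real_differentiable)
  have bf: "\<bar>deriv f s\<bar> \<le> L" and bg: "\<bar>deriv g s\<bar> \<le> L" for s
    using DERIV_abs_le_of_lipschitz[OF df f_lip] DERIV_abs_le_of_lipschitz[OF dg g_lip] .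
  have kf: "k \<le> deriv f s" if "s \<in> {M..A}" for s
    unfolding k_def
  proof (rule cINF_lower[OF _ that])
    show "bdd_below (deriv f ` {M..A})" by (rule bdd_belowI2[of _ "- L"]) (use bf in \<open>simp add: abs_le_iff minus_le_iff\<close>)
  qed
  have kg: "\<bar>deriv g s\<bar> \<le> k'" if "s \<in> {M..A}" for s
    unfolding k'_def
  proof (rule cSUP_upper[OF that])
    show "bdd_above ((\<lambda>s. \<bar>deriv g s\<bar>) ` {M..A})" by (rule bdd_aboveI2[of _ _ L]) (rule bg)
  qed
  have k: "0 \<le> k'" "k' < k" using kg[of A] A deriv_gap by (auto simp: k_def k'_def intro: order_trans[OF abs_ge_zero])
  have f_exp: "k * (t - s) \<le> f t - f s" if "M \<le> s" "s \<le> t" "t \<le> A" for s t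
  proof (cases "s = t")
    case False
    then have "s < t" using that by simp
    from MVT2[OF this, of f "deriv f"] df obtain z where z: "s < z" "z < t" "f t - f s = (t - s) * deriv f z" by auto
    have "(t - s) * k \<le> (t - s) * deriv f z" using kf[of z] z that by (intro mult_left_mono) auto
    then show ?thesis using z(3) by (simp add: mult.commute)
  qed simp
  have g_contr: "\<bar>g t - g s\<bar> \<le> k' * (t - s)" if "M \<le> s" "s \<le> t" "t \<le> A" for s t
  proof (cases "s = t")
    case False
    then have "s < t" using that by simp
    from MVT2[OF this, of g "deriv g"] dg obtain z where z: "s < z" "z < t" "g t - g s = (t - s) * deriv g z" by auto
    have "(t - s) * \<bar>deriv g z\<bar> \<le> (t - s) * k'" using kg[of z] z that by (intro mult_left_mono) auto
    then show ?thesis using z that by (simp add: abs_mult mult.commute)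
  qed simp
  have T_pos: "\<exists>t\<ge>0. T t v x > 0"
    if "continuous_on (closure \<Omega>) v" "\<And>x. x \<in> closure \<Omega> \<Longrightarrow> 0 \<le> v x" "x0 \<in> closure \<Omega>" "v x0 \<noteq> 0" "x \<in> closure \<Omega>" for v x x0
    by (rule neumann_heat_positive[OF domain semigroup that])
  have "globally_exponentially_stable \<Omega> T f g h \<tau> ustar"
    unfolding globally_exponentially_stable_def
  proof (intro ballI impI)
    fix \<phi> :: "'a \<Rightarrow> real \<Rightarrow> real" assume "\<exists>x\<in>closure \<Omega>. \<exists>\<theta>\<in>{-\<tau>..0}. \<phi> x \<theta> \<noteq> 0"
    then obtain x0 s0 where nz: "x0 \<in> closure \<Omega>" "s0 \<in> {-\<tau>..0}" "\<phi> x0 s0 \<noteq> 0" by blast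
    show "\<exists>C>0. \<exists>\<gamma>>0. \<forall>u. mild_solution \<Omega> T f g h \<tau> \<phi> u \<longrightarrow>
           (\<forall>x\<in>closure \<Omega>. \<forall>t\<ge>0. \<bar>u x t - ustar\<bar> \<le> C * exp (- \<gamma> * t))"
    proof (cases "\<exists>u. mild_solution \<Omega> T f g h \<tau> \<phi> u")
      case False
      then show ?thesis by (auto intro!: exI[of _ 1])
    next
      case True
      then obtain v where v: "mild_solution \<Omega> T f g h \<tau> \<phi> v" by blast
      have sol: "solution u" and nonneg: "\<And>x t. x \<in> closure \<Omega> \<Longrightarrow> t \<ge> - \<tau> \<Longrightarrow> 0 \<le> u x t"
        and init: "\<And>x t. x \<in> closure \<Omega> \<Longrightarrow> t \<in> {-\<tau>..0} \<Longrightarrow> u x t = \<phi> x t" if "mild_solution \<Omega> T f g h \<tau> \<phi> u" for u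
        using solution_mild[OF that refl] that unfolding mild_solution_def by auto
      have v0: "v x0 s0 \<noteq> 0" using init[OF v] nz by simp
      have "\<exists>C>0. \<exists>\<gamma>>0. \<forall>t\<ge>0. \<forall>x\<in>closure \<Omega>. \<bar>v x t - ustar\<bar> \<le> C * exp (- \<gamma> * t)"
        by (rule exponential_convergence[OF sol[OF v] nonneg[OF v] T_pos nz(1,2) v0 T1(3) T2(1)[rule_format] M ustar_M uA _
              equilibrium large below' f_A(2)[rule_format, OF conjI] f_A(3) f_M(1)[rule_format, OF conjI] gA k f_exp g_contr])
          (use A(1) in auto)
      then obtain C \<gamma> where C: "C > 0" "\<gamma> > 0" "\<forall>t\<ge>0. \<forall>x\<in>closure \<Omega>. \<bar>v x t - ustar\<bar> \<le> C * exp (- \<gamma> * t)"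
        by (elim exE conjE)
      \<comment> \<open>the constants obtained from one solution serve for all, as there is no other\<close>
      have "\<bar>u x t - ustar\<bar> \<le> C * exp (- \<gamma> * t)" if u: "mild_solution \<Omega> T f g h \<tau> \<phi> u" and x: "x \<in> closure \<Omega>" and t: "t \<ge> 0" for u x t
      proof -
        have "u x t = v x t" by (rule solution_unique[OF sol[OF u] sol[OF v] _ t x]) (use init[OF u] init[OF v] in simp)
        then show ?thesis using C(3) t x by simp
      qed
      then show ?thesis using C(1,2) by blast
    qed
  qed
  moreover have "steady_state \<Omega> T f g h \<tau> ustar"
    by (rule steady_state_equilibrium[where f = f and g = g and c = ustar, OF diss less_imp_le[OF ustar_pos] equilibrium h_integral])
  ultimately show ?thesis by blast
qed

end
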